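(* Assume that the keyed hash function $\mathsf H$ is interpreted by a PRF family. Then for every $m\ge1$ the KCL$^+$ protocol with two tags $\mathsf A$ and $\mathsf B$ satisfies $m$-Fixed Trace Privacy. That is, for all $p,q\ge0$ with $p+q=m$, every sequence of actions $(\alpha_i)_{1\le i\le m}$ with $\alpha_i\in\{\mathrm{ReaderInit},\mathrm{ReaderMsg},\mathrm{TagInit}_1,\mathrm{TagInit}_2,\mathrm{TagMsg}_1,\mathrm{TagMsg}_2\}$ for $i\le p$ and $\alpha_i\in\{\mathrm{ReaderInit},\mathrm{ReaderMsg},\mathrm{TagInit}_1,\mathrm{TagMsg}_1\}$ for $i>p$, and every computational model $\mathcal M$ in which $\mathsf H$ is a PRF family, $$\mathcal M\models\ \phi_{m+1},\,g_{\mathrm{guess}}(\phi_{m+1})\ \sim\ \tilde\phi_{m+1},\,g_{\mathrm{guess}}(\tilde\phi_{m+1}),$$ where $g_{\mathrm{guess}}$ is an attacker function symbol and $\phi,\tilde\phi$ are the frames of the KCL$^+$ protocol for this sequence of actions (defined in the context), in which during the second phase ($i>p$) the tag designated by index $1$ is $\mathsf A$ on the left and $\mathsf B$ on the right.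
   Context: Terms and models. Terms are built from a countable set of names (sort $\mathsf{Nonce}$), function symbols $\mathcal F$ and attacker function symbols $\mathcal G$. $\mathcal F$ contains the keyed hash $\mathsf H:\mathsf{term}\times\mathsf{Nonce}\to\mathsf{Nonce}$, $\oplus:\mathsf{Nonce}\times\mathsf{Nonce}\to\mathsf{Nonce}$, pairing $\langle\_,\_\rangle$, $\pi_1,\pi_2$, $\mathsf{EQ}$, $\mathsf{if\,then\,else}$, $\mathsf{true},\mathsf{false}$, $\mathbf 0$, and constants $\mathsf A,\mathsf B$ of sort $\mathsf{Nonce}$ (the identities) and constants for the natural numbers. In a computational model, for security parameter $\eta$ and infinite uniform random tapes $\rho_1$ (honest) and $\rho_2$ (attacker), names are disjoint $\eta$-bit blocks of $\rho_1$; $\oplus$ is bitwise xor on $\eta$-bit strings, and $\mathsf{EQ},\mathsf{if\,then\,else},\mathsf{true},\mathsf{false},\mathbf 0$ have their expected meaning; every other $f\in\mathcal F$ is a deterministic polynomial-time function of $1^\eta$ and the argument values (sort $\mathsf{Nonce}$ = strings of length $\eta$); each $g\in\mathcal G$ is a polynomial-time machine applied to $1^\eta$, the argument values and $\rho_2$. $\mathcal M\models\vec u\sim\vec v$ iff for every deterministic polynomial-time $\mathcal A$, $|\Pr_{\rho_1,\rho_2}(\mathcal A([\![\vec u]\!],1^\eta,\rho_2)=1)-\Pr_{\rho_1,\rho_2}(\mathcal A([\![\vec v]\!],1^\eta,\rho_2)=1)|$ is negligible in $\eta$. Projections satisfy $\pi_1(\langle x,y\rangle)=x$ and $\pi_2(\langle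 x,y\rangle)=y$. PRF. $\mathsf H(\cdot,k):\{0,1\}^*\to\{0,1\}^\eta$ is a PRF family if for every probabilistic polynomial-time oracle adversary $\mathcal A$, $|\Pr(\mathcal A^{\mathsf H(\cdot,k)}(1^\eta)=1)-\Pr(\mathcal A^{g(\cdot)}(1^\eta)=1)|$ is negligible, where $k$ is uniform in $\{0,1\}^\eta$ and $g$ is a uniformly random function $\{0,1\}^*\to\{0,1\}^\eta$. KCL$^+$ protocol. Tag $\mathsf{Id}\in\{\mathsf A,\mathsf B\}$ shares a secret key with the reader, a name $\mathsf k_{\mathsf{Id}}$ ($\mathsf k_{\mathsf A}\neq\mathsf k_{\mathsf B}$). The reader sends a fresh name $\mathsf n_R$; the tag draws a fresh name $\mathsf n_T$ and answers $\langle\mathsf{Id}\oplus\mathsf H(\mathsf n_T,\mathsf k_{\mathsf{Id}}),\ \mathsf n_T\oplus\mathsf H(\mathsf n_R,\mathsf k_{\mathsf{Id}})\rangle$; the reader sends no further message. Frames. $\phi_1$ is the empty sequence and $\phi_{i+1}=\phi_i,t_i$ for $1\le i\le m$, where $t_i$ is the answer to action $\alpha_i$: for $\mathrm{ReaderInit}$, $t_i=\langle j,\mathsf n_R\rangle$ with $\mathsf n_R$ a fresh name and $j$ the constant index of the new session (number of previous $\mathrm{ReaderInit}$ actions plus one); for $\mathrm{TagMsg}_l$, $t_i=\langle\mathsf{Id}\oplus\mathsf H(\mathsf n_T,\mathsf k_{\mathsf{Id}}),\ \mathsf n_T\oplus\mathsf H(g_l(\phi_i),\mathsf k_{\mathsf{Id}})\rangle$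 with $\mathsf n_T$ a fresh name, $g_l\in\mathcal G$, and $\mathsf{Id}$ the tag designated by $l$; for $\mathrm{ReaderMsg}$ and $\mathrm{TagInit}_l$, $t_i=\mathbf 0$. Fresh means not used elsewhere. In the first phase ($i\le p$), index $1$ designates $\mathsf A$ and index $2$ designates $\mathsf B$. In the second phase ($i>p$), index $1$ designates $\mathsf A$ in the left frame $\phi$ and $\mathsf B$ in the right frame $\tilde\phi$ (which is otherwise defined in the same way, using $\tilde\phi_i$ in place of $\phi_i$). No tag may be corrupted. *)

theory Defs
  imports "HOL-Probability.Probability" "HOL-Computational_Algebra.Polynomial"
begin

section \<open>Polynomial-time machines\<close>

type_synonym bits = "bool list"
type_synonym tape = "nat \<Rightarrow> bool"
type_synonym oracle_fun = "bits \<Rightarrow> bits"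

text \<open>
  Machines are structured programs over finitely many registers, each of which is a stack of bits
  whose top is the head of the list. Every elementary instruction costs one step. Two stacks make
  one tape, so up to polynomial factors this is the multi-tape Turing machine. A machine also has
  an infinite read-only tape of random bits, read one bit at a time and possibly again from its
  beginning, and an oracle; a query replaces the contents of a register by the answer to it.
\<close>

datatype cmd =
    Skip
  | Push nat bool
  | Pop nat
  | Flip nat
  | Rewind
  | Query nat
  | Seq cmd cmd
  | Branch nat cmd cmd cmd
  | Loop nat cmd

text \<open>Register contents, and the position of the head on the random tape.\<close>

type_synonym config = "(nat \<Rightarrow> bits) \<times> nat"

text \<open>
  \<open>exec Or \<rho> c s t s'\<close>: with oracle \<open>Or\<close> and random tape \<open>\<rho>\<close>, the program \<open>c\<close> started in \<open>s\<close> halts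
  in \<open>s'\<close> after \<open>t\<close> steps. \<open>Branch r\<close> distinguishes whether \<open>r\<close> is empty, has top bit 0, or has top
  bit 1; \<open>Loop r\<close> iterates as long as \<open>r\<close> is nonempty.
\<close>

inductive exec :: "oracle_fun \<Rightarrow> tape \<Rightarrow> cmd \<Rightarrow> config \<Rightarrow> nat \<Rightarrow> config \<Rightarrow> bool"
  for Or :: oracle_fun and \<rho> :: tape where
  Skip: "exec Or \<rho> Skip s 1 s"
| Push: "exec Or \<rho> (Push r b) (R, h) 1 (R(r := b # R r), h)"
| Pop: "exec Or \<rho> (Pop r) (R, h) 1 (R(r := tl (R r)), h)"
| Flip: "exec Or \<rho> (Flip r) (R, h) 1 (R(r := \<rho> h # R r), Suc h)"
| Rewind: "exec Or \<rho> Rewind (R, h) 1 (R, 0)"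
| Query: "exec Or \<rho> (Query r) (R, h) 1 (R(r := Or (R r)), h)"
| Seq: "exec Or \<rho> c1 s t1 s1 \<Longrightarrow> exec Or \<rho> c2 s1 t2 s2 \<Longrightarrow> exec Or \<rho> (Seq c1 c2) s (t1 + t2) s2"
| BranchEmpty: "R r = [] \<Longrightarrow> exec Or \<rho> ce (R, h) t s' \<Longrightarrow>
    exec Or \<rho> (Branch r ce c0 c1) (R, h) (Suc t) s'"
| Branch0: "R r = False # w \<Longrightarrow> exec Or \<rho> c0 (R, h) t s' \<Longrightarrow>
    exec Or \<rho> (Branch r ce c0 c1) (R, h) (Suc t) s'"
| Branch1: "R r = True # w \<Longrightarrow> exec Or \<rho> c1 (R, h) t s' \<Longrightarrow>
    exec Or \<rho> (Branch r ce c0 c1) (R, h) (Suc t) s'"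
| LoopEnd: "R r = [] \<Longrightarrow> exec Or \<rho> (Loop r c) (R, h) 1 (R, h)"
| LoopStep: "R r \<noteq> [] \<Longrightarrow> exec Or \<rho> c (R, h) t1 s1 \<Longrightarrow> exec Or \<rho> (Loop r c) s1 t2 s2 \<Longrightarrow>
    exec Or \<rho> (Loop r c) (R, h) (Suc (t1 + t2)) s2"

definition initial :: "bits list \<Rightarrow> config" where
  "initial xs = ((\<lambda>i. if i < length xs then xs ! i else []), 0)"

text \<open>The output is the final content of register 0.\<close>

definition computes_within :: "oracle_fun \<Rightarrow> tape \<Rightarrow> cmd \<Rightarrow> bits list \<Rightarrow> nat \<Rightarrow> bits \<Rightarrow> bool" where
  "computes_within Or \<rho> c xs T y \<longleftrightarrow>
     (\<exists>t R h. exec Or \<rho> c (initial xs) t (R, h) \<and> t \<le> T \<and> R 0 = y)"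

definition unary :: "nat \<Rightarrow> bits" where
  "unary \<eta> = replicate \<eta> True"

text \<open>
  Polynomial-time functions of the security parameter (in unary), argument values satisfying \<open>D\<close>,
  and a random tape. The result may not depend on the oracle, so queries are of no use here. A
  deterministic function that has no random tape is one whose result does not depend on \<open>\<rho>\<close> either.
\<close>

definition ptime :: "(nat \<Rightarrow> bits list \<Rightarrow> bool) \<Rightarrow> (nat \<Rightarrow> bits list \<Rightarrow> tape \<Rightarrow> bits) \<Rightarrow> bool" where
  "ptime D f \<longleftrightarrow> (\<exists>c (p :: nat poly). \<forall>\<eta> xs Or \<rho>. D \<eta> xs \<longrightarrow>
     computes_within Or \<rho> c (unary \<eta> # xs) (poly p (\<eta> + sum_list (map length xs))) (f \<eta> xs \<rho>))"

definition ptime_det :: "(nat \<Rightarrow> bits list \<Rightarrow> bool) \<Rightarrow> (nat \<Rightarrow> bits list \<Rightarrow> bits) \<Rightarrow> bool" where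
  "ptime_det D f \<longleftrightarrow> ptime D (\<lambda>\<eta> xs \<rho>. f \<eta> xs)"

text \<open>
  Probabilistic polynomial-time oracle machines with input \<open>1\<^sup>\<eta>\<close>. Running time is measured against
  oracles that answer with strings of length \<open>\<eta>\<close>, the only ones that occur.
\<close>

definition oracle_ptime :: "(nat \<Rightarrow> oracle_fun \<Rightarrow> tape \<Rightarrow> bits) \<Rightarrow> bool" where
  "oracle_ptime f \<longleftrightarrow> (\<exists>c (p :: nat poly). \<forall>\<eta> Or \<rho>. (\<forall>x. length (Or x) = \<eta>) \<longrightarrow>
     computes_within Or \<rho> c [unary \<eta>] (poly p \<eta>) (f \<eta> Or \<rho>))"


section \<open>Probabilities and pseudo-random functions\<close>

definition negligible :: "(nat \<Rightarrow> real) \<Rightarrow> bool" where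
  "negligible f \<longleftrightarrow> (\<forall>c :: nat. \<forall>\<^sub>F \<eta> in sequentially. \<bar>f \<eta>\<bar> < 1 / real \<eta> ^ c)"

definition random_tape :: "tape measure" where
  "random_tape = (\<Pi>\<^sub>M i\<in>UNIV. uniform_count_measure UNIV)"

definition uniform_bits :: "nat \<Rightarrow> bits measure" where
  "uniform_bits \<eta> = uniform_count_measure {w. length w = \<eta>}"

definition random_function :: "nat \<Rightarrow> oracle_fun measure" where
  "random_function \<eta> = (\<Pi>\<^sub>M x\<in>UNIV. uniform_bits \<eta>)"

text \<open>The second argument of the keyed function is the message, the third one the key.\<close>

definition prf_family :: "(nat \<Rightarrow> bits \<Rightarrow> bits \<Rightarrow> bits) \<Rightarrow> bool" where
  "prf_family H \<longleftrightarrow> (\<forall>Adv. oracle_ptime Adv \<longrightarrow> negligible (\<lambda>\<eta>.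
     \<bar>\<P>((k, \<rho>) in uniform_bits \<eta> \<Otimes>\<^sub>M random_tape. Adv \<eta> (\<lambda>x. H \<eta> x k) \<rho> = [True])
      - \<P>((g, \<rho>) in random_function \<eta> \<Otimes>\<^sub>M random_tape. Adv \<eta> g \<rho> = [True])\<bar>))"


section \<open>Terms and computational models\<close>

datatype tag = TagA | TagB

text \<open>Attacker symbols are overloaded: each stands for one function symbol per number of arguments.\<close>

datatype attacker_sym = G nat | Guess

datatype trm =
    Name nat
  | Hash trm trm
  | Xor trm trm
  | Pair trm trm
  | Proj1 trm
  | Proj2 trm
  | Eq trm trm
  | Ite trm trm trm
  | Tru
  | Fls
  | Zero
  | Ident tag
  | Num nat
  | Att attacker_sym "trm list"

text \<open>
  The interpretations that a model is free to choose; the argument of type \<^typ>\<open>nat\<close> that precedes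
  the bit strings is the security parameter. \<open>i_att M g n\<close> interprets \<open>g\<close> with \<open>n\<close> arguments.
\<close>

record model =
  i_hash :: "nat \<Rightarrow> bits \<Rightarrow> bits \<Rightarrow> bits"
  i_pair :: "nat \<Rightarrow> bits \<Rightarrow> bits \<Rightarrow> bits"
  i_proj1 :: "nat \<Rightarrow> bits \<Rightarrow> bits"
  i_proj2 :: "nat \<Rightarrow> bits \<Rightarrow> bits"
  i_ident :: "tag \<Rightarrow> nat \<Rightarrow> bits"
  i_num :: "nat \<Rightarrow> nat \<Rightarrow> bits"
  i_att :: "attacker_sym \<Rightarrow> nat \<Rightarrow> nat \<Rightarrow> bits list \<Rightarrow> tape \<Rightarrow> bits"

definition computational_model :: "model \<Rightarrow> bool" where
  "computational_model M \<longleftrightarrow>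
     ptime_det (\<lambda>\<eta> xs. length xs = 2 \<and> length (xs ! 1) = \<eta>) (\<lambda>\<eta> xs. i_hash M \<eta> (xs ! 0) (xs ! 1)) \<and>
     (\<forall>\<eta> x k. length k = \<eta> \<longrightarrow> length (i_hash M \<eta> x k) = \<eta>) \<and>
     ptime_det (\<lambda>\<eta> xs. length xs = 2) (\<lambda>\<eta> xs. i_pair M \<eta> (xs ! 0) (xs ! 1)) \<and>
     ptime_det (\<lambda>\<eta> xs. length xs = 1) (\<lambda>\<eta> xs. i_proj1 M \<eta> (xs ! 0)) \<and>
     ptime_det (\<lambda>\<eta> xs. length xs = 1) (\<lambda>\<eta> xs. i_proj2 M \<eta> (xs ! 0)) \<and>
     (\<forall>\<eta> x y. i_proj1 M \<eta> (i_pair M \<eta> x y) = x \<and> i_proj2 M \<eta> (i_pair M \<eta> x y) = y) \<and>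
     (\<forall>a. ptime_det (\<lambda>\<eta> xs. xs = []) (\<lambda>\<eta> xs. i_ident M a \<eta>) \<and>
           (\<forall>\<eta>. length (i_ident M a \<eta>) = \<eta>)) \<and>
     (\<forall>j. ptime_det (\<lambda>\<eta> xs. xs = []) (\<lambda>\<eta> xs. i_num M j \<eta>)) \<and>
     (\<forall>g n. ptime (\<lambda>\<eta> xs. length xs = n) (i_att M g n))"

text \<open>Names are the consecutive blocks of \<open>\<eta>\<close> bits of the honest tape.\<close>

definition block :: "nat \<Rightarrow> tape \<Rightarrow> nat \<Rightarrow> bits" where
  "block \<eta> \<rho> n = map (\<lambda>i. \<rho> (n * \<eta> + i)) [0..<\<eta>]"

primrec eval :: "model \<Rightarrow> nat \<Rightarrow> tape \<Rightarrow> tape \<Rightarrow> trm \<Rightarrow> bits" where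
  "eval M \<eta> \<rho>1 \<rho>2 (Name n) = block \<eta> \<rho>1 n"
| "eval M \<eta> \<rho>1 \<rho>2 (Hash t k) = i_hash M \<eta> (eval M \<eta> \<rho>1 \<rho>2 t) (eval M \<eta> \<rho>1 \<rho>2 k)"
| "eval M \<eta> \<rho>1 \<rho>2 (Xor t u) = map2 (\<noteq>) (eval M \<eta> \<rho>1 \<rho>2 t) (eval M \<eta> \<rho>1 \<rho>2 u)"
| "eval M \<eta> \<rho>1 \<rho>2 (Pair t u) = i_pair M \<eta> (eval M \<eta> \<rho>1 \<rho>2 t) (eval M \<eta> \<rho>1 \<rho>2 u)"
| "eval M \<eta> \<rho>1 \<rho>2 (Proj1 t) = i_proj1 M \<eta> (eval M \<eta> \<rho>1 \<rho>2 t)"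
| "eval M \<eta> \<rho>1 \<rho>2 (Proj2 t) = i_proj2 M \<eta> (eval M \<eta> \<rho>1 \<rho>2 t)"
| "eval M \<eta> \<rho>1 \<rho>2 (Eq t u) = [eval M \<eta> \<rho>1 \<rho>2 t = eval M \<eta> \<rho>1 \<rho>2 u]"
| "eval M \<eta> \<rho>1 \<rho>2 (Ite b t u) =
     (if eval M \<eta> \<rho>1 \<rho>2 b = [True] then eval M \<eta> \<rho>1 \<rho>2 t else eval M \<eta> \<rho>1 \<rho>2 u)"
| "eval M \<eta> \<rho>1 \<rho>2 Tru = [True]"
| "eval M \<eta> \<rho>1 \<rho>2 Fls = [False]"
| "eval M \<eta> \<rho>1 \<rho>2 Zero = replicate \<eta> False"
| "eval M \<eta> \<rho>1 \<rho>2 (Ident a) = i_ident M a \<eta>"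
| "eval M \<eta> \<rho>1 \<rho>2 (Num j) = i_num M j \<eta>"
| "eval M \<eta> \<rho>1 \<rho>2 (Att g ts) = i_att M g (length ts) \<eta> (map (eval M \<eta> \<rho>1 \<rho>2) ts) \<rho>2"

definition indistinguishable :: "model \<Rightarrow> trm list \<Rightarrow> trm list \<Rightarrow> bool" where
  "indistinguishable M us vs \<longleftrightarrow> length us = length vs \<and>
     (\<forall>Adv. ptime (\<lambda>\<eta> xs. length xs = length us) Adv \<longrightarrow> negligible (\<lambda>\<eta>.
       \<bar>\<P>((\<rho>1, \<rho>2) in random_tape \<Otimes>\<^sub>M random_tape. Adv \<eta> (map (eval M \<eta> \<rho>1 \<rho>2) us) \<rho>2 = [True])
        - \<P>((\<rho>1, \<rho>2) in random_tape \<Otimes>\<^sub>M random_tape. Adv \<eta> (map (eval M \<eta> \<rho>1 \<rho>2) vs) \<rho>2 = [True])\<bar>))"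


section \<open>The KCL+ protocol\<close>

datatype action = ReaderInit | ReaderMsg | TagInit nat | TagMsg nat

definition phase1_actions :: "action set" where
  "phase1_actions = {ReaderInit, ReaderMsg, TagInit 1, TagInit 2, TagMsg 1, TagMsg 2}"

definition phase2_actions :: "action set" where
  "phase2_actions = {ReaderInit, ReaderMsg, TagInit 1, TagMsg 1}"

definition key :: "tag \<Rightarrow> trm" where
  "key a = Name (case a of TagA \<Rightarrow> 0 | TagB \<Rightarrow> 1)"

text \<open>The fresh name of the \<open>i\<close>-th action, for \<open>i \<ge> 1\<close>; it is distinct from both keys.\<close>

definition fresh :: "nat \<Rightarrow> trm" where
  "fresh i = Name (i + 1)"

definition tag_answer :: "tag \<Rightarrow> trm \<Rightarrow> trm \<Rightarrow> trm" where
  "tag_answer a nT x = Pair (Xor (Ident a) (Hash nT (key a))) (Xor nT (Hash x (key a)))"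

datatype side = LeftSide | RightSide

text \<open>
  The tag designated by index \<open>l\<close> in the \<open>i\<close>-th action, when the first phase has \<open>p\<close> actions.
  Index 2 does not occur in the second phase.
\<close>

definition designated :: "side \<Rightarrow> nat \<Rightarrow> nat \<Rightarrow> nat \<Rightarrow> tag" where
  "designated s p i l =
     (if i \<le> p then (if l = 1 then TagA else TagB)
      else (case s of LeftSide \<Rightarrow> TagA | RightSide \<Rightarrow> TagB))"

definition answer :: "side \<Rightarrow> nat \<Rightarrow> (nat \<Rightarrow> action) \<Rightarrow> nat \<Rightarrow> trm list \<Rightarrow> trm" where
  "answer s p \<alpha> i \<phi> = (case \<alpha> i of
       ReaderInit \<Rightarrow> Pair (Num (card {j \<in> {1..<i}. \<alpha> j = ReaderInit} + 1)) (fresh i)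
     | TagMsg l \<Rightarrow> tag_answer (designated s p i l) (fresh i) (Att (G l) \<phi>)
     | ReaderMsg \<Rightarrow> Zero
     | TagInit l \<Rightarrow> Zero)"

text \<open>\<open>frame s p \<alpha> i\<close> lists the answers to \<open>\<alpha> 1, \<dots>, \<alpha> (i - 1)\<close>.\<close>

fun frame :: "side \<Rightarrow> nat \<Rightarrow> (nat \<Rightarrow> action) \<Rightarrow> nat \<Rightarrow> trm list" where
  "frame s p \<alpha> 0 = []"
| "frame s p \<alpha> (Suc 0) = []"
| "frame s p \<alpha> (Suc (Suc i)) =
     frame s p \<alpha> (Suc i) @ [answer s p \<alpha> (Suc i) (frame s p \<alpha> (Suc i))]"

end

theory Submission
  imports Defs
begin

text \<open>
  The tags are idealised one at a time: in a hybrid argument all answers of one tag are replaced by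
  pairs of fresh random words. When both tags have been idealised, the frames no longer depend on
  which tag is designated, so the left and the right frame are equal.

  For one tag, the PRF assumption first replaces its keyed hash by a random function \<open>g\<close>; the
  distinguisher runs the whole protocol and queries its oracle for every hash of this tag. It is then
  enough to couple the game with answers \<open>\<langle>Id \<oplus> g(n\<^sub>i), n\<^sub>i \<oplus> g(x\<^sub>i)\<rangle>\<close>, where \<open>x\<^sub>i\<close> is the message of
  the attacker, with the game with uniform answers \<open>\<langle>u\<^sub>i, w\<^sub>i\<rangle>\<close>. Given \<open>u\<close>, \<open>w\<close> and \<open>g\<close>, let the \<open>x\<^sub>i\<close>
  be computed from the uniform answers, put \<open>n\<^sub>i = w\<^sub>i \<oplus> g(x\<^sub>i)\<close>, and reprogram \<open>g\<close> to \<open>Id \<oplus> u\<^sub>i\<close> at each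
  \<open>n\<^sub>i\<close>. For fixed \<open>g\<close> the map \<open>w \<mapsto> n\<close> is a bijection, because \<open>x\<^sub>i\<close> depends only on earlier answers,
  and the reprogrammed function is again uniform since the \<open>u\<^sub>i\<close> are. So the new nonces and oracle are
  distributed as in the real game, and its answers are \<open>\<langle>u\<^sub>i, w\<^sub>i\<rangle>\<close> unless \<open>n\<^sub>i = n\<^sub>j\<close> for some \<open>i \<noteq> j\<close> or
  \<open>n\<^sub>i = x\<^sub>j\<close>. Each of these events has probability at most \<open>2\<^sup>-\<^sup>\<eta>\<close>: the \<open>n\<^sub>i\<close> are uniform, and \<open>n\<^sub>i = x\<^sub>j\<close>
  determines the value of the uniform \<open>g\<close> at \<open>x\<^sub>i\<close>, where \<open>x\<close> does not depend on \<open>g\<close>.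
\<close>

section \<open>Programming the machines\<close>

text \<open>\<open>prf_family\<close> quantifies over programs, and a model supplies its symbols
  only through programs. The distinguisher must therefore be assembled as a program, although a
  model's program is only known to work from fresh registers and from position 0 of a tape; hence
  the relocation of registers and tape. Moreover the distinguisher has a single random tape, whereas
  a model has an honest and an attacker tape: the first \<open>2 * m + 3\<close> blocks of its tape
  act as the names and the rest as \<open>\<rho>2\<close>.

  The two changes of variables in the coupling are kept apart because they need different things
  fixed. The passage from \<open>w\<close> to the nonces is a bijection only for a fixed oracle, so
  it takes place under the integral over the oracle, and it uses the oracle before reprogramming.
  Reprogramming preserves the measure only at fixed points, so it takes place for fixed nonces.
  Averaging over finitely many vectors of names, instead of treating names as random variables, lets
  both be exchanged with the probability over oracle and tape.\<close>

definition pbound :: "(nat \<Rightarrow> nat) \<Rightarrow> bool" where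
  "pbound T \<longleftrightarrow> (\<exists>p :: nat poly. \<forall>n. T n \<le> poly p n)"

lemma poly_nat_mono: "x \<le> y \<Longrightarrow> poly (p :: nat poly) x \<le> poly p y"
  by (induction p) (auto intro!: add_mono mult_mono)

lemma pbound_const: "pbound (\<lambda>n. k)"
  unfolding pbound_def by (rule exI[of _ "[:k:]"]) simp

lemma pbound_id: "pbound (\<lambda>n. n)"
  unfolding pbound_def by (rule exI[of _ "[:0, 1:]"]) simp

lemma pbound_add: "pbound S \<Longrightarrow> pbound T \<Longrightarrow> pbound (\<lambda>n. S n + T n)"
  unfolding pbound_def by (metis poly_add add_mono)

lemma pbound_mult: "pbound S \<Longrightarrow> pbound T \<Longrightarrow> pbound (\<lambda>n. S n * T n)"
  unfolding pbound_def by (metis poly_mult mult_le_mono)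

lemma pbound_poly:
  assumes "pbound T"
  shows "pbound (\<lambda>n. poly p (T n))"
proof -
  obtain q where "\<And>n. T n \<le> poly q n"
    using assms by (auto simp: pbound_def)
  then have "poly p (T n) \<le> poly (pcompose p q) n" for n
    by (simp add: poly_pcompose poly_nat_mono)
  then show ?thesis
    by (auto simp: pbound_def)
qed

lemmas pbound_intros = pbound_const pbound_id pbound_add pbound_mult pbound_poly

section \<open>Executions with a time bound\<close>

definition runs :: "oracle_fun \<Rightarrow> tape \<Rightarrow> cmd \<Rightarrow> config \<Rightarrow> nat \<Rightarrow> config \<Rightarrow> bool" where
  "runs Or \<rho> c s T s' \<longleftrightarrow> (\<exists>t\<le>T. exec Or \<rho> c s t s')"

lemma runs_mono: "runs Or \<rho> c s T s' \<Longrightarrow> T \<le> U \<Longrightarrow> runs Or \<rho> c s U s'"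
  unfolding runs_def by (meson order_trans)

lemma exec_runs: "exec Or \<rho> c s t s' \<Longrightarrow> runs Or \<rho> c s t s'"
  unfolding runs_def by auto

lemma runs_Seq:
  "runs Or \<rho> c s T s1 \<Longrightarrow> runs Or \<rho> d s1 U s2 \<Longrightarrow> runs Or \<rho> (Seq c d) s (T + U) s2"
  unfolding runs_def by (meson exec.Seq add_mono)

text \<open>A query may return a string of any length, so growth by at most one bit per step is
  available for an oracle with empty answers. This suffices to bound results that are the same for
  all oracles.\<close>

lemma exec_length:
  assumes "exec Or \<rho> c s t s'" and "Or = (\<lambda>_. [])"
  shows "length (fst s' r) \<le> length (fst s r) + t"
  using assms
proof (induction arbitrary: r rule: exec.induct)
  case (Seq c1 s t1 s1 c2 t2 s2)
  then show ?case by (meson add_le_mono1 le_trans add.assoc[THEN eq_refl])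
next
  case (LoopStep R r' c h t1 s1 t2 s2)
  have "length (fst s1 r) \<le> length (R r) + t1" "length (fst s2 r) \<le> length (fst s1 r) + t2"
    using LoopStep by auto
  then show ?case by simp
qed (auto simp: le_SucI)

text \<open>Only registers that are written count: the register tested by \<open>Branch\<close> or
  \<open>Loop\<close> is merely read.\<close>

primrec width :: "cmd \<Rightarrow> nat" where
  "width Skip = 0"
| "width (Push r b) = Suc r"
| "width (Pop r) = Suc r"
| "width (Flip r) = Suc r"
| "width Rewind = 0"
| "width (Query r) = Suc r"
| "width (Seq c d) = max (width c) (width d)"
| "width (Branch r ce c0 c1) = max (width ce) (max (width c0) (width c1))"
| "width (Loop r c) = width c"

lemma exec_above_width:
  "exec Or \<rho> c s t s' \<Longrightarrow> width c \<le> r \<Longrightarrow> fst s' r = fst s r"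
  by (induction rule: exec.induct) auto

section \<open>Elementary programs for moving data and skipping tape\<close>

text \<open>Moving reverses the string.\<close>

definition move :: "nat \<Rightarrow> nat \<Rightarrow> cmd" where
  "move x y = Loop x (Branch x Skip (Seq (Pop x) (Push y False)) (Seq (Pop x) (Push y True)))"

text \<open>Four steps per bit: the loop test, the branch, \<open>Pop\<close> and
  \<open>Push\<close>; one more step leaves the loop.\<close>

lemma exec_move:
  assumes "x \<noteq> y"
  shows "exec Or \<rho> (move x y) (R, h) (4 * length (R x) + 1) (R(x := [], y := rev (R x) @ R y), h)"
proof (induction "R x" arbitrary: R)
  case Nil
  then have eq: "R(x := [], y := rev (R x) @ R y) = R" by auto
  show ?case
    unfolding eq using exec.LoopEnd[of R x] Nil by (simp add: move_def)
next
  case (Cons a w)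
  let ?S = "R(x := w, y := a # R y)"
  let ?B = "Branch x Skip (Seq (Pop x) (Push y False)) (Seq (Pop x) (Push y True))"
  have Rx: "R x = a # w" using Cons(2) by simp
  have *: "exec Or \<rho> (Seq (Pop x) (Push y b)) (R, h) 2 (R(x := w, y := b # R y), h)" for b
    using exec.Seq[OF exec.Pop[of Or \<rho> x R h] exec.Push[of Or \<rho> y b "R(x := tl (R x))" h]] assms
    by (simp add: Rx numeral_2_eq_2)
  have "exec Or \<rho> ?B (R, h) 3 (?S, h)"
    using exec.Branch0[OF _ *, of x w] exec.Branch1[OF _ *, of x w] Rx
    by (cases a) (simp_all add: numeral_3_eq_3 numeral_2_eq_2)
  moreover have "exec Or \<rho> (move x y) (?S, h) (4 * length w + 1) (?S(x := [], y := rev w @ ?S y), h)"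
    using Cons(1)[of ?S] assms by simp
  moreover have "?S(x := [], y := rev w @ ?S y) = R(x := [], y := rev (R x) @ R y)"
    using assms Rx by (simp add: fun_eq_iff)
  ultimately show ?case
    using exec.LoopStep[of R x Or \<rho> ?B h 3 "(?S, h)" "4 * length w + 1"] Rx
    by (simp add: move_def)
qed

lemma runs_move:
  assumes "x \<noteq> y"
  shows "runs Or \<rho> (move x y) (R, h) (4 * length (R x) + 1) (R(x := [], y := rev (R x) @ R y), h)"
  by (rule exec_runs[OF exec_move[OF assms]])

text \<open>Two reversals restore the order of the bits; \<open>t\<close> is scratch space.\<close>

definition transfer :: "nat \<Rightarrow> nat \<Rightarrow> nat \<Rightarrow> cmd" where
  "transfer t x y = Seq (move x t) (move t y)"

lemma runs_transfer:
  assumes "x \<noteq> t" "t \<noteq> y" "x \<noteq> y" "R t = []" "R y = []"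
  shows "runs Or \<rho> (transfer t x y) (R, h) (8 * length (R x) + 2) (R(x := [], y := R x), h)"
proof -
  let ?S = "R(x := [], t := rev (R x) @ R t)"
  have "?S(t := [], y := rev (?S t) @ ?S y) = R(x := [], y := R x)"
    using assms by auto
  then show ?thesis
    using runs_Seq[OF runs_move[of x t Or \<rho> R h] runs_move[of t y Or \<rho> ?S h]] assms
    by (simp add: transfer_def algebra_simps)
qed

text \<open>Computed arguments lie in scattered registers \<open>rs\<close>, but a program expects
  them in consecutive ones.\<close>

primrec transfers :: "nat \<Rightarrow> nat list \<Rightarrow> nat \<Rightarrow> cmd" where
  "transfers t [] y = Skip"
| "transfers t (r # rs) y = Seq (transfer t r y) (transfers t rs (Suc y))"

lemma runs_transfers:
  assumes "distinct rs" "\<And>r. r \<in> set rs \<Longrightarrow> r < t" "t < y" "R t = []" "\<And>r. y \<le> r \<Longrightarrow> R r = []"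
    "\<And>r. r \<in> set rs \<Longrightarrow> length (R r) \<le> L"
  shows "runs Or \<rho> (transfers t rs y) (R, h) (length rs * (8 * L + 2) + 1)
     (\<lambda>r. if r \<in> set rs then [] else if y \<le> r \<and> r < y + length rs then R (rs ! (r - y)) else R r, h)"
  using assms
proof (induction rs arbitrary: R y)
  case Nil
  have "(\<lambda>r. if r \<in> set [] then [] else if y \<le> r \<and> r < y + length [] then R ([] ! (r - y)) else R r) = R"
    by (auto simp: fun_eq_iff)
  then show ?case using exec_runs[OF exec.Skip] by auto
next
  case (Cons a rs)
  let ?S = "R(a := [], y := R a)"
  have ay: "a < t" "t < y" using Cons.prems by auto
  have 1: "runs Or \<rho> (transfer t a y) (R, h) (8 * L + 2) (?S, h)"
    by (rule runs_mono[OF runs_transfer]) (use Cons.prems(4,5) Cons.prems(6)[of a] ay in auto)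
  have 2: "runs Or \<rho> (transfers t rs (Suc y)) (?S, h) (length rs * (8 * L + 2) + 1)
     (\<lambda>r. if r \<in> set rs then [] else if Suc y \<le> r \<and> r < Suc y + length rs then ?S (rs ! (r - Suc y)) else ?S r, h)"
  proof (rule Cons.IH)
    show "length (?S r) \<le> L" if "r \<in> set rs" for r
      using that Cons.prems by auto
  qed (use Cons.prems ay in auto)
  have 3: "(\<lambda>r. if r \<in> set rs then [] else if Suc y \<le> r \<and> r < Suc y + length rs then ?S (rs ! (r - Suc y)) else ?S r)
     = (\<lambda>r. if r \<in> set (a # rs) then [] else if y \<le> r \<and> r < y + length (a # rs) then R ((a # rs) ! (r - y)) else R r)"
  proof
    fix r
    have *: "rs ! (r - Suc y) \<in> set rs" "(a # rs) ! (r - y) = rs ! (r - Suc y)" if "Suc y \<le> r" "r < Suc y + length rs"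
      using that by (auto simp: nth_Cons' Suc_diff_le)
    have "rs ! (r - Suc y) \<noteq> a" "rs ! (r - Suc y) \<noteq> y" if "Suc y \<le> r" "r < Suc y + length rs"
      using *(1)[OF that] Cons.prems(1) Cons.prems(2)[of "rs ! (r - Suc y)"] ay by auto
    with * ay show "(if r \<in> set rs then [] else if Suc y \<le> r \<and> r < Suc y + length rs then ?S (rs ! (r - Suc y)) else ?S r)
     = (if r \<in> set (a # rs) then [] else if y \<le> r \<and> r < y + length (a # rs) then R ((a # rs) ! (r - y)) else R r)"
      using Cons.prems(2)[of y]
      by (cases "r = y") auto
  qed
  show ?case
    using runs_Seq[OF 1 2] unfolding 3 by (simp add: algebra_simps)
qed

text \<open>A program needs \<open>unary \<eta>\<close> in its own register 0, while the original
  has to survive for later programs. As all bits are equal, the reversal by \<open>move\<close> is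
  harmless.\<close>

definition duplicate :: "nat \<Rightarrow> nat \<Rightarrow> cmd" where
  "duplicate t y = Seq (move 0 t) (Loop t (Seq (Pop t) (Seq (Push 0 True) (Push y True))))"

lemma runs_duplicate:
  assumes "0 < t" "0 < y" "t \<noteq> y" "R 0 = unary \<eta>" "R t = []" "R y = []"
  shows "runs Or \<rho> (duplicate t y) (R, h) (8 * \<eta> + 2) (R(y := unary \<eta>), h)"
proof -
  let ?B = "Seq (Pop t) (Seq (Push 0 True) (Push y True))"
  have B: "exec Or \<rho> ?B (S, h) 3 (S(t := tl (S t), 0 := True # S 0, y := True # S y), h)" for S
    using exec.Seq[OF exec.Pop[of Or \<rho> t S h] exec.Seq[OF exec.Push[of Or \<rho> 0 True _ h] exec.Push[of Or \<rho> y True _ h]]] assms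
    by (simp add: numeral_eq_Suc)
  have L: "exec Or \<rho> (Loop t ?B) (S, h) (4 * n + 1) (S(t := [], 0 := replicate n True @ S 0, y := replicate n True @ S y), h)"
    if "length (S t) = n" for n S
    using that
  proof (induction n arbitrary: S)
    case 0
    then have eq: "S(t := [], 0 := replicate 0 True @ S 0, y := replicate 0 True @ S y) = S" by auto
    show ?case unfolding eq using 0 exec.LoopEnd[of S t] by simp
  next
    case (Suc n)
    let ?S = "S(t := tl (S t), 0 := True # S 0, y := True # S y)"
    have x: "exec Or \<rho> (Loop t ?B) (?S, h) (4 * n + 1) (?S(t := [], 0 := replicate n True @ ?S 0, y := replicate n True @ ?S y), h)"
      by (rule Suc.IH) (use Suc.prems assms in auto)
    have eq: "?S(t := [], 0 := replicate n True @ ?S 0, y := replicate n True @ ?S y)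
       = S(t := [], 0 := replicate (Suc n) True @ S 0, y := replicate (Suc n) True @ S y)"
      using assms by (auto simp: replicate_append_same fun_eq_iff)
    have ne: "S t \<noteq> []" using Suc.prems by auto
    have num: "Suc (3 + (4 * n + 1)) = 4 * Suc n + 1" by simp
    show ?case
      using exec.LoopStep[OF ne B x] unfolding eq num .
  qed
  let ?S = "R(0 := [], t := rev (R 0) @ R t)"
  have "?S(t := [], 0 := replicate \<eta> True @ ?S 0, y := replicate \<eta> True @ ?S y) = R(y := unary \<eta>)"
    using assms by (auto simp: unary_def)
  then show ?thesis
    using runs_Seq[OF runs_move[of 0 t Or \<rho> R h] exec_runs[OF L[of ?S \<eta>]]] assms
    by (simp add: duplicate_def unary_def algebra_simps)
qed

text \<open>\<open>Flip\<close> is the instruction that moves the head forward, so register 0 serves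
  as a counter for \<eta> reads. Each bit read is discarded in favour of a \<open>True\<close>, from
  which the counter is rebuilt.\<close>

definition advance :: "nat \<Rightarrow> cmd" where
  "advance t = Seq (Loop 0 (Seq (Pop 0) (Seq (Flip t) (Seq (Pop t) (Push t True))))) (move t 0)"

lemma runs_advance:
  assumes "0 < t" "R 0 = unary \<eta>" "R t = []"
  shows "runs Or \<rho> (advance t) (R, h) (9 * \<eta> + 2) (R, h + \<eta>)"
proof -
  let ?B = "Seq (Pop 0) (Seq (Flip t) (Seq (Pop t) (Push t True)))"
  have B: "exec Or \<rho> ?B (S, h) 4 (S(0 := tl (S 0), t := True # S t), Suc h)" for S h
    using exec.Seq[OF exec.Pop[of Or \<rho> 0 S h] exec.Seq[OF exec.Flip[of Or \<rho> t _ h]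
       exec.Seq[OF exec.Pop[of Or \<rho> t _ "Suc h"] exec.Push[of Or \<rho> t True _ "Suc h"]]]] assms
    by (simp add: fun_upd_twist numeral_eq_Suc)
  have L: "exec Or \<rho> (Loop 0 ?B) (S, h) (5 * n + 1) (S(0 := [], t := replicate n True @ S t), h + n)"
    if "length (S 0) = n" for n S h
    using that
  proof (induction n arbitrary: S h)
    case 0
    then have eq: "S(0 := [], t := replicate 0 True @ S t) = S" by auto
    show ?case unfolding eq using 0 exec.LoopEnd[of S 0] by simp
  next
    case (Suc n)
    let ?S = "S(0 := tl (S 0), t := True # S t)"
    have x: "exec Or \<rho> (Loop 0 ?B) (?S, Suc h) (5 * n + 1) (?S(0 := [], t := replicate n True @ ?S t), Suc h + n)"
      by (rule Suc.IH) (use Suc.prems assms in auto)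
    have eq: "?S(0 := [], t := replicate n True @ ?S t)
       = S(0 := [], t := replicate (Suc n) True @ S t)"
      using assms by (auto simp: replicate_append_same fun_eq_iff)
    have ne: "S 0 \<noteq> []" using Suc.prems by auto
    have num: "Suc (4 + (5 * n + 1)) = 5 * Suc n + 1" "Suc h + n = h + Suc n" by simp_all
    show ?case
      using exec.LoopStep[OF ne B x] unfolding eq num .
  qed
  let ?S = "R(0 := [], t := replicate \<eta> True @ R t)"
  have "?S(t := [], 0 := rev (?S t) @ ?S 0) = R"
    using assms by (auto simp: unary_def)
  then show ?thesis
    using runs_Seq[OF exec_runs[OF L[of R \<eta> h]] runs_move[of t 0 Or \<rho> ?S "h + \<eta>"]] assms
    by (simp add: advance_def unary_def algebra_simps)
qed

primrec advances :: "nat \<Rightarrow> nat \<Rightarrow> cmd" where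
  "advances t 0 = Skip"
| "advances t (Suc k) = Seq (advance t) (advances t k)"

lemma runs_advances:
  assumes "0 < t" "R 0 = unary \<eta>" "R t = []"
  shows "runs Or \<rho> (advances t k) (R, h) (k * (9 * \<eta> + 2) + 1) (R, k * \<eta> + h)"
proof (induction k arbitrary: h)
  case 0
  then show ?case using exec_runs[OF exec.Skip] by simp
next
  case (Suc k)
  show ?case
    using runs_Seq[OF runs_advance[OF assms, of Or \<rho> h] Suc[of "h + \<eta>"]] by (simp add: algebra_simps)
qed

section \<open>Running a machine on shifted registers and a shifted tape\<close>

text \<open>
  Renames the registers and runs the program on the random tape without its first \<open>k * \<eta>\<close> bits,
  provided that register 0 contains the security parameter.
\<close>

primrec relocate :: "nat \<Rightarrow> nat \<Rightarrow> nat \<Rightarrow> cmd \<Rightarrow> cmd" where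
  "relocate t k e Skip = Skip"
| "relocate t k e (Push r b) = Push (e + r) b"
| "relocate t k e (Pop r) = Pop (e + r)"
| "relocate t k e (Flip r) = Flip (e + r)"
| "relocate t k e Rewind = Seq Rewind (advances t k)"
| "relocate t k e (Query r) = Query (e + r)"
| "relocate t k e (Seq c d) = Seq (relocate t k e c) (relocate t k e d)"
| "relocate t k e (Branch r ce c0 c1) = Branch (e + r) (relocate t k e ce) (relocate t k e c0) (relocate t k e c1)"
| "relocate t k e (Loop r c) = Loop (e + r) (relocate t k e c)"

lemma runs_Branch:
  "R r = [] \<Longrightarrow> runs Or \<rho> ce (R, h) T s' \<Longrightarrow> runs Or \<rho> (Branch r ce c0 c1) (R, h) (Suc T) s'"
  "R r = False # w \<Longrightarrow> runs Or \<rho> c0 (R, h) T s' \<Longrightarrow> runs Or \<rho> (Branch r ce c0 c1) (R, h) (Suc T) s'"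
  "R r = True # w \<Longrightarrow> runs Or \<rho> c1 (R, h) T s' \<Longrightarrow> runs Or \<rho> (Branch r ce c0 c1) (R, h) (Suc T) s'"
  unfolding runs_def by (blast intro: exec.intros Suc_le_mono[THEN iffD2])+

lemma runs_LoopStep:
  "R r \<noteq> [] \<Longrightarrow> runs Or \<rho> c (R, h) T s1 \<Longrightarrow> runs Or \<rho> (Loop r c) s1 U s2 \<Longrightarrow>
    runs Or \<rho> (Loop r c) (R, h) (Suc (T + U)) s2"
  unfolding runs_def by (meson exec.LoopStep Suc_le_mono add_mono)

text \<open>The simulation goes instruction by instruction; only \<open>Rewind\<close> becomes
  longer, since it has to skip the first \<open>k * \<eta>\<close> bits anew. The factor bounds this
  cost and hence the cost of every step. Registers below \<open>e\<close> are preserved, so the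
  counter in register 0 is available at each \<open>Rewind\<close>.\<close>

lemma runs_relocate:
  assumes "exec Or \<rho>' c s T s'" "\<rho>' = (\<lambda>i. \<rho> (k * \<eta> + i))" "0 < t" "t < e"
    "S 0 = unary \<eta>" "S t = []" "\<And>r. S (e + r) = fst s r"
  shows "runs Or \<rho> (relocate t k e c) (S, k * \<eta> + snd s) ((k * (9 * \<eta> + 2) + 3) * T)
     (\<lambda>r. if r < e then S r else fst s' (r - e), k * \<eta> + snd s')"
proof -
  let ?C = "k * (9 * \<eta> + 2) + 3"
  let ?m = "\<lambda>S :: nat \<Rightarrow> bits. \<lambda>s r. if r < e then S r else fst s (r - e)"
  have atom: "runs Or \<rho> c s (?C * 1) s'" if "exec Or \<rho> c s 1 s'" for c s s'
    by (rule runs_mono[OF exec_runs[OF that]]) auto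
  have eqI: "S = ?m S s" if "\<And>r. S (e + r) = fst s r" for S and s :: config
  proof
    fix x show "S x = ?m S s x"
      using that[of "x - e"] by auto
  qed
  have upd: "S(e + r := w) = ?m S (R(r := w), h)" if "\<And>r. S (e + r) = R r" for S r w h R
  proof
    fix x show "(S(e + r := w)) x = ?m S (R(r := w), h) x"
      using that[of "x - e"] by auto
  qed
  from assms show ?thesis
  proof (induction arbitrary: S rule: exec.induct)
    case (Skip s)
    have "?m S s = S" using eqI Skip(6) by metis
    then show ?case using atom[OF exec.Skip] by simp
  next
    case (Push r b R h)
    then show ?case
      using atom[OF exec.Push, of "e + r" b S "k * \<eta> + h"] upd[of S R r "b # R r" h] by simp
  next
    case (Pop r R h)
    then show ?case
      using atom[OF exec.Pop, of "e + r" S "k * \<eta> + h"] upd[of S R r "tl (R r)" h] by simp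
  next
    case (Flip r R h)
    have tape: "\<rho>' h = \<rho> (k * \<eta> + h)" using assms(2) by simp
    show ?case
      unfolding tape using Flip atom[OF exec.Flip, of "e + r" S "k * \<eta> + h"] upd[of S R r "\<rho> (k * \<eta> + h) # R r" "Suc h"] by simp
  next
    case (Query r R h)
    then show ?case
      using atom[OF exec.Query, of "e + r" S "k * \<eta> + h"] upd[of S R r "Or (R r)" h] by simp
  next
    case (Rewind R h)
    have "runs Or \<rho> (advances t k) (S, 0) (k * (9 * \<eta> + 2) + 1) (S, k * \<eta> + 0)"
      by (rule runs_advances) (use Rewind in auto)
    from runs_mono[OF runs_Seq[OF exec_runs[OF exec.Rewind] this], of "?C * 1"]
    have "runs Or \<rho> (relocate t k e Rewind) (S, k * \<eta> + h) (?C * 1) (S, k * \<eta> + 0)"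
      by simp
    moreover have "?m S (R, 0 :: nat) = S" by (rule eqI[symmetric]) (use Rewind in simp)
    ultimately show ?case by simp
  next
    case (Seq c1 s t1 s1 c2 t2 s2)
    have 1: "runs Or \<rho> (relocate t k e c1) (S, k * \<eta> + snd s) (?C * t1) (?m S s1, k * \<eta> + snd s1)"
      by (rule Seq.IH(1)) (use Seq.prems in auto)
    have 2: "runs Or \<rho> (relocate t k e c2) (?m S s1, k * \<eta> + snd s1) (?C * t2) (?m (?m S s1) s2, k * \<eta> + snd s2)"
      by (rule Seq.IH(2)) (use Seq.prems in auto)
    have "?m (?m S s1) s2 = ?m S s2" by auto
    with runs_Seq[OF 1 2] show ?case by (simp add: algebra_simps)
  next
    case (BranchEmpty R r ce h u s' c0 c1)
    have 1: "runs Or \<rho> (relocate t k e ce) (S, k * \<eta> + h) (?C * u) (?m S s', k * \<eta> + snd s')"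
      using BranchEmpty.IH[of S] BranchEmpty.prems by simp
    have "S (e + r) = []" using BranchEmpty by simp
    from runs_mono[OF runs_Branch(1)[of S, OF this 1], of "?C * Suc u"] show ?case by simp
  next
    case (Branch0 R r w c0 h u s' ce c1)
    have 1: "runs Or \<rho> (relocate t k e c0) (S, k * \<eta> + h) (?C * u) (?m S s', k * \<eta> + snd s')"
      using Branch0.IH[of S] Branch0.prems by simp
    have "S (e + r) = False # w" using Branch0 by simp
    from runs_mono[OF runs_Branch(2)[of S, OF this 1], of "?C * Suc u"] show ?case by simp
  next
    case (Branch1 R r w c1 h u s' ce c0)
    have 1: "runs Or \<rho> (relocate t k e c1) (S, k * \<eta> + h) (?C * u) (?m S s', k * \<eta> + snd s')"
      using Branch1.IH[of S] Branch1.prems by simp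
    have "S (e + r) = True # w" using Branch1 by simp
    from runs_mono[OF runs_Branch(3)[of S, OF this 1], of "?C * Suc u"] show ?case by simp
  next
    case (LoopEnd R r c h)
    have "S (e + r) = []" using LoopEnd by simp
    moreover have "?m S (R, h) = S" by (rule eqI[symmetric]) (use LoopEnd in simp)
    ultimately show ?case
      using atom[OF exec.LoopEnd[of S "e + r" Or \<rho> "relocate t k e c" "k * \<eta> + h"]] by simp
  next
    case (LoopStep R r c h t1 s1 t2 s2)
    have 1: "runs Or \<rho> (relocate t k e c) (S, k * \<eta> + h) (?C * t1) (?m S s1, k * \<eta> + snd s1)"
      using LoopStep.IH(1)[of S] LoopStep.prems by simp
    have 2: "runs Or \<rho> (relocate t k e (Loop r c)) (?m S s1, k * \<eta> + snd s1) (?C * t2) (?m (?m S s1) s2, k * \<eta> + snd s2)"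
      by (rule LoopStep.IH(2)) (use LoopStep.prems in auto)
    have 3: "?m (?m S s1) s2 = ?m S s2" by auto
    have "S (e + r) \<noteq> []" using LoopStep by simp
    from runs_mono[OF runs_LoopStep[of S, OF this 1 2[simplified]], of "?C * Suc (t1 + t2)"] 3
    show ?case by (simp add: algebra_simps)
  qed
qed

section \<open>Composition of programs\<close>

text \<open>
  Every program uses only the registers from \<open>b\<close> on, so that programs for several functions can be
  run one after the other.
\<close>

definition computable :: "(nat \<Rightarrow> oracle_fun \<Rightarrow> tape \<Rightarrow> bits) \<Rightarrow> bool" where
  "computable F \<longleftrightarrow> (\<forall>b>0. \<exists>c e T. b < e \<and> pbound T \<and>
     (\<forall>\<eta> Or \<rho> R h. (\<forall>x. length (Or x) = \<eta>) \<longrightarrow> R 0 = unary \<eta> \<longrightarrow> (\<forall>r\<ge>b. R r = []) \<longrightarrow>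
       (\<exists>R' h'. runs Or \<rho> c (R, h) (T \<eta>) (R', h') \<and> R' b = F \<eta> Or \<rho> \<and> length (F \<eta> Or \<rho>) \<le> T \<eta> \<and>
          (\<forall>r. r < b \<or> e \<le> r \<longrightarrow> R' r = R r))))"

lemma computableE:
  assumes "computable F" "0 < b"
  obtains c e T where "b < e" "pbound T"
    "\<forall>\<eta> Or \<rho> R h. (\<forall>x. length (Or x) = \<eta>) \<longrightarrow> R 0 = unary \<eta> \<longrightarrow> (\<forall>r\<ge>b. R r = []) \<longrightarrow>
       (\<exists>R' h'. runs Or \<rho> c (R, h) (T \<eta>) (R', h') \<and> R' b = F \<eta> Or \<rho> \<and> length (F \<eta> Or \<rho>) \<le> T \<eta> \<and>
          (\<forall>r. r < b \<or> e \<le> r \<longrightarrow> R' r = R r))"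
  using assms(1)[unfolded computable_def, THEN spec, THEN mp, OF assms(2)]
  by (elim exE conjE) (rule that, assumption+)

text \<open>Every program begins where the registers of its predecessor end and leaves everything
  below untouched. The results thus survive, but in positions \<open>rs\<close> with gaps between
  them.\<close>

lemma computable_list:
  assumes "\<forall>F\<in>set Fs. computable F" "0 < b"
  shows "\<exists>c e rs T. b \<le> e \<and> pbound T \<and> length rs = length Fs \<and> distinct rs \<and> set rs \<subseteq> {b..<e} \<and>
     (\<forall>\<eta> Or \<rho> R h. (\<forall>x. length (Or x) = \<eta>) \<longrightarrow> R 0 = unary \<eta> \<longrightarrow> (\<forall>r\<ge>b. R r = []) \<longrightarrow>
       (\<exists>R' h'. runs Or \<rho> c (R, h) (T \<eta>) (R', h') \<and>
          (\<forall>i<length Fs. R' (rs ! i) = (Fs ! i) \<eta> Or \<rho> \<and> length ((Fs ! i) \<eta> Or \<rho>) \<le> T \<eta>) \<and>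
          (\<forall>r. r < b \<or> e \<le> r \<longrightarrow> R' r = R r)))"
  using assms
proof (induction Fs arbitrary: b)
  case Nil
  have skip: "\<exists>R' h'. runs Or \<rho> Skip (R, h) 1 (R', h') \<and>
          (\<forall>i<length []. R' ([] ! i) = ([] ! i) \<eta> Or \<rho> \<and> length (([] ! i) \<eta> Or \<rho>) \<le> 1) \<and>
          (\<forall>r. r < b \<or> b \<le> r \<longrightarrow> R' r = R r)" for Or :: oracle_fun and \<rho> R h and \<eta> :: nat
    by (intro exI[of _ R] exI[of _ h]) (use exec_runs[OF exec.Skip[of Or \<rho> "(R, h)"]] in auto)
  show ?case
    by (intro exI[of _ Skip] exI[of _ b] exI[of _ "[]"] exI[of _ "\<lambda>_. 1"] conjI allI impI)
      (rule skip | simp add: pbound_const)+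
next
  case (Cons F Fs)
  have "computable F" using Cons.prems by simp
  then obtain c1 e1 T1 where 1: "b < e1" "pbound T1"
    "\<forall>\<eta> Or \<rho> R h. (\<forall>x. length (Or x) = \<eta>) \<longrightarrow> R 0 = unary \<eta> \<longrightarrow> (\<forall>r\<ge>b. R r = []) \<longrightarrow>
       (\<exists>R' h'. runs Or \<rho> c1 (R, h) (T1 \<eta>) (R', h') \<and> R' b = F \<eta> Or \<rho> \<and> length (F \<eta> Or \<rho>) \<le> T1 \<eta> \<and>
          (\<forall>r. r < b \<or> e1 \<le> r \<longrightarrow> R' r = R r))"
    by (rule computableE[OF _ Cons.prems(2)])
  have "0 < e1" using 1 by simp
  have "\<forall>F\<in>set Fs. computable F" using Cons.prems by simp
  from Cons.IH[OF this \<open>0 < e1\<close>] obtain c2 e2 rs T2 where 2: "e1 \<le> e2" "pbound T2" "length rs = length Fs" "distinct rs"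
    "set rs \<subseteq> {e1..<e2}"
    "\<forall>\<eta> Or \<rho> R h. (\<forall>x. length (Or x) = \<eta>) \<longrightarrow> R 0 = unary \<eta> \<longrightarrow> (\<forall>r\<ge>e1. R r = []) \<longrightarrow>
       (\<exists>R' h'. runs Or \<rho> c2 (R, h) (T2 \<eta>) (R', h') \<and>
          (\<forall>i<length Fs. R' (rs ! i) = (Fs ! i) \<eta> Or \<rho> \<and> length ((Fs ! i) \<eta> Or \<rho>) \<le> T2 \<eta>) \<and>
          (\<forall>r. r < e1 \<or> e2 \<le> r \<longrightarrow> R' r = R r))"
    by (elim exE conjE) (rule that, assumption+)
  let ?T = "\<lambda>\<eta>. T1 \<eta> + T2 \<eta>"
  have "\<exists>R' h'. runs Or \<rho> (Seq c1 c2) (R, h) (?T \<eta>) (R', h') \<and>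
          (\<forall>i<length (F # Fs). R' ((b # rs) ! i) = ((F # Fs) ! i) \<eta> Or \<rho> \<and> length (((F # Fs) ! i) \<eta> Or \<rho>) \<le> ?T \<eta>) \<and>
          (\<forall>r. r < b \<or> e2 \<le> r \<longrightarrow> R' r = R r)"
    if *: "\<forall>x. length (Or x) = \<eta>" "R 0 = unary \<eta>" "\<forall>r\<ge>b. R r = []" for Or :: oracle_fun and \<rho> R h \<eta>
  proof -
    from 1(3)[THEN spec[of _ \<eta>], THEN spec[of _ Or], THEN spec[of _ \<rho>], THEN spec[of _ "R"], THEN spec[of _ h], THEN mp, THEN mp, THEN mp, OF *] obtain R1 h1 where R1: "runs Or \<rho> c1 (R, h) (T1 \<eta>) (R1, h1)" "R1 b = F \<eta> Or \<rho>"
      "length (F \<eta> Or \<rho>) \<le> T1 \<eta>" "\<And>r. r < b \<or> e1 \<le> r \<Longrightarrow> R1 r = R r" by blast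
    have "R1 0 = unary \<eta>" "\<forall>r\<ge>e1. R1 r = []" using R1(4) * 1(1) Cons.prems(2) by auto
    from 2(6)[THEN spec[of _ \<eta>], THEN spec[of _ Or], THEN spec[of _ \<rho>], THEN spec[of _ "R1"], THEN spec[of _ h1], THEN mp, THEN mp, THEN mp, OF *(1) this] obtain R2 h2 where R2: "runs Or \<rho> c2 (R1, h1) (T2 \<eta>) (R2, h2)"
      "\<And>i. i<length Fs \<Longrightarrow> R2 (rs ! i) = (Fs ! i) \<eta> Or \<rho> \<and> length ((Fs ! i) \<eta> Or \<rho>) \<le> T2 \<eta>"
      "\<And>r. r < e1 \<or> e2 \<le> r \<Longrightarrow> R2 r = R1 r" by blast
    have "R2 ((b # rs) ! i) = ((F # Fs) ! i) \<eta> Or \<rho> \<and> length (((F # Fs) ! i) \<eta> Or \<rho>) \<le> ?T \<eta>"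
      if "i < length (F # Fs)" for i
      using R1(2,3) R2(2)[of "i - 1"] R2(3)[of b] 1(1) that by (cases i) auto
    moreover have "R2 r = R r" if "r < b \<or> e2 \<le> r" for r
      using R1(4)[of r] R2(3)[of r] that 1(1) 2(1) by auto
    ultimately show ?thesis using runs_Seq[OF R1(1) R2(1)] by blast
  qed
  moreover have "pbound ?T" by (intro pbound_intros 1 2)
  moreover have "b \<le> e2" "length (b # rs) = length (F # Fs)" "distinct (b # rs)" "set (b # rs) \<subseteq> {b..<e2}"
    using 1(1) 2(1-5) by auto
  ultimately show ?case by blast
qed

lemma computes_within_length:
  assumes "computes_within (\<lambda>_. []) \<rho> c xs T y"
  shows "length y \<le> length (concat xs) + T"
proof -
  from assms obtain t R h where e: "exec (\<lambda>_. []) \<rho> c (initial xs) t (R, h)" "t \<le> T" "R 0 = y"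
    by (auto simp: computes_within_def)
  from exec_length[OF e(1) refl, of 0] e(2,3) show ?thesis
    by (cases xs) (auto simp: initial_def)
qed

text \<open>This is closure under the symbols of a model. The offset \<open>k\<close> lets all of
  them read the same tape behind the blocks reserved for names; when a name itself is read,
  \<open>k\<close> is its index.\<close>

lemma computable_ptime:
  assumes f: "ptime D f" and Fs: "\<forall>F\<in>set Fs. computable F"
    and D: "\<And>\<eta> Or \<rho>. (\<And>x. length (Or x) = \<eta>) \<Longrightarrow> D \<eta> (map (\<lambda>F. F \<eta> Or \<rho>) Fs)"
  shows "computable (\<lambda>\<eta> Or \<rho>. f \<eta> (map (\<lambda>F. F \<eta> Or \<rho>) Fs) (\<lambda>i. \<rho> (k * \<eta> + i)))"
  unfolding computable_def
proof (intro allI impI)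
  fix b :: nat assume "0 < b"
  obtain c p where c: "\<And>\<eta> xs Or \<rho>. D \<eta> xs \<Longrightarrow>
     computes_within Or \<rho> c (unary \<eta> # xs) (poly p (\<eta> + sum_list (map length xs))) (f \<eta> xs \<rho>)"
    using f unfolding ptime_def by blast
  have sb: "0 < Suc b" by simp
  obtain cl e rs Tl where l: "Suc b \<le> e" "pbound Tl" "length rs = length Fs" "distinct rs"
    "set rs \<subseteq> {Suc b..<e}"
    "\<forall>\<eta> Or \<rho> R h. (\<forall>x. length (Or x) = \<eta>) \<longrightarrow> R 0 = unary \<eta> \<longrightarrow> (\<forall>r\<ge>Suc b. R r = []) \<longrightarrow>
       (\<exists>R' h'. runs Or \<rho> cl (R, h) (Tl \<eta>) (R', h') \<and>
          (\<forall>i<length Fs. R' (rs ! i) = (Fs ! i) \<eta> Or \<rho> \<and> length ((Fs ! i) \<eta> Or \<rho>) \<le> Tl \<eta>) \<and>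
          (\<forall>r. r < Suc b \<or> e \<le> r \<longrightarrow> R' r = R r))"
    using computable_list[of Fs, OF Fs sb] by (elim exE conjE) (rule that, assumption+)
  let ?n = "length Fs"
  \<comment> \<open>Register \<open>e\<close> is scratch. Register \<open>e + 1\<close> plays
    register 0 of the relocated program: it holds \<open>unary \<eta>\<close> at the start and the
    result at the end. The arguments follow from \<open>e + 2\<close> on.\<close>
  let ?prog = "Seq cl (Seq (transfers e rs (e + 2)) (Seq (duplicate e (e + 1)) (Seq Rewind (Seq (advances e k)
     (Seq (relocate e k (e + 1) c) (transfer e (e + 1) b))))))"
  let ?P = "\<lambda>\<eta>. poly p (\<eta> + ?n * Tl \<eta>)"
  let ?L = "\<lambda>\<eta>. \<eta> + ?n * Tl \<eta> + ?P \<eta>"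
  let ?T = "\<lambda>\<eta>. Tl \<eta> + ((?n * (8 * Tl \<eta> + 2) + 1) + ((8 * \<eta> + 2) + (1 + ((k * (9 * \<eta> + 2) + 1) +
     ((k * (9 * \<eta> + 2) + 3) * ?P \<eta> + (8 * ?L \<eta> + 2))))))"
  \<comment> \<open>The end must lie beyond the argument registers and beyond every register that
    the relocated program can write.\<close>
  let ?e = "e + 2 + ?n + width c"
  have "pbound ?T" by (intro pbound_intros l)
  moreover have "b < ?e" using l(1) by simp
  moreover have "\<exists>R' h'. runs Or \<rho> ?prog (R, h) (?T \<eta>) (R', h') \<and>
      R' b = f \<eta> (map (\<lambda>F. F \<eta> Or \<rho>) Fs) (\<lambda>i. \<rho> (k * \<eta> + i)) \<and>
      length (f \<eta> (map (\<lambda>F. F \<eta> Or \<rho>) Fs) (\<lambda>i. \<rho> (k * \<eta> + i))) \<le> ?T \<eta> \<and>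
      (\<forall>r. r < b \<or> ?e \<le> r \<longrightarrow> R' r = R r)"
    if *: "\<forall>x. length (Or x) = \<eta>" "R 0 = unary \<eta>" "\<forall>r\<ge>b. R r = []" for Or :: oracle_fun and \<rho> R h \<eta>
  proof -
    let ?xs = "map (\<lambda>F. F \<eta> Or \<rho>) Fs"
    let ?\<rho> = "\<lambda>i. \<rho> (k * \<eta> + i)"
    let ?y = "f \<eta> ?xs ?\<rho>"
    have "\<forall>r\<ge>Suc b. R r = []" using * by auto
    from l(6)[THEN spec[of _ \<eta>], THEN spec[of _ Or], THEN spec[of _ \<rho>], THEN spec[of _ "R"], THEN spec[of _ h], THEN mp, THEN mp, THEN mp, OF *(1,2) this] obtain R1 h1 where R1: "runs Or \<rho> cl (R, h) (Tl \<eta>) (R1, h1)"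
       "\<And>i. i < ?n \<Longrightarrow> R1 (rs ! i) = (Fs ! i) \<eta> Or \<rho> \<and> length ((Fs ! i) \<eta> Or \<rho>) \<le> Tl \<eta>"
       "\<And>r. r < Suc b \<or> e \<le> r \<Longrightarrow> R1 r = R r" by blast
    define R2 where "R2 = (\<lambda>r. if r \<in> set rs then [] else if e + 2 \<le> r \<and> r < e + 2 + ?n then R1 (rs ! (r - (e + 2))) else R1 r)"
    have 2: "runs Or \<rho> (transfers e rs (e + 2)) (R1, h1) (?n * (8 * Tl \<eta> + 2) + 1) (R2, h1)"
      unfolding R2_def l(3)[symmetric]
    proof (rule runs_transfers)
      show "length (R1 r) \<le> Tl \<eta>" if "r \<in> set rs" for r
        using that R1(2) l(3) by (metis in_set_conv_nth)
    qed (use l R1(3) * in auto)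
    have R2: "R2 0 = unary \<eta>" "R2 e = []" "R2 (e + 1) = []" "R2 r = R r" if "r < Suc b \<or> ?e \<le> r" for r
      using that l(5) R1(3) * l(1) by (auto simp: R2_def)
    have 3: "runs Or \<rho> (duplicate e (e + 1)) (R2, h1) (8 * \<eta> + 2) (R2(e + 1 := unary \<eta>), h1)"
      by (rule runs_duplicate) (use R2[of 0] l(1) in auto)
    let ?R3 = "R2(e + 1 := unary \<eta>)"
    have 4: "runs Or \<rho> Rewind (?R3, h1) 1 (?R3, 0)"
      by (rule exec_runs[OF exec.Rewind])
    have 5: "runs Or \<rho> (advances e k) (?R3, 0) (k * (9 * \<eta> + 2) + 1) (?R3, k * \<eta> + 0)"
      by (rule runs_advances) (use R2[of 0] l(1) in auto)
    have Dx: "D \<eta> ?xs" using D *(1) by blast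
    have sl: "sum_list (map length ?xs) \<le> ?n * Tl \<eta>"
    proof -
      have "sum_list (map length ?xs) = (\<Sum>i<?n. length ((Fs ! i) \<eta> Or \<rho>))"
        by (simp add: sum_list_sum_nth atLeast0LessThan)
      also have "\<dots> \<le> (\<Sum>i<?n. Tl \<eta>)"
        by (rule sum_mono) (use R1(2) in auto)
      finally show ?thesis by simp
    qed
    \<comment> \<open>The result is the same for every oracle, so its length may be read off from a
      run with empty answers.\<close>
    have len: "length ?y \<le> ?L \<eta>"
      using computes_within_length[OF c[OF Dx, of "\<lambda>_. []" ?\<rho>]] sl
        poly_nat_mono[of "\<eta> + sum_list (map length ?xs)" "\<eta> + ?n * Tl \<eta>" p]
      by (simp add: length_concat unary_def)
    obtain t R4 h4 where ex: "exec Or ?\<rho> c (initial (unary \<eta> # ?xs)) t (R4, h4)"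
      "t \<le> poly p (\<eta> + sum_list (map length ?xs))" "R4 0 = ?y"
      using c[OF Dx, of Or ?\<rho>] by (auto simp: computes_within_def)
    have "t \<le> ?P \<eta>" using ex(2) poly_nat_mono[of "\<eta> + sum_list (map length ?xs)" "\<eta> + ?n * Tl \<eta>" p] sl by simp
    then have t: "(k * (9 * \<eta> + 2) + 3) * t \<le> (k * (9 * \<eta> + 2) + 3) * ?P \<eta>" by (rule mult_le_mono2)
    let ?R5 = "\<lambda>r. if r < e + 1 then ?R3 r else R4 (r - (e + 1))"
    have "runs Or \<rho> (relocate e k (e + 1) c) (?R3, k * \<eta> + snd (initial (unary \<eta> # ?xs)))
       ((k * (9 * \<eta> + 2) + 3) * t) (\<lambda>r. if r < e + 1 then ?R3 r else fst (R4, h4) (r - (e + 1)), k * \<eta> + snd (R4, h4))"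
    proof (rule runs_relocate[OF ex(1) refl])
      show "?R3 (e + 1 + r) = fst (initial (unary \<eta> # ?xs)) r" for r
      proof (cases r)
        case 0
        then show ?thesis by (simp add: initial_def)
      next
        case (Suc i)
        have "R2 (e + 2 + i) = (if i < ?n then ?xs ! i else [])"
          using l(1,5) R1(2)[of i] R1(3)[of "e + 2 + i"] * by (auto simp: R2_def)
        then show ?thesis using Suc by (simp add: initial_def)
      qed
    qed (use R2[of 0] l(1) in auto)
    then have 6: "runs Or \<rho> (relocate e k (e + 1) c) (?R3, k * \<eta> + 0) ((k * (9 * \<eta> + 2) + 3) * ?P \<eta>) (?R5, k * \<eta> + h4)"
      using runs_mono[OF _ t] by (simp only: initial_def fst_conv snd_conv)
    have 7: "runs Or \<rho> (transfer e (e + 1) b) (?R5, k * \<eta> + h4) (8 * ?L \<eta> + 2) (?R5(e + 1 := [], b := ?R5 (e + 1)), k * \<eta> + h4)"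
      by (rule runs_mono[OF runs_transfer]) (use R2[of 0] R2(4)[of b] l(1) * len ex(3) in auto)
    let ?R6 = "?R5(e + 1 := [], b := ?R5 (e + 1))"
    have "?R6 r = R r" if r: "r < b \<or> ?e \<le> r" for r
    proof (cases "r < b")
      case True
      then show ?thesis using R2(4)[of r] l(1) by auto
    next
      case False
      then have r: "?e \<le> r" using r by simp
      then have "width c \<le> r - (e + 1)" by simp
      from exec_above_width[OF ex(1) this] have "R4 (r - (e + 1)) = []"
        using r by (simp add: initial_def)
      then show ?thesis using r * l(1) by auto
    qed
    moreover have "?R6 b = ?y" using ex(3) by simp
    moreover have "runs Or \<rho> ?prog (R, h) (?T \<eta>) (?R6, k * \<eta> + h4)"
      by (rule runs_Seq[OF R1(1) runs_Seq[OF 2 runs_Seq[OF 3 runs_Seq[OF 4 runs_Seq[OF 5 runs_Seq[OF 6 7]]]]]])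
    moreover have "length ?y \<le> ?T \<eta>"
    proof -
      have "length ?y \<le> 8 * ?L \<eta> + 2" using len by simp
      from trans_le_add2[OF trans_le_add2[OF trans_le_add2[OF trans_le_add2[OF trans_le_add2[OF trans_le_add2[OF this]]]]]]
      show ?thesis .
    qed
    ultimately show ?thesis
      by (intro exI[of _ ?R6] exI[of _ "k * \<eta> + h4"] conjI allI impI)
  qed
  ultimately show "\<exists>c e T. b < e \<and> pbound T \<and>
     (\<forall>\<eta> Or \<rho> R h. (\<forall>x. length (Or x) = \<eta>) \<longrightarrow> R 0 = unary \<eta> \<longrightarrow> (\<forall>r\<ge>b. R r = []) \<longrightarrow>
       (\<exists>R' h'. runs Or \<rho> c (R, h) (T \<eta>) (R', h') \<and> R' b = f \<eta> (map (\<lambda>F. F \<eta> Or \<rho>) Fs) (\<lambda>i. \<rho> (k * \<eta> + i)) \<and>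
          length (f \<eta> (map (\<lambda>F. F \<eta> Or \<rho>) Fs) (\<lambda>i. \<rho> (k * \<eta> + i))) \<le> T \<eta> \<and>
          (\<forall>r. r < b \<or> e \<le> r \<longrightarrow> R' r = R r)))"
    by blast
qed

text \<open>Answers of length \<eta> keep the result, and so the cost of using it further,
  polynomial.\<close>

lemma computable_query:
  assumes "computable F"
  shows "computable (\<lambda>\<eta> Or \<rho>. Or (F \<eta> Or \<rho>))"
  unfolding computable_def
proof (intro allI impI)
  fix b :: nat assume "0 < b"
  from assms this obtain c e T where c: "b < e" "pbound T"
    "\<forall>\<eta> Or \<rho> R h. (\<forall>x. length (Or x) = \<eta>) \<longrightarrow> R 0 = unary \<eta> \<longrightarrow> (\<forall>r\<ge>b. R r = []) \<longrightarrow>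
       (\<exists>R' h'. runs Or \<rho> c (R, h) (T \<eta>) (R', h') \<and> R' b = F \<eta> Or \<rho> \<and> length (F \<eta> Or \<rho>) \<le> T \<eta> \<and>
          (\<forall>r. r < b \<or> e \<le> r \<longrightarrow> R' r = R r))"
    by (rule computableE)
  let ?T = "\<lambda>\<eta>. T \<eta> + (1 + \<eta>)"
  have "\<exists>R' h'. runs Or \<rho> (Seq c (Query b)) (R, h) (?T \<eta>) (R', h') \<and> R' b = Or (F \<eta> Or \<rho>) \<and>
      length (Or (F \<eta> Or \<rho>)) \<le> ?T \<eta> \<and> (\<forall>r. r < b \<or> e \<le> r \<longrightarrow> R' r = R r)"
    if *: "\<forall>x. length (Or x) = \<eta>" "R 0 = unary \<eta>" "\<forall>r\<ge>b. R r = []" for Or :: oracle_fun and \<rho> R h \<eta>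
  proof -
    from c(3)[THEN spec[of _ \<eta>], THEN spec[of _ Or], THEN spec[of _ \<rho>], THEN spec[of _ "R"], THEN spec[of _ h], THEN mp, THEN mp, THEN mp, OF *] obtain R1 h1 where R1: "runs Or \<rho> c (R, h) (T \<eta>) (R1, h1)" "R1 b = F \<eta> Or \<rho>"
      "\<And>r. r < b \<or> e \<le> r \<Longrightarrow> R1 r = R r" by blast
    have "runs Or \<rho> (Seq c (Query b)) (R, h) (?T \<eta>) (R1(b := Or (R1 b)), h1)"
      by (rule runs_mono[OF runs_Seq[OF R1(1) exec_runs[OF exec.Query]]]) simp
    moreover have "(R1(b := Or (R1 b))) r = R r" if "r < b \<or> e \<le> r" for r
      using that R1(3)[of r] c(1) by auto
    ultimately show ?thesis using R1(2) *(1) by (intro exI[of _ "R1(b := Or (R1 b))"] exI[of _ h1]) auto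
  qed
  moreover have "pbound ?T" by (intro pbound_intros c)
  ultimately show "\<exists>c e T. b < e \<and> pbound T \<and>
     (\<forall>\<eta> Or \<rho> R h. (\<forall>x. length (Or x) = \<eta>) \<longrightarrow> R 0 = unary \<eta> \<longrightarrow> (\<forall>r\<ge>b. R r = []) \<longrightarrow>
       (\<exists>R' h'. runs Or \<rho> c (R, h) (T \<eta>) (R', h') \<and> R' b = Or (F \<eta> Or \<rho>) \<and> length (Or (F \<eta> Or \<rho>)) \<le> T \<eta> \<and>
          (\<forall>r. r < b \<or> e \<le> r \<longrightarrow> R' r = R r)))"
    using c(1) by blast
qed

lemma computable_imp_oracle_ptime:
  assumes "computable F"
  shows "oracle_ptime F"
proof -
  have "0 < (1 :: nat)" by simp
  from assms this obtain c e T where c: "1 < e" "pbound T"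
    "\<forall>\<eta> Or \<rho> R h. (\<forall>x. length (Or x) = \<eta>) \<longrightarrow> R 0 = unary \<eta> \<longrightarrow> (\<forall>r\<ge>1. R r = []) \<longrightarrow>
       (\<exists>R' h'. runs Or \<rho> c (R, h) (T \<eta>) (R', h') \<and> R' 1 = F \<eta> Or \<rho> \<and> length (F \<eta> Or \<rho>) \<le> T \<eta> \<and>
          (\<forall>r. r < 1 \<or> e \<le> r \<longrightarrow> R' r = R r))"
    by (rule computableE)
  \<comment> \<open>The result is in register 1 and the output is expected in register 0, which
    still holds \<open>unary \<eta>\<close> and is first emptied into \<open>e\<close>.\<close>
  let ?prog = "Seq c (Seq (move 0 e) (transfer (Suc e) 1 0))"
  let ?T = "\<lambda>\<eta>. T \<eta> + ((4 * \<eta> + 1) + (8 * T \<eta> + 2))"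
  have "pbound ?T" by (intro pbound_intros c)
  then obtain p :: "nat poly" where p: "\<And>\<eta>. ?T \<eta> \<le> poly p \<eta>" by (auto simp: pbound_def)
  have "computes_within Or \<rho> ?prog [unary \<eta>] (poly p \<eta>) (F \<eta> Or \<rho>)" if *: "\<forall>x. length (Or x) = \<eta>" for Or :: oracle_fun and \<rho> \<eta>
  proof -
    define R0 where "R0 = fst (initial [unary \<eta>])"
    have i: "initial [unary \<eta>] = (R0, 0)" by (simp add: initial_def R0_def)
    have "R0 0 = unary \<eta>" "\<forall>r\<ge>1. R0 r = []" by (auto simp: initial_def R0_def)
    from c(3)[THEN spec[of _ \<eta>], THEN spec[of _ Or], THEN spec[of _ \<rho>], THEN spec[of _ R0], THEN spec[of _ 0], THEN mp, THEN mp, THEN mp, OF * this] obtain R1 h1 where R1: "runs Or \<rho> c (R0, 0) (T \<eta>) (R1, h1)" "R1 1 = F \<eta> Or \<rho>"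
      "length (F \<eta> Or \<rho>) \<le> T \<eta>" "\<And>r. r < 1 \<or> e \<le> r \<Longrightarrow> R1 r = R0 r" by blast
    have R1': "R1 0 = unary \<eta>" "R1 (Suc e) = []" using R1(4) c(1) by (auto simp: initial_def R0_def)
    let ?R2 = "R1(0 := [], e := rev (R1 0) @ R1 e)"
    have 2: "runs Or \<rho> (move 0 e) (R1, h1) (4 * \<eta> + 1) (?R2, h1)"
      using runs_move[of 0 e Or \<rho> R1 h1] c(1) R1' by (simp add: unary_def)
    have 3: "runs Or \<rho> (transfer (Suc e) 1 0) (?R2, h1) (8 * T \<eta> + 2) (?R2(1 := [], 0 := ?R2 1), h1)"
      by (rule runs_mono[OF runs_transfer]) (use c(1) R1' R1(2,3) in auto)
    from runs_Seq[OF R1(1) runs_Seq[OF 2 3]] p[of \<eta>]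
    have "runs Or \<rho> ?prog (R0, 0) (poly p \<eta>) (?R2(1 := [], 0 := ?R2 1), h1)"
      by (rule runs_mono)
    moreover have "(?R2(1 := [], 0 := ?R2 1)) 0 = F \<eta> Or \<rho>" using R1(2) c(1) by simp
    ultimately show ?thesis unfolding computes_within_def runs_def i by blast
  qed
  then show ?thesis unfolding oracle_ptime_def by blast
qed


section \<open>Concrete machines for names, zero and xor\<close>

lemma computes_withinI:
  assumes "runs Or \<rho> c (initial xs) T (R, h)" "R 0 = y"
  shows "computes_within Or \<rho> c xs T y"
  using assms by (auto simp: computes_within_def runs_def)

lemma runs_LoopEnd: "R r = [] \<Longrightarrow> runs Or \<rho> (Loop r c) (R, h) 1 (R, h)"
  by (rule exec_runs[OF exec.LoopEnd])

lemma ptime_read: "ptime (\<lambda>\<eta> xs. xs = []) (\<lambda>\<eta> xs \<rho>. map \<rho> [0..<\<eta>])"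
proof -
  let ?B = "Seq (Pop 0) (Flip 1)"
  have L: "runs Or \<rho> (Loop 0 ?B) (R, h) (3 * n + 1) (R(0 := [], 1 := rev (map (\<lambda>i. \<rho> (h + i)) [0..<n]) @ R 1), h + n)"
    if "length (R 0) = n" for Or \<rho> R h n
    using that
  proof (induction n arbitrary: R h)
    case 0
    then have eq: "R(0 := [], 1 := rev (map (\<lambda>i. \<rho> (h + i)) [0..<0]) @ R 1) = R" by auto
    show ?case unfolding eq using 0 by (simp add: runs_LoopEnd[unfolded One_nat_def])
  next
    case (Suc n)
    let ?S = "R(0 := tl (R 0), 1 := \<rho> h # R 1)"
    have B: "runs Or \<rho> ?B (R, h) (1 + 1) (?S, Suc h)"
      using runs_Seq[OF exec_runs[OF exec.Pop[of Or \<rho> 0 R h]] exec_runs[OF exec.Flip[of Or \<rho> 1 _ h]]] by simp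
    have ne: "R 0 \<noteq> []" using Suc.prems by auto
    have x: "runs Or \<rho> (Loop 0 ?B) (?S, Suc h) (3 * n + 1)
        (?S(0 := [], 1 := rev (map (\<lambda>i. \<rho> (Suc h + i)) [0..<n]) @ ?S 1), Suc h + n)"
      by (rule Suc.IH) (use Suc.prems in auto)
    have "map (\<lambda>i. \<rho> (h + i)) [0..<Suc n] = \<rho> h # map (\<lambda>i. \<rho> (Suc h + i)) [0..<n]"
      by (simp add: upt_conv_Cons map_Suc_upt[symmetric] o_def del: upt_Suc)
    then have eq: "?S(0 := [], 1 := rev (map (\<lambda>i. \<rho> (Suc h + i)) [0..<n]) @ ?S 1)
      = R(0 := [], 1 := rev (map (\<lambda>i. \<rho> (h + i)) [0..<Suc n]) @ R 1)"
      by (simp add: fun_eq_iff del: upt_Suc)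
    have num: "Suc (1 + 1 + (3 * n + 1)) = 3 * Suc n + 1" "Suc h + n = h + Suc n" by simp_all
    show ?case
      using runs_LoopStep[OF ne B x] unfolding eq num .
  qed
  \<comment> \<open>Reading takes \<open>3 * \<eta> + 1\<close> steps and the final reversal
    \<open>4 * \<eta> + 1\<close>, in total \<open>7 * \<eta> + 2\<close>.\<close>
  have "computes_within Or \<rho> (Seq (Loop 0 ?B) (move 1 0)) [unary \<eta>] (poly [:2, 7:] \<eta>) (map \<rho> [0..<\<eta>])" for Or \<rho> \<eta>
  proof -
    define R0 where "R0 = fst (initial [unary \<eta>])"
    have R0: "initial [unary \<eta>] = (R0, 0)" "R0 0 = unary \<eta>" "R0 1 = []"
      by (auto simp: R0_def initial_def)
    let ?S = "R0(0 := [], 1 := rev (map (\<lambda>i. \<rho> (0 + i)) [0..<\<eta>]) @ R0 1)"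
    have "runs Or \<rho> (Seq (Loop 0 ?B) (move 1 0)) (R0, 0) ((3 * \<eta> + 1) + (4 * length (?S 1) + 1))
       (?S(1 := [], 0 := rev (?S 1) @ ?S 0), 0 + \<eta>)"
      by (rule runs_Seq[OF L runs_move]) (use R0 in \<open>auto simp: unary_def\<close>)
    then show ?thesis
      by (intro computes_withinI[of Or \<rho> _ _ _ "?S(1 := [], 0 := rev (?S 1) @ ?S 0)" "0 + \<eta>"])
        (use R0 in \<open>auto intro: runs_mono\<close>)
  qed
  then show ?thesis
    unfolding ptime_def by (intro exI[of _ "Seq (Loop 0 ?B) (move 1 0)"] exI[of _ "[:2, 7:]"]) simp
qed

lemma ptime_zero: "ptime (\<lambda>\<eta> xs. xs = []) (\<lambda>\<eta> xs \<rho>. replicate \<eta> False)"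
proof -
  let ?B = "Seq (Pop 0) (Push 1 False)"
  have L: "runs Or \<rho> (Loop 0 ?B) (R, h) (3 * n + 1) (R(0 := [], 1 := replicate n False @ R 1), h)"
    if "length (R 0) = n" for Or \<rho> R h n
    using that
  proof (induction n arbitrary: R h)
    case 0
    then have eq: "R(0 := [], 1 := replicate 0 False @ R 1) = R" by auto
    show ?case unfolding eq using 0 by (simp add: runs_LoopEnd[unfolded One_nat_def])
  next
    case (Suc n)
    let ?S = "R(0 := tl (R 0), 1 := False # R 1)"
    have B: "runs Or \<rho> ?B (R, h) (1 + 1) (?S, h)"
      using runs_Seq[OF exec_runs[OF exec.Pop[of Or \<rho> 0 R h]] exec_runs[OF exec.Push[of Or \<rho> 1 False _ h]]] by simp
    have ne: "R 0 \<noteq> []" using Suc.prems by auto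
    have x: "runs Or \<rho> (Loop 0 ?B) (?S, h) (3 * n + 1) (?S(0 := [], 1 := replicate n False @ ?S 1), h)"
      by (rule Suc.IH) (use Suc.prems in auto)
    have eq: "?S(0 := [], 1 := replicate n False @ ?S 1) = R(0 := [], 1 := replicate (Suc n) False @ R 1)"
      by (simp add: fun_eq_iff replicate_append_same)
    have num: "Suc (1 + 1 + (3 * n + 1)) = 3 * Suc n + 1" by simp
    show ?case
      using runs_LoopStep[OF ne B x] unfolding eq num .
  qed
  have "computes_within Or \<rho> (Seq (Loop 0 ?B) (move 1 0)) [unary \<eta>] (poly [:2, 7:] \<eta>) (replicate \<eta> False)" for Or \<rho> \<eta>
  proof -
    define R0 where "R0 = fst (initial [unary \<eta>])"
    have R0: "initial [unary \<eta>] = (R0, 0)" "R0 0 = unary \<eta>" "R0 1 = []"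
      by (auto simp: R0_def initial_def)
    let ?S = "R0(0 := [], 1 := replicate \<eta> False @ R0 1)"
    have "runs Or \<rho> (Seq (Loop 0 ?B) (move 1 0)) (R0, 0) ((3 * \<eta> + 1) + (4 * length (?S 1) + 1))
       (?S(1 := [], 0 := rev (?S 1) @ ?S 0), 0)"
      by (rule runs_Seq[OF L runs_move]) (use R0 in \<open>auto simp: unary_def\<close>)
    then show ?thesis
      by (intro computes_withinI[of Or \<rho> _ _ _ "?S(1 := [], 0 := rev (?S 1) @ ?S 0)" 0])
        (use R0 in \<open>auto intro: runs_mono\<close>)
  qed
  then show ?thesis
    unfolding ptime_def by (intro exI[of _ "Seq (Loop 0 ?B) (move 1 0)"] exI[of _ "[:2, 7:]"]) simp
qed

text \<open>Register 0 is popped along with the two arguments, so that it is empty when the result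
  is moved there. A round takes seven steps, and the final reversal adds four per bit.\<close>

lemma ptime_xor:
  "ptime (\<lambda>\<eta> xs. length xs = 2 \<and> length (xs ! 0) = \<eta> \<and> length (xs ! 1) = \<eta>)
     (\<lambda>\<eta> xs \<rho>. map2 (\<noteq>) (xs ! 0) (xs ! 1))"
proof -
  let ?X = "\<lambda>a. Seq (Pop 1) (Branch 2 Skip (Seq (Pop 2) (Push 3 a)) (Seq (Pop 2) (Push 3 (\<not> a))))"
  let ?B = "Seq (Pop 0) (Branch 1 Skip (?X False) (?X True))"
  have L: "runs Or \<rho> (Loop 1 ?B) (R, h) (7 * length u + 1) (R(0 := [], 1 := [], 2 := [], 3 := rev (map2 (\<noteq>) u v) @ R 3), h)"
    if "length u = length v" "R 1 = u" "R 2 = v" "length (R 0) = length u" for Or \<rho> R h u v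
    using that
  proof (induction u v arbitrary: R rule: list_induct2)
    case Nil
    then have eq: "R(0 := [], 1 := [], 2 := [], 3 := rev (map2 (\<noteq>) [] []) @ R 3) = R" by auto
    show ?case unfolding eq using Nil by (simp add: runs_LoopEnd[unfolded One_nat_def])
  next
    case (Cons a u b v)
    let ?U = "R(0 := tl (R 0))"
    let ?S = "R(0 := tl (R 0), 1 := u, 2 := v, 3 := (a \<noteq> b) # R 3)"
    let ?Q = "?U(1 := u)"
    have pp: "runs Or \<rho> (Seq (Pop 2) (Push 3 (a \<noteq> b))) (?Q, h) 2 (?S, h)"
      using runs_Seq[OF exec_runs[OF exec.Pop[of Or \<rho> 2 ?Q h]] exec_runs[OF exec.Push[of Or \<rho> 3 "a \<noteq> b" _ h]]] Cons.prems
      by (simp add: numeral_2_eq_2)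
    have "runs Or \<rho> (Branch 2 Skip (Seq (Pop 2) (Push 3 a)) (Seq (Pop 2) (Push 3 (\<not> a)))) (?Q, h) (Suc 2) (?S, h)"
    proof (cases b)
      case True
      have ab: "(a \<noteq> b) = (\<not> a)" using True by simp
      from pp[unfolded ab] show ?thesis
        unfolding ab by (intro runs_Branch(3)[of _ 2 v]) (use True Cons.prems in simp_all)
    next
      case False
      have ab: "(a \<noteq> b) = a" using False by simp
      from pp[unfolded ab] show ?thesis
        unfolding ab by (intro runs_Branch(2)[of _ 2 v]) (use False Cons.prems in simp_all)
    qed
    moreover have "runs Or \<rho> (Pop 1) (?U, h) 1 (?Q, h)"
      using exec_runs[OF exec.Pop[of Or \<rho> 1 ?U h]] Cons.prems by simp
    ultimately have X: "runs Or \<rho> (?X a) (?U, h) (1 + Suc 2) (?S, h)"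
      by (intro runs_Seq)
    have "runs Or \<rho> (Branch 1 Skip (?X False) (?X True)) (?U, h) (Suc (1 + Suc 2)) (?S, h)"
    proof (cases a)
      case True
      show ?thesis by (rule runs_Branch(3)[of ?U 1 u]) (use X True Cons.prems in auto)
    next
      case False
      show ?thesis by (rule runs_Branch(2)[of ?U 1 u]) (use X False Cons.prems in auto)
    qed
    from runs_Seq[OF exec_runs[OF exec.Pop] this]
    have B: "runs Or \<rho> ?B (R, h) (1 + Suc (1 + Suc 2)) (?S, h)" .
    have ne: "R 1 \<noteq> []" using Cons.prems by auto
    have x: "runs Or \<rho> (Loop 1 ?B) (?S, h) (7 * length u + 1)
      (?S(0 := [], 1 := [], 2 := [], 3 := rev (map2 (\<noteq>) u v) @ ?S 3), h)"
      by (rule Cons.IH) (use Cons.prems in auto)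
    have eq: "?S(0 := [], 1 := [], 2 := [], 3 := rev (map2 (\<noteq>) u v) @ ?S 3)
      = R(0 := [], 1 := [], 2 := [], 3 := rev (map2 (\<noteq>) (a # u) (b # v)) @ R 3)"
      by (auto simp: fun_eq_iff)
    have num: "Suc (1 + Suc (1 + Suc 2) + (7 * length u + 1)) = 7 * length (a # u) + 1" by simp
    show ?case
      using runs_LoopStep[OF ne B x] unfolding eq num .
  qed
  let ?P = "Seq (Loop 1 ?B) (move 3 0)"
  have run: "computes_within Or \<rho> ?P [unary \<eta>, u, v] (poly [:2, 11:] (\<eta> + length u + length v)) (map2 (\<noteq>) u v)"
    if uv: "length u = \<eta>" "length v = \<eta>" for Or \<rho> \<eta> u v
  proof -
    define R0 where "R0 = fst (initial [unary \<eta>, u, v])"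
    have R0: "initial [unary \<eta>, u, v] = (R0, 0)" "R0 0 = unary \<eta>" "R0 1 = u" "R0 2 = v" "R0 3 = []"
      by (auto simp: R0_def initial_def numeral_3_eq_3 numeral_2_eq_2)
    let ?S = "R0(0 := [], 1 := [], 2 := [], 3 := rev (map2 (\<noteq>) u v) @ R0 3)"
    have "runs Or \<rho> ?P (R0, 0) ((7 * length u + 1) + (4 * length (?S 3) + 1))
       (?S(3 := [], 0 := rev (?S 3) @ ?S 0), 0)"
      by (rule runs_Seq[OF L runs_move]) (use R0 uv in \<open>auto simp: unary_def\<close>)
    then show ?thesis
      by (intro computes_withinI[of Or \<rho> _ _ _ "?S(3 := [], 0 := rev (?S 3) @ ?S 0)" 0])
        (use R0 uv in \<open>auto intro: runs_mono\<close>)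
  qed
  have "computes_within Or \<rho> ?P (unary \<eta> # xs) (poly [:2, 11:] (\<eta> + sum_list (map length xs))) (map2 (\<noteq>) (xs ! 0) (xs ! 1))"
    if xs: "length xs = 2 \<and> length (xs ! 0) = \<eta> \<and> length (xs ! 1) = \<eta>" for Or \<rho> \<eta> xs
  proof -
    obtain u v where "xs = [u, v]"
      using xs by (auto simp: numeral_2_eq_2 length_Suc_conv)
    then show ?thesis using run[of u \<eta> v Or \<rho>] xs by (simp add: add.assoc)
  qed
  then show ?thesis
    unfolding ptime_def by (intro exI[of _ ?P] exI[of _ "[:2, 11:]"]) blast
qed

lemma computable_block: "computable (\<lambda>\<eta> Or \<rho>. block \<eta> \<rho> n)"
  using computable_ptime[where Fs = "[]" and k = n, OF ptime_read] by (simp add: block_def)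

lemma computable_zero: "computable (\<lambda>\<eta> Or \<rho>. replicate \<eta> False)"
  using computable_ptime[where Fs = "[]" and k = 0, OF ptime_zero] by simp

lemma computable_xor:
  assumes "computable F" "computable E"
    and "\<And>\<eta> Or \<rho>. (\<And>x. length (Or x) = \<eta>) \<Longrightarrow> length (F \<eta> Or \<rho>) = \<eta> \<and> length (E \<eta> Or \<rho>) = \<eta>"
  shows "computable (\<lambda>\<eta> Or \<rho>. map2 (\<noteq>) (F \<eta> Or \<rho>) (E \<eta> Or \<rho>))"
  using computable_ptime[where Fs = "[F, E]" and k = 0, OF ptime_xor] assms by simp

section \<open>Random tapes and random functions\<close>

inductive_cases exec_SkipE: "exec Or \<rho> Skip s t s'"
inductive_cases exec_PushE: "exec Or \<rho> (Push r b) s t s'"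
inductive_cases exec_PopE: "exec Or \<rho> (Pop r) s t s'"
inductive_cases exec_FlipE: "exec Or \<rho> (Flip r) s t s'"
inductive_cases exec_RewindE: "exec Or \<rho> Rewind s t s'"
inductive_cases exec_QueryE: "exec Or \<rho> (Query r) s t s'"
inductive_cases exec_SeqE: "exec Or \<rho> (Seq c d) s t s'"

lemma exec_deterministic:
  "exec Or \<rho> c s t s' \<Longrightarrow> exec Or \<rho> c s u s'' \<Longrightarrow> s'' = s'"
proof (induction arbitrary: u s'' rule: exec.induct)
  case (Seq c1 s t1 s1 c2 t2 s2)
  from Seq.prems show ?case by (rule exec_SeqE) (metis Seq.IH)
next
  case (BranchEmpty R r ce h t s' c0 c1)
  from BranchEmpty.prems have "\<exists>u'. exec Or \<rho> ce (R, h) u' s''" by cases (use BranchEmpty.hyps(1) in auto)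
  then show ?case using BranchEmpty.IH by blast
next
  case (Branch0 R r w c0 h t s' ce c1)
  from Branch0.prems have "\<exists>u'. exec Or \<rho> c0 (R, h) u' s''" by cases (use Branch0.hyps(1) in auto)
  then show ?case using Branch0.IH by blast
next
  case (Branch1 R r w c1 h t s' ce c0)
  from Branch1.prems have "\<exists>u'. exec Or \<rho> c1 (R, h) u' s''" by cases (use Branch1.hyps(1) in auto)
  then show ?case using Branch1.IH by blast
next
  case (LoopEnd R r c h)
  from LoopEnd.prems show ?case by cases (use LoopEnd.hyps in simp_all)
next
  case (LoopStep R r c h t1 s1 t2 s2)
  from LoopStep.prems show ?case
  proof cases
    case (LoopStep t1' s1' t2')
    then show ?thesis using LoopStep.IH by blast
  qed (use LoopStep.hyps(1) in simp)
qed (auto elim: exec_SkipE exec_PushE exec_PopE exec_FlipE exec_RewindE exec_QueryE)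

lemma exec_head: "exec Or \<rho> c s t s' \<Longrightarrow> snd s' \<le> snd s + t"
  by (induction rule: exec.induct) auto

lemma exec_finite_tape:
  assumes "exec Or \<rho> c s t s'" "snd s + t \<le> N" "\<And>i. i < N \<Longrightarrow> \<rho> i = \<rho>' i"
  shows "exec Or \<rho>' c s t s'"
  using assms
proof (induction rule: exec.induct)
  case (Seq c1 s t1 s1 c2 t2 s2)
  with exec_head[OF Seq.hyps(1)] show ?case by (auto intro!: exec.Seq)
next
  case (LoopStep R r c h t1 s1 t2 s2)
  with exec_head[OF LoopStep.hyps(2)] show ?case by (auto intro!: exec.LoopStep)
next
  case (Flip r R h)
  then show ?case using exec.Flip[of Or \<rho>' r R h] by simp
qed (auto intro: exec.intros[unfolded One_nat_def])

text \<open>The head advances by at most one position per step, so tapes that agree on a prefix as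
  long as the running time have the same run, and determinism makes the computed value unique. This
  finite dependence is the source of measurability in the infinite product.\<close>

lemma ptime_finite_tape:
  assumes "ptime D f" "D \<eta> xs"
  obtains N where "\<And>\<rho> \<rho>'. (\<And>i. i < N \<Longrightarrow> \<rho> i = \<rho>' i) \<Longrightarrow> f \<eta> xs \<rho> = f \<eta> xs \<rho>'"
proof -
  obtain c p where c: "\<And>Or \<rho>. computes_within Or \<rho> c (unary \<eta> # xs) (poly p (\<eta> + sum_list (map length xs))) (f \<eta> xs \<rho>)"
    using assms unfolding ptime_def by blast
  let ?N = "poly p (\<eta> + sum_list (map length xs))"
  show thesis
  proof (rule that[of ?N])
    fix \<rho> \<rho>' :: tape assume eq: "\<And>i. i < ?N \<Longrightarrow> \<rho> i = \<rho>' i"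
    obtain t R h where e: "exec (\<lambda>_. []) \<rho> c (initial (unary \<eta> # xs)) t (R, h)" "t \<le> ?N" "R 0 = f \<eta> xs \<rho>"
      using c[of "\<lambda>_. []" \<rho>] by (auto simp: computes_within_def)
    obtain t' R' h' where e': "exec (\<lambda>_. []) \<rho>' c (initial (unary \<eta> # xs)) t' (R', h')" "R' 0 = f \<eta> xs \<rho>'"
      using c[of "\<lambda>_. []" \<rho>'] by (auto simp: computes_within_def)
    have "exec (\<lambda>_. []) \<rho>' c (initial (unary \<eta> # xs)) t (R, h)"
      by (rule exec_finite_tape[OF e(1) _ eq]) (use e(2) in \<open>auto simp: initial_def\<close>)
    from exec_deterministic[OF this e'(1)] show "f \<eta> xs \<rho> = f \<eta> xs \<rho>'" using e(3) e'(2) by simp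
  qed
qed

lemma space_random_tape [simp]: "space random_tape = UNIV"
  by (simp add: random_tape_def space_PiM space_uniform_count_measure)

lemma measurable_tape_bit: "(\<lambda>\<rho>. \<rho> i) \<in> random_tape \<rightarrow>\<^sub>M count_space UNIV"
proof -
  have "(\<lambda>\<rho>. \<rho> i) \<in> random_tape \<rightarrow>\<^sub>M uniform_count_measure (UNIV :: bool set)"
    unfolding random_tape_def by (rule measurable_component_singleton) simp
  then show ?thesis
    by (simp add: measurable_def space_uniform_count_measure sets_uniform_count_measure)
qed

lemma measurable_tape_prefix: "(\<lambda>\<rho>. map \<rho> [0..<N]) \<in> random_tape \<rightarrow>\<^sub>M count_space UNIV"
proof (induction N)
  case (Suc N)
  have "(\<lambda>\<rho>. (\<lambda>w \<rho>. w @ [\<rho> N]) (map \<rho> [0..<N]) \<rho>) \<in> random_tape \<rightarrow>\<^sub>M count_space UNIV"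
  proof (rule measurable_compose_countable[OF _ Suc])
    show "(\<lambda>\<rho>. w @ [\<rho> N]) \<in> random_tape \<rightarrow>\<^sub>M count_space UNIV" for w :: bits
      by (rule measurable_compose[OF measurable_tape_bit, of "\<lambda>b. w @ [b]"]) simp
  qed
  then show ?case by simp
qed simp

lemma measurable_ptime:
  assumes "ptime D f" "D \<eta> xs"
  shows "(\<lambda>\<rho>. f \<eta> xs \<rho>) \<in> random_tape \<rightarrow>\<^sub>M count_space UNIV"
proof -
  obtain N where N: "\<And>\<rho> \<rho>'. (\<And>i. i < N \<Longrightarrow> \<rho> i = \<rho>' i) \<Longrightarrow> f \<eta> xs \<rho> = f \<eta> xs \<rho>'"
    using ptime_finite_tape[OF assms] by blast
  have "f \<eta> xs \<rho> = f \<eta> xs (\<lambda>i. map \<rho> [0..<N] ! i)" for \<rho>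
    by (rule N) simp
  then have "(\<lambda>\<rho>. f \<eta> xs \<rho>) = (\<lambda>\<rho>. (\<lambda>w. f \<eta> xs (\<lambda>i. w ! i)) (map \<rho> [0..<N]))"
    by (simp only:)
  also have "\<dots> \<in> random_tape \<rightarrow>\<^sub>M count_space UNIV"
    by (rule measurable_compose[OF measurable_tape_prefix]) simp
  finally show ?thesis .
qed

section \<open>Names as uniform vectors of words\<close>

definition words :: "nat \<Rightarrow> bits set" where
  "words \<eta> = {w. length w = \<eta>}"

text \<open>The default value \<open>[]\<close> from \<open>K\<close> on makes the vectors a finite
  set of total functions.\<close>

definition vectors :: "nat \<Rightarrow> nat \<Rightarrow> (nat \<Rightarrow> bits) set" where
  "vectors \<eta> K = PiE_dflt {..<K} [] (\<lambda>_. words \<eta>)"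

definition names :: "nat \<Rightarrow> nat \<Rightarrow> tape \<Rightarrow> nat \<Rightarrow> bits" where
  "names \<eta> K \<rho> n = (if n < K then block \<eta> \<rho> n else [])"

lemma finite_words [simp]: "finite (words \<eta>)"
  using finite_lists_length_eq[of "UNIV :: bool set" \<eta>] by (simp add: words_def)

lemma card_words: "card (words \<eta>) = 2 ^ \<eta>"
  using card_lists_length_eq[of "UNIV :: bool set" \<eta>] by (simp add: words_def)

lemma finite_vectors [simp]: "finite (vectors \<eta> K)"
  by (auto simp: vectors_def)

lemma card_vectors: "card (vectors \<eta> K) = 2 ^ (K * \<eta>)"
  by (simp add: vectors_def card_PiE_dflt card_words power_mult[symmetric] mult.commute)

lemma vectors_iff: "\<nu> \<in> vectors \<eta> K \<longleftrightarrow> (\<forall>n<K. length (\<nu> n) = \<eta>) \<and> (\<forall>n\<ge>K. \<nu> n = [])"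
  by (auto simp: vectors_def PiE_dflt_def words_def not_less)

lemma names_in_vectors: "names \<eta> K \<rho> \<in> vectors \<eta> K"
  by (auto simp: vectors_iff names_def block_def)

lemma prob_space_random_tape: "prob_space random_tape"
  unfolding random_tape_def
  by (intro prob_space_PiM prob_space_uniform_count_measure) auto

text \<open>Bit \<open>j\<close> of the tape is bit \<open>j mod \<eta>\<close> of block
  \<open>j div \<eta>\<close>. The event is thus a cylinder set over finitely many coordinates,
  whose measure is a product.\<close>

lemma names_eq_iff:
  assumes "\<nu> \<in> vectors \<eta> K"
  shows "names \<eta> K \<rho> = \<nu> \<longleftrightarrow> (\<forall>j\<in>{..<K * \<eta>}. \<rho> j \<in> {\<nu> (j div \<eta>) ! (j mod \<eta>)})"
proof -
  have len: "length (\<nu> n) = \<eta>" if "n < K" for n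
    using assms that by (simp add: vectors_iff)
  have "names \<eta> K \<rho> = \<nu> \<longleftrightarrow> (\<forall>n<K. block \<eta> \<rho> n = \<nu> n)"
    using assms by (auto simp: fun_eq_iff names_def vectors_iff)
  also have "\<dots> \<longleftrightarrow> (\<forall>n<K. \<forall>i<\<eta>. \<rho> (n * \<eta> + i) = \<nu> n ! i)"
    using len by (auto simp: block_def list_eq_iff_nth_eq)
  also have "\<dots> \<longleftrightarrow> (\<forall>j<K * \<eta>. \<rho> j = \<nu> (j div \<eta>) ! (j mod \<eta>))"
  proof (rule iffI; intro allI impI)
    fix j assume *: "\<forall>n<K. \<forall>i<\<eta>. \<rho> (n * \<eta> + i) = \<nu> n ! i" "j < K * \<eta>"
    then have "j div \<eta> < K" "j mod \<eta> < \<eta>"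
      by (auto simp: less_mult_imp_div_less intro!: mod_less_divisor gr0I)
    with *(1) have "\<rho> (j div \<eta> * \<eta> + j mod \<eta>) = \<nu> (j div \<eta>) ! (j mod \<eta>)" by blast
    then show "\<rho> j = \<nu> (j div \<eta>) ! (j mod \<eta>)" by simp
  next
    fix n i assume *: "\<forall>j<K * \<eta>. \<rho> j = \<nu> (j div \<eta>) ! (j mod \<eta>)" "n < K" "i < \<eta>"
    then have "n * \<eta> + i < Suc n * \<eta>" by simp
    also have "\<dots> \<le> K * \<eta>" using * by (intro mult_le_mono1) simp
    finally have "\<rho> (n * \<eta> + i) = \<nu> ((n * \<eta> + i) div \<eta>) ! ((n * \<eta> + i) mod \<eta>)" using * by blast
    then show "\<rho> (n * \<eta> + i) = \<nu> n ! i" using * by simp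
  qed
  finally show ?thesis by auto
qed

lemma
  assumes "\<nu> \<in> vectors \<eta> K"
  shows emeasure_names_eq: "emeasure random_tape {\<rho>. names \<eta> K \<rho> = \<nu>} = ennreal (1 / card (vectors \<eta> K))"
    and sets_names_eq: "{\<rho>. names \<eta> K \<rho> = \<nu>} \<in> sets random_tape"
proof -
  interpret U: prob_space "uniform_count_measure (UNIV :: bool set)"
    by (rule prob_space_uniform_count_measure) auto
  interpret P: product_prob_space "\<lambda>_ :: nat. uniform_count_measure (UNIV :: bool set)" UNIV
    by unfold_locales
  let ?X = "\<lambda>j. {\<nu> (j div \<eta>) ! (j mod \<eta>)}"
  have sp: "space (PiM UNIV (\<lambda>_ :: nat. uniform_count_measure (UNIV :: bool set))) = UNIV"
    using space_random_tape by (simp add: random_tape_def)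
  have "emeasure random_tape {\<rho> \<in> space random_tape. \<forall>j\<in>{..<K * \<eta>}. \<rho> j \<in> ?X j} =
    (\<Prod>j\<in>{..<K * \<eta>}. emeasure (uniform_count_measure UNIV) (?X j))"
    unfolding random_tape_def by (rule P.emeasure_PiM_Collect) (auto simp: sets_uniform_count_measure)
  also have "\<dots> = (\<Prod>j\<in>{..<K * \<eta>}. ennreal (1 / 2))"
    by (intro prod.cong refl) (simp add: emeasure_uniform_count_measure)
  also have "\<dots> = ennreal (1 / card (vectors \<eta> K))"
    by (subst prod_ennreal) (auto simp: card_vectors power_divide)
  finally show "emeasure random_tape {\<rho>. names \<eta> K \<rho> = \<nu>} = ennreal (1 / card (vectors \<eta> K))"
    using names_eq_iff[OF assms] by simp
  have "{\<rho> \<in> space random_tape. \<forall>j\<in>{..<K * \<eta>}. \<rho> j \<in> ?X j} \<in> sets random_tape"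
    by (intro sets.sets_Collect_finite_All measurable_sets_Collect[OF measurable_tape_bit]) auto
  then show "{\<rho>. names \<eta> K \<rho> = \<nu>} \<in> sets random_tape"
    using names_eq_iff[OF assms] by simp
qed

text \<open>The honest tape matters only through finitely many names, which are uniform. Its
  probability becomes a finite average, and measurability is required only for each fixed vector of
  names.\<close>

lemma tape_pair_average:
  assumes "\<And>\<nu>. \<nu> \<in> vectors \<eta> K \<Longrightarrow> {\<rho>. \<phi> \<nu> \<rho>} \<in> sets random_tape"
  shows "emeasure (random_tape \<Otimes>\<^sub>M random_tape) {(\<rho>1, \<rho>2). \<phi> (names \<eta> K \<rho>1) \<rho>2} =
    ennreal (1 / card (vectors \<eta> K)) * (\<Sum>\<nu>\<in>vectors \<eta> K. emeasure random_tape {\<rho>. \<phi> \<nu> \<rho>})"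
proof -
  interpret T: prob_space random_tape by (rule prob_space_random_tape)
  let ?V = "vectors \<eta> K"
  let ?E = "\<lambda>\<nu>. {\<rho>. names \<eta> K \<rho> = \<nu>} \<times> {\<rho>. \<phi> \<nu> \<rho>}"
  have "{(\<rho>1, \<rho>2). \<phi> (names \<eta> K \<rho>1) \<rho>2} = (\<Union>\<nu>\<in>?V. ?E \<nu>)"
    using names_in_vectors by auto
  then have "emeasure (random_tape \<Otimes>\<^sub>M random_tape) {(\<rho>1, \<rho>2). \<phi> (names \<eta> K \<rho>1) \<rho>2} =
      emeasure (random_tape \<Otimes>\<^sub>M random_tape) (\<Union>\<nu>\<in>?V. ?E \<nu>)" by simp
  also have "\<dots> = (\<Sum>\<nu>\<in>?V. emeasure (random_tape \<Otimes>\<^sub>M random_tape) (?E \<nu>))"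
    by (rule sum_emeasure[symmetric])
      (use assms sets_names_eq in \<open>auto simp: disjoint_family_on_def\<close>)
  also have "\<dots> = (\<Sum>\<nu>\<in>?V. ennreal (1 / card ?V) * emeasure random_tape {\<rho>. \<phi> \<nu> \<rho>})"
    by (intro sum.cong refl, subst T.emeasure_pair_measure_Times)
      (use assms sets_names_eq emeasure_names_eq in auto)
  finally show ?thesis by (simp add: sum_distrib_left)
qed

lemma measurable_drop_tape: "(\<lambda>\<rho> i. \<rho> (k + i)) \<in> random_tape \<rightarrow>\<^sub>M random_tape"
proof -
  have "(\<lambda>\<rho> i. \<rho> (k + i)) \<in> random_tape \<rightarrow>\<^sub>M (\<Pi>\<^sub>M i\<in>UNIV. uniform_count_measure (UNIV :: bool set))"
    by (rule measurable_PiM_single')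
      (auto simp: random_tape_def space_uniform_count_measure intro!: measurable_component_singleton)
  then show ?thesis by (simp add: random_tape_def)
qed

text \<open>One tape serves as two: its first \<open>K * \<eta>\<close> bits give the names and the
  remainder is an independent random tape. \<open>comb_seq\<close> glues a prefix of one tape to
  another tape and preserves the distribution, which reduces the claim to the case of two
  tapes.\<close>

lemma tape_average:
  assumes "\<And>\<nu>. \<nu> \<in> vectors \<eta> K \<Longrightarrow> {\<rho>. \<phi> \<nu> \<rho>} \<in> sets random_tape"
  shows "emeasure random_tape {\<rho>. \<phi> (names \<eta> K \<rho>) (\<lambda>i. \<rho> (K * \<eta> + i))} =
    ennreal (1 / card (vectors \<eta> K)) * (\<Sum>\<nu>\<in>vectors \<eta> K. emeasure random_tape {\<rho>. \<phi> \<nu> \<rho>})"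
    (is ?thesis1)
    and "{\<rho>. \<phi> (names \<eta> K \<rho>) (\<lambda>i. \<rho> (K * \<eta> + i))} \<in> sets random_tape" (is ?thesis2)
proof -
  interpret U: prob_space "uniform_count_measure (UNIV :: bool set)"
    by (rule prob_space_uniform_count_measure) auto
  interpret P: sequence_space "uniform_count_measure (UNIV :: bool set)"
    by unfold_locales
  let ?V = "vectors \<eta> K"
  let ?E = "{\<rho>. \<phi> (names \<eta> K \<rho>) (\<lambda>i. \<rho> (K * \<eta> + i))}"
  let ?c = "\<lambda>(\<omega>, \<omega>'). comb_seq (K * \<eta>) \<omega> \<omega>'"
  have "?E = (\<Union>\<nu>\<in>?V. {\<rho>. names \<eta> K \<rho> = \<nu>} \<inter> ((\<lambda>\<rho> i. \<rho> (K * \<eta> + i)) -` {\<rho>. \<phi> \<nu> \<rho>} \<inter> space random_tape))"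
    using names_in_vectors by auto
  also have "\<dots> \<in> sets random_tape"
    using assms sets_names_eq by (intro sets.finite_UN sets.Int measurable_sets[OF measurable_drop_tape]) auto
  finally show E: ?thesis2 .
  have n: "names \<eta> K (comb_seq (K * \<eta>) \<omega> \<omega>') = names \<eta> K \<omega>" for \<omega> \<omega>' :: tape
  proof
    fix n
    have "n * \<eta> + i < K * \<eta>" if "n < K" "i < \<eta>" for i
    proof -
      have "n * \<eta> + i < Suc n * \<eta>" using that by simp
      also have "\<dots> \<le> K * \<eta>" using that by (intro mult_le_mono1) simp
      finally show ?thesis .
    qed
    then show "names \<eta> K (comb_seq (K * \<eta>) \<omega> \<omega>') n = names \<eta> K \<omega> n"
      by (auto simp: names_def block_def comb_seq_less)
  qed
  have meas: "?c \<in> random_tape \<Otimes>\<^sub>M random_tape \<rightarrow>\<^sub>M random_tape"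
    unfolding random_tape_def by (rule measurable_comb_seq)
  have "emeasure random_tape ?E = emeasure (distr (random_tape \<Otimes>\<^sub>M random_tape) random_tape ?c) ?E"
    using P.PiM_comb_seq[of "K * \<eta>"] by (simp add: random_tape_def)
  also have "\<dots> = emeasure (random_tape \<Otimes>\<^sub>M random_tape) (?c -` ?E \<inter> space (random_tape \<Otimes>\<^sub>M random_tape))"
    by (rule emeasure_distr[OF meas E])
  also have "?c -` ?E \<inter> space (random_tape \<Otimes>\<^sub>M random_tape) = {(\<rho>1, \<rho>2). \<phi> (names \<eta> K \<rho>1) \<rho>2}"
    by (auto simp: space_pair_measure n comb_seq_def)
  also have "emeasure (random_tape \<Otimes>\<^sub>M random_tape) \<dots> =
     ennreal (1 / card ?V) * (\<Sum>\<nu>\<in>?V. emeasure random_tape {\<rho>. \<phi> \<nu> \<rho>})"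
    by (rule tape_pair_average[OF assms])
  finally show ?thesis1 .
qed

lemma measure_from_average:
  assumes "prob_space M" "prob_space N" "finite V"
    "emeasure M E = ennreal (1 / real c) * (\<Sum>\<nu>\<in>V. emeasure N (F \<nu>))"
  shows "measure M E = (\<Sum>\<nu>\<in>V. measure N (F \<nu>)) / c"
proof -
  interpret M: prob_space M by fact
  interpret N: prob_space N by fact
  have "ennreal (measure M E) = ennreal (1 / real c) * ennreal (\<Sum>\<nu>\<in>V. measure N (F \<nu>))"
    using assms(4) by (simp add: M.emeasure_eq_measure N.emeasure_eq_measure sum_ennreal)
  also have "\<dots> = ennreal (1 / real c * (\<Sum>\<nu>\<in>V. measure N (F \<nu>)))"
    by (rule ennreal_mult'[symmetric]) simp
  finally have "measure M E = 1 / real c * (\<Sum>\<nu>\<in>V. measure N (F \<nu>))"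
    by (subst (asm) ennreal_inj) (auto intro!: mult_nonneg_nonneg sum_nonneg divide_nonneg_nonneg)
  then show ?thesis by simp
qed

lemma prob_space_pair_tape: "prob_space N \<Longrightarrow> prob_space (N \<Otimes>\<^sub>M random_tape)"
  by (rule prob_space_pair[OF _ prob_space_random_tape])

lemma prob_tape_pair_average:
  assumes "\<And>\<nu>. \<nu> \<in> vectors \<eta> K \<Longrightarrow> {\<rho>. \<phi> \<nu> \<rho>} \<in> sets random_tape"
  shows "\<P>((\<rho>1, \<rho>2) in random_tape \<Otimes>\<^sub>M random_tape. \<phi> (names \<eta> K \<rho>1) \<rho>2) =
    (\<Sum>\<nu>\<in>vectors \<eta> K. \<P>(\<rho> in random_tape. \<phi> \<nu> \<rho>)) / card (vectors \<eta> K)"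
  using measure_from_average[OF prob_space_pair_tape[OF prob_space_random_tape] prob_space_random_tape finite_vectors
    tape_pair_average[OF assms]] by (simp add: space_pair_measure)

text \<open>\<open>N\<close> will carry the uniform key or the random function behind the oracle.
  Integrating over it reduces the claim to \<open>tape_average\<close> for each of its
  values.\<close>

lemma prob_tape_average:
  assumes "prob_space N"
    and \<phi>: "\<And>\<nu>. \<nu> \<in> vectors \<eta> K \<Longrightarrow> {p \<in> space (N \<Otimes>\<^sub>M random_tape). \<phi> (fst p) \<nu> (snd p)} \<in> sets (N \<Otimes>\<^sub>M random_tape)"
  shows "\<P>(p in N \<Otimes>\<^sub>M random_tape. \<phi> (fst p) (names \<eta> K (snd p)) (\<lambda>i. snd p (K * \<eta> + i))) =
    (\<Sum>\<nu>\<in>vectors \<eta> K. \<P>(p in N \<Otimes>\<^sub>M random_tape. \<phi> (fst p) \<nu> (snd p))) / card (vectors \<eta> K)"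
proof (rule measure_from_average)
  interpret N: prob_space N by fact
  interpret T: prob_space random_tape by (rule prob_space_random_tape)
  let ?V = "vectors \<eta> K" and ?NT = "N \<Otimes>\<^sub>M random_tape"
  let ?E = "{p \<in> space ?NT. \<phi> (fst p) (names \<eta> K (snd p)) (\<lambda>i. snd p (K * \<eta> + i))}"
  let ?F = "\<lambda>\<nu>. {p \<in> space ?NT. \<phi> (fst p) \<nu> (snd p)}"
  let ?h = "\<lambda>p. (fst p, \<lambda>i. snd p (K * \<eta> + i))"
  have h: "?h \<in> ?NT \<rightarrow>\<^sub>M ?NT"
    by (intro measurable_Pair measurable_fst measurable_compose[OF measurable_snd measurable_drop_tape])
  have F: "{\<rho>. \<phi> x \<nu> \<rho>} \<in> sets random_tape" "Product_Type.Pair x -` ?F \<nu> = {\<rho>. \<phi> x \<nu> \<rho>}"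
    if "\<nu> \<in> ?V" "x \<in> space N" for x \<nu>
    using sets_Pair1[OF \<phi>[OF that(1)], of x] that(2) by (auto simp: space_pair_measure)
  have "?E = (\<Union>\<nu>\<in>?V. (space N \<times> {\<rho>. names \<eta> K \<rho> = \<nu>}) \<inter> (?h -` ?F \<nu> \<inter> space ?NT))"
    using names_in_vectors by (auto simp: space_pair_measure)
  also have "\<dots> \<in> sets ?NT"
    using \<phi> by (intro sets.finite_UN sets.Int measurable_sets[OF h] pair_measureI sets_names_eq) auto
  finally have E: "?E \<in> sets ?NT" .
  have PE: "Product_Type.Pair x -` ?E = {\<rho>. \<phi> x (names \<eta> K \<rho>) (\<lambda>i. \<rho> (K * \<eta> + i))}" if "x \<in> space N" for x
    using that by (auto simp: space_pair_measure)
  have "emeasure ?NT ?E = (\<integral>\<^sup>+x. emeasure random_tape (Product_Type.Pair x -` ?E) \<partial>N)"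
    by (rule T.emeasure_pair_measure_alt[OF E])
  also have "\<dots> = (\<integral>\<^sup>+x. ennreal (1 / card ?V) * (\<Sum>\<nu>\<in>?V. emeasure random_tape (Product_Type.Pair x -` ?F \<nu>)) \<partial>N)"
    by (intro nn_integral_cong) (simp add: F PE tape_average(1) del: vimage_Collect_eq)
  also have "\<dots> = ennreal (1 / card ?V) * (\<integral>\<^sup>+x. (\<Sum>\<nu>\<in>?V. emeasure random_tape (Product_Type.Pair x -` ?F \<nu>)) \<partial>N)"
    by (intro nn_integral_cmult borel_measurable_sum T.measurable_emeasure_Pair \<phi>)
  also have "(\<integral>\<^sup>+x. (\<Sum>\<nu>\<in>?V. emeasure random_tape (Product_Type.Pair x -` ?F \<nu>)) \<partial>N) = (\<Sum>\<nu>\<in>?V. \<integral>\<^sup>+x. emeasure random_tape (Product_Type.Pair x -` ?F \<nu>) \<partial>N)"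
    by (intro nn_integral_sum T.measurable_emeasure_Pair \<phi>)
  also have "\<dots> = (\<Sum>\<nu>\<in>?V. emeasure ?NT (?F \<nu>))"
    by (intro sum.cong refl T.emeasure_pair_measure_alt[symmetric] \<phi>)
  finally show "emeasure ?NT ?E = ennreal (1 / real (card ?V)) * (\<Sum>\<nu>\<in>?V. emeasure ?NT (?F \<nu>))" .
qed (use assms(1) prob_space_pair_tape in auto)

section \<open>Uniform keys and random functions\<close>

lemma space_uniform_bits: "space (uniform_bits \<eta>) = words \<eta>"
  by (simp add: uniform_bits_def space_uniform_count_measure words_def)

lemma prob_space_uniform_bits: "prob_space (uniform_bits \<eta>)"
  unfolding uniform_bits_def
  by (intro prob_space_uniform_count_measure)
    (use finite_words[of \<eta>] in \<open>auto simp: words_def intro: exI[of _ "replicate \<eta> False"]\<close>)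

lemma emeasure_uniform_bits: "w \<in> words \<eta> \<Longrightarrow> emeasure (uniform_bits \<eta>) {w} = ennreal (1 / card (words \<eta>))"
  unfolding uniform_bits_def using finite_words[of \<eta>]
  by (subst emeasure_uniform_count_measure) (auto simp: words_def)

lemma sets_uniform_bits: "sets (uniform_bits \<eta>) = Pow (words \<eta>)"
  by (simp add: uniform_bits_def sets_uniform_count_measure words_def)

lemma prob_uniform_bits_average:
  assumes "prob_space N"
    and \<phi>: "\<And>k. k \<in> words \<eta> \<Longrightarrow> {y \<in> space N. \<phi> k y} \<in> sets N"
  shows "\<P>(p in uniform_bits \<eta> \<Otimes>\<^sub>M N. \<phi> (fst p) (snd p)) = (\<Sum>k\<in>words \<eta>. \<P>(y in N. \<phi> k y)) / card (words \<eta>)"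
proof (rule measure_from_average)
  interpret U: prob_space "uniform_bits \<eta>" by (rule prob_space_uniform_bits)
  interpret N: prob_space N by fact
  let ?UN = "uniform_bits \<eta> \<Otimes>\<^sub>M N"
  let ?E = "\<lambda>k. {k} \<times> {y \<in> space N. \<phi> k y}"
  have "{p \<in> space ?UN. \<phi> (fst p) (snd p)} = (\<Union>k\<in>words \<eta>. ?E k)"
    by (auto simp: space_pair_measure space_uniform_bits)
  then have "emeasure ?UN {p \<in> space ?UN. \<phi> (fst p) (snd p)} = emeasure ?UN (\<Union>k\<in>words \<eta>. ?E k)" by simp
  also have "\<dots> = (\<Sum>k\<in>words \<eta>. emeasure ?UN (?E k))"
    by (rule sum_emeasure[symmetric])
      (use \<phi> in \<open>auto simp: disjoint_family_on_def sets_uniform_bits intro!: pair_measureI\<close>)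
  also have "\<dots> = (\<Sum>k\<in>words \<eta>. ennreal (1 / card (words \<eta>)) * emeasure N {y \<in> space N. \<phi> k y})"
    by (intro sum.cong refl, subst N.emeasure_pair_measure_Times)
      (use \<phi> in \<open>auto simp: sets_uniform_bits emeasure_uniform_bits\<close>)
  finally show "emeasure ?UN {p \<in> space ?UN. \<phi> (fst p) (snd p)} =
     ennreal (1 / real (card (words \<eta>))) * (\<Sum>k\<in>words \<eta>. emeasure N {y \<in> space N. \<phi> k y})"
    by (simp add: sum_distrib_left)
  show "prob_space ?UN" by (rule prob_space_pair[OF prob_space_uniform_bits assms(1)])
qed (use assms(1) in auto)

lemma prob_space_random_function: "prob_space (random_function \<eta>)"
  unfolding random_function_def by (intro prob_space_PiM prob_space_uniform_bits)

lemma space_random_function: "space (random_function \<eta>) = {g. \<forall>x. length (g x) = \<eta>}"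
  by (auto simp: random_function_def space_PiM space_uniform_bits words_def PiE_iff)

lemma measurable_random_function_eval: "(\<lambda>g. g x) \<in> random_function \<eta> \<rightarrow>\<^sub>M count_space UNIV"
proof -
  have "(\<lambda>g. g x) \<in> random_function \<eta> \<rightarrow>\<^sub>M uniform_bits \<eta>"
    unfolding random_function_def by (rule measurable_component_singleton) simp
  moreover have "(\<lambda>w. w) \<in> uniform_bits \<eta> \<rightarrow>\<^sub>M count_space UNIV"
    by (auto simp: measurable_def sets_uniform_bits space_uniform_bits)
  ultimately show ?thesis by (rule measurable_compose)
qed

text \<open>The coordinates of a random function are independent, so overwriting one fixed
  coordinate by a uniform word does not change the distribution. The sum over \<open>v\<close>
  stands for the expectation over this word; \<open>N\<close> will be the attacker's tape.\<close>

lemma random_function_reprogram: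
  assumes N: "prob_space N" and E: "E \<in> sets (random_function \<eta> \<Otimes>\<^sub>M N)"
  shows "(\<Sum>v\<in>words \<eta>. \<P>(p in random_function \<eta> \<Otimes>\<^sub>M N. ((fst p)(y := v), snd p) \<in> E)) =
    card (words \<eta>) * measure (random_function \<eta> \<Otimes>\<^sub>M N) E"
    and "v \<in> words \<eta> \<Longrightarrow> {p \<in> space (random_function \<eta> \<Otimes>\<^sub>M N). ((fst p)(y := v), snd p) \<in> E} \<in> sets (random_function \<eta> \<Otimes>\<^sub>M N)"
proof -
  let ?U = "uniform_bits \<eta>" and ?R = "random_function \<eta>"
  interpret N: prob_space N by fact
  interpret U: prob_space ?U by (rule prob_space_uniform_bits)
  interpret R: prob_space ?R by (rule prob_space_random_function)
  interpret RN: prob_space "?R \<Otimes>\<^sub>M N" by (rule prob_space_pair[OF prob_space_random_function N])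
  interpret UR: prob_space "?U \<Otimes>\<^sub>M ?R" by (rule prob_space_pair[OF prob_space_uniform_bits prob_space_random_function])
  interpret P: pair_sigma_finite ?R N by unfold_locales
  have upd2: "(\<lambda>(v, g). g(y := v)) \<in> ?U \<Otimes>\<^sub>M ?R \<rightarrow>\<^sub>M ?R"
  proof -
    have "(\<lambda>p. (snd p)(y := fst p)) \<in> ?U \<Otimes>\<^sub>M ?R \<rightarrow>\<^sub>M PiM (insert y UNIV) (\<lambda>_. ?U)"
      by (rule measurable_fun_upd[where J = UNIV]) (auto simp: random_function_def)
    then show ?thesis by (simp add: random_function_def split_beta')
  qed
  have upd: "(\<lambda>g. g(y := v)) \<in> ?R \<rightarrow>\<^sub>M ?R" if "v \<in> words \<eta>" for v
    using measurable_compose[OF measurable_Pair1'[of v ?U ?R] upd2] that by (simp add: space_uniform_bits)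
  have upd': "(\<lambda>p. ((fst p)(y := v), snd p)) \<in> ?R \<Otimes>\<^sub>M N \<rightarrow>\<^sub>M ?R \<Otimes>\<^sub>M N" if "v \<in> words \<eta>" for v
    by (intro measurable_Pair measurable_snd measurable_compose[OF measurable_fst upd[OF that]])
  let ?F = "\<lambda>v. {p \<in> space (?R \<Otimes>\<^sub>M N). ((fst p)(y := v), snd p) \<in> E}"
  show F: "?F v \<in> sets (?R \<Otimes>\<^sub>M N)" if "v \<in> words \<eta>" for v
    using measurable_sets[OF upd'[OF that] E] by (simp add: vimage_def Int_def conj_commute)
  \<comment> \<open>\<open>distr_pair_PiM_eq_PiM\<close> inserts a coordinate into a product. Here
    \<open>y\<close> already belongs to the index set, so the coordinate is redrawn.\<close>
  have distr: "distr (?U \<Otimes>\<^sub>M ?R) ?R (\<lambda>(v, g). g(y := v)) = ?R"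
    using distr_pair_PiM_eq_PiM[of UNIV "\<lambda>_. ?U" y] prob_space_uniform_bits by (simp add: random_function_def)
  have one: "emeasure ?R A = ennreal (1 / card (words \<eta>)) * (\<Sum>v\<in>words \<eta>. emeasure ?R ((\<lambda>g. g(y := v)) -` A \<inter> space ?R))"
    if A: "A \<in> sets ?R" for A
  proof -
    have "emeasure ?R A = emeasure (?U \<Otimes>\<^sub>M ?R) ((\<lambda>(v, g). g(y := v)) -` A \<inter> space (?U \<Otimes>\<^sub>M ?R))"
      using emeasure_distr[OF upd2 A] by (simp add: distr)
    also have "(\<lambda>(v, g). g(y := v)) -` A \<inter> space (?U \<Otimes>\<^sub>M ?R) = (\<Union>v\<in>words \<eta>. {v} \<times> ((\<lambda>g. g(y := v)) -` A \<inter> space ?R))"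
      by (auto simp: space_pair_measure space_uniform_bits)
    also have "emeasure (?U \<Otimes>\<^sub>M ?R) \<dots> = (\<Sum>v\<in>words \<eta>. emeasure (?U \<Otimes>\<^sub>M ?R) ({v} \<times> ((\<lambda>g. g(y := v)) -` A \<inter> space ?R)))"
      by (rule sum_emeasure[symmetric])
        (use measurable_sets[OF upd A] in \<open>auto simp: disjoint_family_on_def sets_uniform_bits intro!: pair_measureI\<close>)
    also have "\<dots> = (\<Sum>v\<in>words \<eta>. ennreal (1 / card (words \<eta>)) * emeasure ?R ((\<lambda>g. g(y := v)) -` A \<inter> space ?R))"
      by (intro sum.cong refl, subst R.emeasure_pair_measure_Times)
        (use measurable_sets[OF upd A] in \<open>auto simp: sets_uniform_bits emeasure_uniform_bits\<close>)
    finally show ?thesis by (simp add: sum_distrib_left)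
  qed
  have sec: "(\<lambda>g. (g, \<rho>)) -` ?F v = (\<lambda>g. g(y := v)) -` ((\<lambda>g. (g, \<rho>)) -` E) \<inter> space ?R" if "\<rho> \<in> space N" for \<rho> v
    using that by (auto simp: space_pair_measure)
  have "emeasure (?R \<Otimes>\<^sub>M N) E = (\<integral>\<^sup>+\<rho>. emeasure ?R ((\<lambda>g. (g, \<rho>)) -` E) \<partial>N)"
    by (rule P.emeasure_pair_measure_alt2[OF E])
  also have "\<dots> = (\<integral>\<^sup>+\<rho>. ennreal (1 / card (words \<eta>)) * (\<Sum>v\<in>words \<eta>. emeasure ?R ((\<lambda>g. (g, \<rho>)) -` ?F v)) \<partial>N)"
    using one[OF sets_Pair2[OF E]] by (intro nn_integral_cong) (simp only: sec)
  also have "\<dots> = ennreal (1 / card (words \<eta>)) * (\<integral>\<^sup>+\<rho>. (\<Sum>v\<in>words \<eta>. emeasure ?R ((\<lambda>g. (g, \<rho>)) -` ?F v)) \<partial>N)"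
    by (intro nn_integral_cmult borel_measurable_sum P.measurable_emeasure_Pair2 F)
  also have "(\<integral>\<^sup>+\<rho>. (\<Sum>v\<in>words \<eta>. emeasure ?R ((\<lambda>g. (g, \<rho>)) -` ?F v)) \<partial>N) = (\<Sum>v\<in>words \<eta>. \<integral>\<^sup>+\<rho>. emeasure ?R ((\<lambda>g. (g, \<rho>)) -` ?F v) \<partial>N)"
    by (intro nn_integral_sum P.measurable_emeasure_Pair2 F)
  also have "\<dots> = (\<Sum>v\<in>words \<eta>. emeasure (?R \<Otimes>\<^sub>M N) (?F v))"
    by (intro sum.cong refl P.emeasure_pair_measure_alt2[symmetric] F)
  finally have "measure (?R \<Otimes>\<^sub>M N) E = (\<Sum>v\<in>words \<eta>. measure (?R \<Otimes>\<^sub>M N) (?F v)) / card (words \<eta>)"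
    by (intro measure_from_average RN.prob_space_axioms finite_words)
  then show "(\<Sum>v\<in>words \<eta>. measure (?R \<Otimes>\<^sub>M N) (?F v)) = card (words \<eta>) * measure (?R \<Otimes>\<^sub>M N) E"
    by (simp add: card_words)
qed

text \<open>Point and target may be random, but they are functions of \<open>N\<close> alone. Once
  the component in \<open>N\<close> is fixed, a single coordinate of the random function is
  involved, and it is uniform.\<close>

lemma random_function_guess:
  assumes N: "prob_space N" and E: "{p \<in> space (random_function \<eta> \<Otimes>\<^sub>M N). fst p (y (snd p)) = z (snd p)} \<in> sets (random_function \<eta> \<Otimes>\<^sub>M N)"
  shows "\<P>(p in random_function \<eta> \<Otimes>\<^sub>M N. fst p (y (snd p)) = z (snd p)) \<le> 1 / 2 ^ \<eta>"
proof -
  let ?U = "uniform_bits \<eta>" and ?R = "random_function \<eta>"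
  let ?E = "{p \<in> space (?R \<Otimes>\<^sub>M N). fst p (y (snd p)) = z (snd p)}"
  interpret N: prob_space N by fact
  interpret U: prob_space ?U by (rule prob_space_uniform_bits)
  interpret R: prob_space ?R by (rule prob_space_random_function)
  interpret RN: prob_space "?R \<Otimes>\<^sub>M N" by (rule prob_space_pair[OF prob_space_random_function N])
  interpret P: pair_sigma_finite ?R N by unfold_locales
  interpret Q: product_prob_space "\<lambda>_ :: bits. ?U" UNIV by unfold_locales
  have "emeasure ?R ((\<lambda>g. (g, \<rho>)) -` ?E) \<le> ennreal (1 / 2 ^ \<eta>)" if "\<rho> \<in> space N" for \<rho>
  proof -
    \<comment> \<open>Targets of a length other than \<eta> are never hit, hence the intersection
      with \<open>words \<eta>\<close>.\<close>
    have "(\<lambda>g. (g, \<rho>)) -` ?E = {g \<in> space ?R. g (y \<rho>) \<in> {z \<rho>} \<inter> words \<eta>}"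
      using that by (auto simp: space_pair_measure space_random_function words_def)
    also have "emeasure ?R \<dots> = emeasure ?U ({z \<rho>} \<inter> words \<eta>)"
      unfolding random_function_def by (rule Q.emeasure_PiM_Collect_single) (auto simp: sets_uniform_bits)
    also have "\<dots> \<le> ennreal (1 / 2 ^ \<eta>)"
      using emeasure_uniform_bits[of "z \<rho>" \<eta>] by (cases "z \<rho> \<in> words \<eta>") (auto simp: card_words)
    finally show ?thesis .
  qed
  then have "emeasure (?R \<Otimes>\<^sub>M N) ?E \<le> (\<integral>\<^sup>+\<rho>. ennreal (1 / 2 ^ \<eta>) \<partial>N)"
    unfolding P.emeasure_pair_measure_alt2[OF E] by (intro nn_integral_mono) auto
  also have "\<dots> = ennreal (1 / 2 ^ \<eta>)" by (simp add: N.emeasure_space_1)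
  finally show ?thesis by (simp add: RN.emeasure_eq_measure ennreal_le_iff)
qed

text \<open>The bijection may depend on the sample \<open>p\<close>, so it cannot reindex the outer
  sum. Writing probabilities as integrals brings the sum inside, where \<open>p\<close> is
  fixed.\<close>

lemma sum_prob_bijection:
  assumes "prob_space N" "finite V"
    and bij: "\<And>p. p \<in> space N \<Longrightarrow> bij_betw (\<Psi> p) V V"
    and m1: "\<And>\<nu>. \<nu> \<in> V \<Longrightarrow> {p \<in> space N. \<phi> p \<nu>} \<in> sets N"
    and m2: "\<And>\<nu>. \<nu> \<in> V \<Longrightarrow> {p \<in> space N. \<phi> p (\<Psi> p \<nu>)} \<in> sets N"
  shows "(\<Sum>\<nu>\<in>V. \<P>(p in N. \<phi> p (\<Psi> p \<nu>))) = (\<Sum>\<nu>\<in>V. \<P>(p in N. \<phi> p \<nu>))"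
proof -
  interpret N: prob_space N by fact
  let ?i = "\<lambda>P. if P then 1 else 0 :: real"
  have I: "(\<Sum>\<nu>\<in>V. \<P>(p in N. Q p \<nu>)) = (\<integral>p. (\<Sum>\<nu>\<in>V. ?i (Q p \<nu>)) \<partial>N)"
    if m: "\<And>\<nu>. \<nu> \<in> V \<Longrightarrow> {p \<in> space N. Q p \<nu>} \<in> sets N" for Q
  proof -
    have ind: "integrable N (\<lambda>p. ?i (Q p \<nu>))" "(\<integral>p. ?i (Q p \<nu>) \<partial>N) = \<P>(p in N. Q p \<nu>)" if "\<nu> \<in> V" for \<nu>
    proof -
      have "integrable N (indicator {p \<in> space N. Q p \<nu>} :: _ \<Rightarrow> real)"
        using m[OF that] by (simp add: integrable_indicator_iff N.emeasure_eq_measure)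
      moreover have "(\<integral>p. indicator {p \<in> space N. Q p \<nu>} p \<partial>N) = \<P>(p in N. Q p \<nu>)"
        using m[OF that] by simp
      moreover have "indicator {p \<in> space N. Q p \<nu>} p = ?i (Q p \<nu>)" if "p \<in> space N" for p
        using that by (simp add: indicator_def)
      ultimately show "integrable N (\<lambda>p. ?i (Q p \<nu>))" "(\<integral>p. ?i (Q p \<nu>) \<partial>N) = \<P>(p in N. Q p \<nu>)"
        by (auto cong: Bochner_Integration.integrable_cong Bochner_Integration.integral_cong)
    qed
    then show ?thesis by (subst Bochner_Integration.integral_sum) auto
  qed
  have "(\<Sum>\<nu>\<in>V. \<P>(p in N. \<phi> p (\<Psi> p \<nu>))) = (\<integral>p. (\<Sum>\<nu>\<in>V. ?i (\<phi> p (\<Psi> p \<nu>))) \<partial>N)"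
    by (rule I) (rule m2)
  also have "\<dots> = (\<integral>p. (\<Sum>\<nu>\<in>V. ?i (\<phi> p \<nu>)) \<partial>N)"
    by (intro Bochner_Integration.integral_cong refl sum.reindex_bij_betw[OF bij])
  also have "\<dots> = (\<Sum>\<nu>\<in>V. \<P>(p in N. \<phi> p \<nu>))"
    by (rule I[symmetric]) (rule m1)
  finally show ?thesis .
qed

text \<open>Overwriting a coordinate by a fresh word is uniform: swap the coordinate and the word.\<close>

lemma sum_vectors_resample:
  fixes F :: "(nat \<Rightarrow> bits) \<Rightarrow> real"
  assumes "a < K"
  shows "(\<Sum>k\<in>words \<eta>. \<Sum>\<nu>\<in>vectors \<eta> K. F (\<nu>(a := k))) = card (words \<eta>) * (\<Sum>\<nu>\<in>vectors \<eta> K. F \<nu>)"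
proof -
  let ?s = "\<lambda>(k, \<nu>). (\<nu> a, \<nu>(a := k))"
  have "bij_betw ?s (words \<eta> \<times> vectors \<eta> K) (words \<eta> \<times> vectors \<eta> K)"
    by (rule bij_betw_byWitness[where f' = ?s]) (use assms in \<open>auto simp: vectors_iff words_def\<close>)
  from sum.reindex_bij_betw[OF this, of "\<lambda>(k, \<nu>). F \<nu>"]
  have "(\<Sum>(k, \<nu>)\<in>words \<eta> \<times> vectors \<eta> K. F (\<nu>(a := k))) = (\<Sum>(k, \<nu>)\<in>words \<eta> \<times> vectors \<eta> K. F \<nu>)"
    by (simp add: split_beta')
  then show ?thesis by (simp add: sum.cartesian_product[symmetric])
qed

text \<open>Redraw coordinate \<open>a\<close>: for each vector exactly one word equals coordinate
  \<open>b\<close>, which the redrawing leaves alone.\<close>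

lemma card_vectors_collision:
  assumes "a < K" "b < K" "a \<noteq> b"
  shows "(\<Sum>\<nu>\<in>vectors \<eta> K. if \<nu> a = \<nu> b then 1 else 0 :: real) = card (vectors \<eta> K) / card (words \<eta>)"
proof -
  have "(\<Sum>k\<in>words \<eta>. \<Sum>\<nu>\<in>vectors \<eta> K. if (\<nu>(a := k)) a = (\<nu>(a := k)) b then 1 else 0 :: real) =
     (\<Sum>\<nu>\<in>vectors \<eta> K. \<Sum>k\<in>words \<eta>. if k = \<nu> b then 1 else 0)"
    using assms(3) by (subst sum.swap) simp
  also have "\<dots> = (\<Sum>\<nu>\<in>vectors \<eta> K. 1)"
  proof (intro sum.cong refl)
    fix \<nu> assume "\<nu> \<in> vectors \<eta> K"
    then have "\<nu> b \<in> words \<eta>" using assms(2) by (simp add: vectors_iff words_def)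
    then show "(\<Sum>k\<in>words \<eta>. if k = \<nu> b then 1 else 0) = (1 :: real)" by simp
  qed
  finally show ?thesis
    using sum_vectors_resample[OF assms(1), of "\<lambda>\<nu>. if \<nu> a = \<nu> b then 1 else 0" \<eta>]
    by (simp add: card_words field_simps)
qed

section \<open>From a random function to random answers\<close>

definition bxor :: "bits \<Rightarrow> bits \<Rightarrow> bits" where
  "bxor u v = map2 (\<noteq>) u v"

lemma length_bxor [simp]: "length (bxor u v) = min (length u) (length v)"
  by (simp add: bxor_def)

lemma bxor_cancel: "length u = length v \<Longrightarrow> bxor u (bxor u v) = v"
  by (induction u v rule: list_induct2) (auto simp: bxor_def)

lemma bxor_cancel': "length u = length v \<Longrightarrow> bxor (bxor u v) v = u"
  by (induction u v rule: list_induct2) (auto simp: bxor_def)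

lemma bij_betw_bxor:
  assumes "c \<in> words \<eta>"
  shows "bij_betw (bxor c) (words \<eta>) (words \<eta>)"
  by (rule bij_betw_byWitness[where f' = "bxor c"]) (use assms in \<open>auto simp: words_def bxor_cancel\<close>)

primrec transcript :: "(nat \<Rightarrow> bits list \<Rightarrow> bits) \<Rightarrow> nat \<Rightarrow> bits list" where
  "transcript A 0 = []"
| "transcript A (Suc n) = transcript A n @ [A (Suc n) (transcript A n)]"

lemma length_transcript [simp]: "length (transcript A n) = n"
  by (induction n) auto

text \<open>Agreement is demanded only on histories that arise in \<open>A\<close>; coupled games
  agree there, but not on arbitrary lists.\<close>

lemma transcript_cong:
  "(\<And>i. 1 \<le> i \<Longrightarrow> i \<le> n \<Longrightarrow> A i (transcript A (i - 1)) = B i (transcript A (i - 1))) \<Longrightarrow> transcript A n = transcript B n"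
proof (induction n)
  case (Suc n)
  then have "transcript A n = transcript B n" by simp
  with Suc.prems[of "Suc n"] show ?case by simp
qed simp

lemma measurable_count_space2:
  fixes u :: "'a \<Rightarrow> 'b :: countable" and v :: "'a \<Rightarrow> 'c :: countable"
  assumes "u \<in> M \<rightarrow>\<^sub>M count_space UNIV" "v \<in> M \<rightarrow>\<^sub>M count_space UNIV"
  shows "(\<lambda>p. f (u p) (v p)) \<in> M \<rightarrow>\<^sub>M count_space UNIV"
  by (rule measurable_compose_countable[OF _ assms(1)], rule measurable_compose[OF assms(2)]) simp

lemma measurable_transcript:
  assumes "\<And>i ts. (\<lambda>p. A p i ts) \<in> M \<rightarrow>\<^sub>M count_space UNIV"
  shows "(\<lambda>p. transcript (A p) n) \<in> M \<rightarrow>\<^sub>M count_space UNIV"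
proof (induction n)
  case (Suc n)
  have "(\<lambda>p. A p (Suc n) (transcript (A p) n)) \<in> M \<rightarrow>\<^sub>M count_space UNIV"
    by (rule measurable_compose_countable[OF assms Suc])
  from measurable_count_space2[OF Suc this, of "\<lambda>ts t. ts @ [t]"] show ?case by simp
qed simp

section \<open>The coupling for one tag\<close>

text \<open>
  One hop of the hybrid argument after the keyed hash of one tag has become a random function \<open>g\<close>:
  \<open>S\<close> is the set of actions that this tag answers and \<open>c\<close> its identity. The nonce of action \<open>i\<close> is
  \<open>\<nu> (i + 1)\<close>; the components \<open>\<nu> (m + 2 + i)\<close>, which the
  protocol does not use, are the first components of the ideal answers.
\<close>

locale hop =
  fixes m \<eta> :: nat and S :: "nat set" and pair :: "bits \<Rightarrow> bits \<Rightarrow> bits" and c :: bits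
    and q :: "nat \<Rightarrow> tape \<Rightarrow> bits list \<Rightarrow> bits"
    and B :: "nat \<Rightarrow> (nat \<Rightarrow> bits) \<Rightarrow> tape \<Rightarrow> bits list \<Rightarrow> bits"
    and W :: "bits list \<Rightarrow> tape \<Rightarrow> bool"
  assumes S: "S \<subseteq> {1..m}"
    and c: "c \<in> words \<eta>"
    and B: "\<And>i \<nu> \<nu>' \<rho> ts. 1 \<le> i \<Longrightarrow> i \<le> m \<Longrightarrow> i \<notin> S \<Longrightarrow>
      (\<And>n. (\<And>j. j \<in> S \<Longrightarrow> n \<noteq> j + 1 \<and> n \<noteq> m + 2 + j) \<Longrightarrow> \<nu> n = \<nu>' n) \<Longrightarrow> B i \<nu> \<rho> ts = B i \<nu>' \<rho> ts"
    and q_measurable: "\<And>i ts. (\<lambda>\<rho>. q i \<rho> ts) \<in> random_tape \<rightarrow>\<^sub>M count_space UNIV"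
    and B_measurable: "\<And>i \<nu> ts. (\<lambda>\<rho>. B i \<nu> \<rho> ts) \<in> random_tape \<rightarrow>\<^sub>M count_space UNIV"
    and W_measurable: "\<And>ts. length ts = m \<Longrightarrow> (\<lambda>\<rho>. W ts \<rho>) \<in> random_tape \<rightarrow>\<^sub>M count_space UNIV"
begin

text \<open>Positions 0 and 1 hold the keys, \<open>i + 1\<close> with
  \<open>1 \<le> i \<le> m\<close> the names of the actions, and \<open>m + 2 + i\<close> the first
  components of ideal answers. The largest position is \<open>2 * m + 2\<close>.\<close>

abbreviation "V \<equiv> vectors \<eta> (2 * m + 3)"
abbreviation "N \<equiv> random_function \<eta> \<Otimes>\<^sub>M random_tape"

definition real_answer :: "oracle_fun \<Rightarrow> (nat \<Rightarrow> bits) \<Rightarrow> tape \<Rightarrow> nat \<Rightarrow> bits list \<Rightarrow> bits" where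
  "real_answer g \<nu> \<rho> i ts = (if i \<in> S
     then pair (bxor c (g (\<nu> (i + 1)))) (bxor (\<nu> (i + 1)) (g (q i \<rho> ts)))
     else B i \<nu> \<rho> ts)"

definition ideal_answer :: "(nat \<Rightarrow> bits) \<Rightarrow> tape \<Rightarrow> nat \<Rightarrow> bits list \<Rightarrow> bits" where
  "ideal_answer \<nu> \<rho> i ts = (if i \<in> S then pair (\<nu> (m + 2 + i)) (\<nu> (i + 1)) else B i \<nu> \<rho> ts)"

text \<open>The history is that of the ideal game, which contains no oracle; this makes
  \<open>random_function_guess\<close> applicable to the queried point.\<close>

definition query :: "(nat \<Rightarrow> bits) \<Rightarrow> nat \<Rightarrow> tape \<Rightarrow> bits" where
  "query \<nu> i \<rho> = q i \<rho> (transcript (ideal_answer \<nu> \<rho>) (i - 1))"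

text \<open>
  In the ideal game \<open>\<nu> (i + 1)\<close> is the second component of the answer; \<open>nonces\<close> turns these
  components into nonces that give the same answers in the real game.
\<close>

definition nonces :: "oracle_fun \<times> tape \<Rightarrow> (nat \<Rightarrow> bits) \<Rightarrow> nat \<Rightarrow> bits" where
  "nonces p \<nu> n = (if n \<in> Suc ` S then bxor (\<nu> n) (fst p (query \<nu> (n - 1) (snd p))) else \<nu> n)"

text \<open>To be applied to \<open>nonces p \<nu>\<close>. The new value is chosen so that xor with
  the identity \<open>c\<close> gives back the ideal first component
  \<open>\<nu> (m + 2 + i)\<close>.\<close>

primrec reprogram :: "nat list \<Rightarrow> oracle_fun \<Rightarrow> (nat \<Rightarrow> bits) \<Rightarrow> oracle_fun" where
  "reprogram [] g \<nu> = g"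
| "reprogram (i # L) g \<nu> = (reprogram L g \<nu>)(\<nu> (i + 1) := bxor c (\<nu> (m + 2 + i)))"

text \<open>The first disjunct includes \<open>i = j\<close>, since a query may hit the nonce of its
  own action. It also covers nonces of later actions, because the oracle is reprogrammed at all
  nonces at once.\<close>

definition bad :: "oracle_fun \<times> tape \<Rightarrow> (nat \<Rightarrow> bits) \<Rightarrow> bool" where
  "bad p \<nu> \<longleftrightarrow> (\<exists>i\<in>S. \<exists>j\<in>S. nonces p \<nu> (i + 1) = query \<nu> j (snd p)) \<or>
     (\<exists>i\<in>S. \<exists>j\<in>S. i \<noteq> j \<and> nonces p \<nu> (i + 1) = nonces p \<nu> (j + 1))"

lemma prob_space_N: "prob_space N"
  by (rule prob_space_pair_tape[OF prob_space_random_function])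

lemma in_spaceN: "p \<in> space N \<Longrightarrow> length (fst p x) = \<eta>"
  by (auto simp: space_pair_measure space_random_function)

lemma reprogram_other: "(\<And>i. i \<in> set L \<Longrightarrow> y \<noteq> \<nu> (i + 1)) \<Longrightarrow> reprogram L g \<nu> y = g y"
  by (induction L) auto

lemma reprogram_nonce:
  assumes "i \<in> set L" "distinct L"
    "\<And>i j. i \<in> set L \<Longrightarrow> j \<in> set L \<Longrightarrow> i \<noteq> j \<Longrightarrow> \<nu> (i + 1) \<noteq> \<nu> (j + 1)"
  shows "reprogram L g \<nu> (\<nu> (i + 1)) = bxor c (\<nu> (m + 2 + i))"
  using assms by (induction L) auto

lemma in_V:
  assumes "\<nu> \<in> V" "i \<in> S"
  shows "length (\<nu> (i + 1)) = \<eta>" "length (\<nu> (m + 2 + i)) = \<eta>" "length (\<nu> (Suc i)) = \<eta>"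
  using assms S by (auto simp: vectors_iff)

lemma coupling:
  assumes p: "p \<in> space N" and \<nu>: "\<nu> \<in> V" and L: "set L = S" "distinct L" and nb: "\<not> bad p \<nu>" and n: "n \<le> m"
  shows "transcript (real_answer (reprogram L (fst p) (nonces p \<nu>)) (nonces p \<nu>) (snd p)) n =
    transcript (ideal_answer \<nu> (snd p)) n"
proof (rule transcript_cong[symmetric])
  fix i assume i: "1 \<le> i" "i \<le> n"
  let ?ts = "transcript (ideal_answer \<nu> (snd p)) (i - 1)"
  let ?\<nu> = "nonces p \<nu>"
  let ?g = "reprogram L (fst p) ?\<nu>"
  show "ideal_answer \<nu> (snd p) i ?ts = real_answer ?g ?\<nu> (snd p) i ?ts"
  proof (cases "i \<in> S")
    case True
    \<comment> \<open>\<open>m + 2 + i\<close> lies above \<open>m + 1\<close>, so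
      \<open>nonces\<close> leaves the ideal first components alone.\<close>
    have u: "?\<nu> (m + 2 + i) = \<nu> (m + 2 + i)"
      using S by (auto simp: nonces_def)
    have "?g (?\<nu> (i + 1)) = bxor c (?\<nu> (m + 2 + i))"
      by (rule reprogram_nonce) (use True L nb in \<open>auto simp: bad_def\<close>)
    then have 1: "bxor c (?g (?\<nu> (i + 1))) = \<nu> (m + 2 + i)"
      unfolding u using c in_V[OF \<nu> True] by (simp add: words_def bxor_cancel)
    have "?g (query \<nu> i (snd p)) = fst p (query \<nu> i (snd p))"
    proof (rule reprogram_other)
      fix j assume "j \<in> set L"
      then show "query \<nu> i (snd p) \<noteq> ?\<nu> (j + 1)"
        using True L(1) nb unfolding bad_def by metis
    qed
    then have 2: "bxor (?\<nu> (i + 1)) (?g (query \<nu> i (snd p))) = \<nu> (i + 1)"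
      using True in_V[OF \<nu> True] in_spaceN[OF p] by (simp add: nonces_def bxor_cancel')
    show ?thesis
      using True 1 2 by (simp add: ideal_answer_def real_answer_def query_def)
  next
    case False
    \<comment> \<open>\<open>nonces\<close> alters only the names of actions in \<open>S\<close>, on
      which the other answers do not depend.\<close>
    have "B i \<nu> (snd p) ?ts = B i ?\<nu> (snd p) ?ts"
      by (rule B) (use False i n in \<open>auto simp: nonces_def\<close>)
    then show ?thesis using False by (simp add: ideal_answer_def real_answer_def)
  qed
qed

text \<open>\<open>V\<close> is finite, so it is enough to recover the ideal components from the
  nonces, action by action.\<close>

lemma bij_nonces:
  assumes p: "p \<in> space N"
  shows "bij_betw (nonces p) V V"
proof -
  have into: "nonces p \<nu> \<in> V" if "\<nu> \<in> V" for \<nu>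
    using that S in_spaceN[OF p] by (auto simp: vectors_iff nonces_def)
  have "inj_on (nonces p) V"
  proof (rule inj_onI)
    fix \<nu> \<nu>' assume \<nu>: "\<nu> \<in> V" "\<nu>' \<in> V" "nonces p \<nu> = nonces p \<nu>'"
    have off: "\<nu> n = \<nu>' n" if "n \<notin> Suc ` S" for n
      using fun_cong[OF \<nu>(3), of n] that by (simp add: nonces_def)
    have u: "\<nu> (m + 2 + i) = \<nu>' (m + 2 + i)" for i
      using S by (intro off) auto
    \<comment> \<open>The two statements need each other: equal histories give equal queries and so
      equal masks, which determine the next component; equal components then extend the equality of
      the histories.\<close>
    have "n \<le> m \<Longrightarrow> transcript (ideal_answer \<nu> (snd p)) n = transcript (ideal_answer \<nu>' (snd p)) n \<and>
       (\<forall>i\<in>S. i \<le> n \<longrightarrow> \<nu> (Suc i) = \<nu>' (Suc i))" for n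
    proof (induction n)
      case 0
      then show ?case using S by auto
    next
      case (Suc n)
      then have IH: "transcript (ideal_answer \<nu> (snd p)) n = transcript (ideal_answer \<nu>' (snd p)) n"
        "\<And>i. i \<in> S \<Longrightarrow> i \<le> n \<Longrightarrow> \<nu> (Suc i) = \<nu>' (Suc i)" by auto
      show ?case
      proof (cases "Suc n \<in> S")
        case True
        have "query \<nu> (Suc n) (snd p) = query \<nu>' (Suc n) (snd p)"
          using IH by (simp add: query_def)
        then have "bxor (\<nu> (Suc (Suc n))) (fst p (query \<nu> (Suc n) (snd p))) = bxor (\<nu>' (Suc (Suc n))) (fst p (query \<nu> (Suc n) (snd p)))"
          using fun_cong[OF \<nu>(3), of "Suc (Suc n)"] True by (simp add: nonces_def)
        then have "\<nu> (Suc (Suc n)) = \<nu>' (Suc (Suc n))"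
          using bxor_cancel'[of "\<nu> (Suc (Suc n))"] bxor_cancel'[of "\<nu>' (Suc (Suc n))"]
            in_V(3)[OF \<nu>(1) True] in_V(3)[OF \<nu>(2) True] in_spaceN[OF p] by metis
        moreover have "ideal_answer \<nu> (snd p) (Suc n) ts = ideal_answer \<nu>' (snd p) (Suc n) ts" for ts
          using True u[of "Suc n"] calculation by (simp add: ideal_answer_def)
        ultimately show ?thesis using IH by (auto simp: le_Suc_eq)
      next
        case False
        have "B (Suc n) \<nu> (snd p) (transcript (ideal_answer \<nu>' (snd p)) n) = B (Suc n) \<nu>' (snd p) (transcript (ideal_answer \<nu>' (snd p)) n)"
          by (rule B) (use False Suc.prems in \<open>auto intro!: off\<close>)
        then have "ideal_answer \<nu> (snd p) (Suc n) (transcript (ideal_answer \<nu>' (snd p)) n) =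
            ideal_answer \<nu>' (snd p) (Suc n) (transcript (ideal_answer \<nu>' (snd p)) n)"
          using False by (simp add: ideal_answer_def)
        then show ?thesis using IH False by (auto simp: le_Suc_eq)
      qed
    qed
    from this[of m] S have "\<nu> (Suc i) = \<nu>' (Suc i)" if "i \<in> S" for i
      using that by auto
    then have "\<nu> n = \<nu>' n" for n
      by (cases "n \<in> Suc ` S") (auto intro: off)
    then show "\<nu> = \<nu>'" ..
  qed
  moreover have "nonces p ` V \<subseteq> V" using into by blast
  ultimately show ?thesis
    by (simp add: bij_betw_def endo_inj_surj)
qed

section \<open>Measurability of the events in the two games\<close>

lemma measurable_oracle:
  assumes "(\<lambda>\<rho>. x \<rho>) \<in> random_tape \<rightarrow>\<^sub>M count_space UNIV"
  shows "(\<lambda>p. fst p (x (snd p))) \<in> N \<rightarrow>\<^sub>M count_space UNIV"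
  by (rule measurable_compose_countable[OF _ measurable_compose[OF measurable_snd assms]])
    (rule measurable_compose[OF measurable_fst measurable_random_function_eval])

lemma measurable_const_oracle: "(\<lambda>p. fst p y) \<in> N \<rightarrow>\<^sub>M count_space UNIV"
  by (rule measurable_compose[OF measurable_fst measurable_random_function_eval])

lemma measurable_real: "(\<lambda>p. transcript (real_answer (fst p) \<nu> (snd p)) n) \<in> N \<rightarrow>\<^sub>M count_space UNIV"
proof (rule measurable_transcript)
  fix i ts
  have 1: "(\<lambda>p. bxor c (fst p (\<nu> (i + 1)))) \<in> N \<rightarrow>\<^sub>M count_space UNIV"
    by (rule measurable_compose[OF measurable_const_oracle]) simp
  have 2: "(\<lambda>p. bxor (\<nu> (i + 1)) (fst p (q i (snd p) ts))) \<in> N \<rightarrow>\<^sub>M count_space UNIV"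
    by (rule measurable_compose[OF measurable_oracle[OF q_measurable]]) simp
  have 3: "(\<lambda>p. B i \<nu> (snd p) ts) \<in> N \<rightarrow>\<^sub>M count_space UNIV"
    by (rule measurable_compose[OF measurable_snd B_measurable])
  show "(\<lambda>p. real_answer (fst p) \<nu> (snd p) i ts) \<in> N \<rightarrow>\<^sub>M count_space UNIV"
    unfolding real_answer_def using measurable_count_space2[OF 1 2, of pair] 3 by (cases "i \<in> S") simp_all
qed

lemma measurable_ideal: "(\<lambda>\<rho>. transcript (ideal_answer \<nu> \<rho>) n) \<in> random_tape \<rightarrow>\<^sub>M count_space UNIV"
proof (rule measurable_transcript)
  fix i ts
  show "(\<lambda>\<rho>. ideal_answer \<nu> \<rho> i ts) \<in> random_tape \<rightarrow>\<^sub>M count_space UNIV"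
    unfolding ideal_answer_def using B_measurable[of i \<nu> ts] by (cases "i \<in> S") simp_all
qed

lemma measurable_query: "(\<lambda>\<rho>. query \<nu> i \<rho>) \<in> random_tape \<rightarrow>\<^sub>M count_space UNIV"
  unfolding query_def by (rule measurable_compose_countable[OF q_measurable measurable_ideal])

lemma measurable_nonces: "(\<lambda>p. nonces p \<nu> n) \<in> N \<rightarrow>\<^sub>M count_space UNIV"
proof -
  have "(\<lambda>p. bxor (\<nu> n) (fst p (query \<nu> (n - 1) (snd p)))) \<in> N \<rightarrow>\<^sub>M count_space UNIV"
    by (rule measurable_compose[OF measurable_oracle[OF measurable_query]]) simp
  then show ?thesis by (cases "n \<in> Suc ` S") (simp_all add: nonces_def)
qed

lemma sets_W:
  assumes "(\<lambda>p. ts p) \<in> M \<rightarrow>\<^sub>M count_space UNIV" "(\<lambda>p. r p) \<in> M \<rightarrow>\<^sub>M random_tape" "\<And>p. length (ts p) = m"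
  shows "{p \<in> space M. W (ts p) (r p)} \<in> sets M"
proof -
  have "(\<lambda>p. (\<lambda>us p. length us = m \<and> W us (r p)) (ts p) p) \<in> M \<rightarrow>\<^sub>M count_space UNIV"
  proof (rule measurable_compose_countable[OF _ assms(1)])
    show "(\<lambda>p. length us = m \<and> W us (r p)) \<in> M \<rightarrow>\<^sub>M count_space UNIV" for us :: "bits list"
      using measurable_compose[OF assms(2) W_measurable[of us]] by (cases "length us = m") auto
  qed
  from measurable_sets[OF this, of "{True}"] show ?thesis
    by (simp add: assms(3) vimage_def Int_def conj_commute)
qed

lemma sets_eqN:
  assumes "(\<lambda>p. u p :: bits) \<in> N \<rightarrow>\<^sub>M count_space UNIV" "(\<lambda>p. v p) \<in> N \<rightarrow>\<^sub>M count_space UNIV"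
  shows "{p \<in> space N. u p = v p} \<in> sets N"
  using measurable_sets[OF measurable_count_space2[OF assms, of "(=)"], of "{True}"]
  by (simp add: vimage_def Int_def conj_commute)

text \<open>Here the vector is itself random. It has finitely many possible values, so the event
  splits into finitely many pieces on which the vector is fixed.\<close>

lemma sets_nonces:
  assumes "\<And>\<nu>. \<nu> \<in> V \<Longrightarrow> {p \<in> space N. f p \<nu>} \<in> sets N" "\<nu> \<in> V"
  shows "{p \<in> space N. f p (nonces p \<nu>)} \<in> sets N"
proof -
  have into: "nonces p \<nu> \<in> V" if "p \<in> space N" for p
    using bij_betw_apply[OF bij_nonces[OF that] assms(2)] .
  have "{p \<in> space N. nonces p \<nu> = \<nu>'} \<in> sets N" if "\<nu>' \<in> V" for \<nu>'
  proof -
    have "nonces p \<nu> = \<nu>' \<longleftrightarrow> (\<forall>n\<in>{..<2 * m + 3}. nonces p \<nu> n = \<nu>' n)" if "p \<in> space N" for p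
    proof
      assume eq: "\<forall>n\<in>{..<2 * m + 3}. nonces p \<nu> n = \<nu>' n"
      show "nonces p \<nu> = \<nu>'"
      proof
        fix n show "nonces p \<nu> n = \<nu>' n"
          using eq into[OF that] \<open>\<nu>' \<in> V\<close> by (cases "n < 2 * m + 3") (auto simp: vectors_iff)
      qed
    qed simp
    then have "{p \<in> space N. nonces p \<nu> = \<nu>'} = {p \<in> space N. \<forall>n\<in>{..<2 * m + 3}. nonces p \<nu> n = \<nu>' n}" by blast
    also have "\<dots> \<in> sets N"
      by (intro sets.sets_Collect_finite_All sets_eqN measurable_nonces) auto
    finally show ?thesis .
  qed
  then have "(\<Union>\<nu>'\<in>V. {p \<in> space N. nonces p \<nu> = \<nu>'} \<inter> {p \<in> space N. f p \<nu>'}) \<in> sets N"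
    using assms(1) by (intro sets.finite_UN sets.Int) auto
  also have "(\<Union>\<nu>'\<in>V. {p \<in> space N. nonces p \<nu> = \<nu>'} \<inter> {p \<in> space N. f p \<nu>'}) = {p \<in> space N. f p (nonces p \<nu>)}"
    using into by auto
  finally show ?thesis .
qed

section \<open>Changes of variables that preserve the averages\<close>

lemma sum_prob_nonces:
  assumes "\<And>\<nu>. \<nu> \<in> V \<Longrightarrow> {p \<in> space N. f p \<nu>} \<in> sets N"
  shows "(\<Sum>\<nu>\<in>V. \<P>(p in N. f p (nonces p \<nu>))) = (\<Sum>\<nu>\<in>V. \<P>(p in N. f p \<nu>))"
  by (rule sum_prob_bijection[OF prob_space_N finite_vectors bij_nonces assms sets_nonces[OF assms]])

text \<open>The new value is \<open>bxor c\<close> of a component that \<open>f\<close> does not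
  see, hence a uniform word, and for a fixed vector the point is fixed too; so
  \<open>random_function_reprogram\<close> applies.\<close>

lemma reprogram_once:
  assumes f: "\<And>\<nu>. \<nu> \<in> V \<Longrightarrow> {p \<in> space N. f (fst p) \<nu> (snd p)} \<in> sets N" and i: "i \<in> S"
    and indep: "\<And>g \<nu> w \<rho>. f g (\<nu>(m + 2 + i := w)) \<rho> = f g \<nu> \<rho>"
  shows "(\<Sum>\<nu>\<in>V. \<P>(p in N. f ((fst p)(\<nu> (i + 1) := bxor c (\<nu> (m + 2 + i)))) \<nu> (snd p))) =
     (\<Sum>\<nu>\<in>V. \<P>(p in N. f (fst p) \<nu> (snd p)))"
    and "\<nu> \<in> V \<Longrightarrow> {p \<in> space N. f ((fst p)(\<nu> (i + 1) := bxor c (\<nu> (m + 2 + i)))) \<nu> (snd p)} \<in> sets N"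
proof -
  let ?E = "\<lambda>\<nu>. {p \<in> space N. f (fst p) \<nu> (snd p)}"
  have upd: "{p \<in> space N. ((fst p)(y := v), snd p) \<in> ?E \<nu>} = {p \<in> space N. f ((fst p)(y := v)) \<nu> (snd p)}"
    if "v \<in> words \<eta>" for y v \<nu>
    using that by (auto simp: space_pair_measure space_random_function words_def)
  have cx: "bxor c k \<in> words \<eta>" if "k \<in> words \<eta>" for k
    using that c by (simp add: words_def)
  show "{p \<in> space N. f ((fst p)(\<nu> (i + 1) := bxor c (\<nu> (m + 2 + i)))) \<nu> (snd p)} \<in> sets N" if "\<nu> \<in> V"
  proof -
    have w: "bxor c (\<nu> (m + 2 + i)) \<in> words \<eta>"
      using cx[of "\<nu> (m + 2 + i)"] in_V(2)[OF that i] by (simp add: words_def)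
    show ?thesis
      using random_function_reprogram(2)[OF prob_space_random_tape f[OF that] w, of "\<nu> (i + 1)"] unfolding upd[OF w] .
  qed
  let ?P = "\<lambda>y v \<nu>. \<P>(p in N. f ((fst p)(y := v)) \<nu> (snd p))"
  \<comment> \<open>Multiplying by \<open>card (words \<eta>)\<close> makes room for a fresh word
    \<open>k\<close> in the place of that component; xor with \<open>c\<close> then merely permutes
    the words.\<close>
  have "card (words \<eta>) * (\<Sum>\<nu>\<in>V. ?P (\<nu> (i + 1)) (bxor c (\<nu> (m + 2 + i))) \<nu>) =
    (\<Sum>k\<in>words \<eta>. \<Sum>\<nu>\<in>V. ?P ((\<nu>(m + 2 + i := k)) (i + 1)) (bxor c ((\<nu>(m + 2 + i := k)) (m + 2 + i))) (\<nu>(m + 2 + i := k)))"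
    using S i by (intro sum_vectors_resample[symmetric]) auto
  also have "\<dots> = (\<Sum>k\<in>words \<eta>. \<Sum>\<nu>\<in>V. ?P (\<nu> (i + 1)) (bxor c k) \<nu>)"
  proof (intro sum.cong refl)
    fix k :: bits and \<nu> :: "nat \<Rightarrow> bits"
    have "(\<nu>(m + 2 + i := k)) (i + 1) = \<nu> (i + 1)" "(\<nu>(m + 2 + i := k)) (m + 2 + i) = k"
      using S i by auto
    then show "?P ((\<nu>(m + 2 + i := k)) (i + 1)) (bxor c ((\<nu>(m + 2 + i := k)) (m + 2 + i))) (\<nu>(m + 2 + i := k)) =
      ?P (\<nu> (i + 1)) (bxor c k) \<nu>"
      by (simp only: indep)
  qed
  also have "\<dots> = (\<Sum>\<nu>\<in>V. \<Sum>k\<in>words \<eta>. ?P (\<nu> (i + 1)) (bxor c k) \<nu>)"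
    by (rule sum.swap)
  also have "\<dots> = (\<Sum>\<nu>\<in>V. \<Sum>v\<in>words \<eta>. ?P (\<nu> (i + 1)) v \<nu>)"
    by (intro sum.cong refl sum.reindex_bij_betw[OF bij_betw_bxor[OF c]])
  also have "\<dots> = (\<Sum>\<nu>\<in>V. card (words \<eta>) * \<P>(p in N. f (fst p) \<nu> (snd p)))"
  proof (intro sum.cong refl)
    fix \<nu> assume "\<nu> \<in> V"
    from random_function_reprogram(1)[OF prob_space_random_tape f[OF this], of "\<nu> (i + 1)"]
    have "(\<Sum>v\<in>words \<eta>. \<P>(p in N. ((fst p)(\<nu> (i + 1) := v), snd p) \<in> ?E \<nu>)) =
       card (words \<eta>) * \<P>(p in N. f (fst p) \<nu> (snd p))" .
    moreover have "(\<Sum>v\<in>words \<eta>. \<P>(p in N. ((fst p)(\<nu> (i + 1) := v), snd p) \<in> ?E \<nu>)) = (\<Sum>v\<in>words \<eta>. ?P (\<nu> (i + 1)) v \<nu>)"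
      by (intro sum.cong refl) (simp only: upd)
    ultimately show "(\<Sum>v\<in>words \<eta>. ?P (\<nu> (i + 1)) v \<nu>) = card (words \<eta>) * \<P>(p in N. f (fst p) \<nu> (snd p))"
      by simp
  qed
  finally show "(\<Sum>\<nu>\<in>V. ?P (\<nu> (i + 1)) (bxor c (\<nu> (m + 2 + i))) \<nu>) = (\<Sum>\<nu>\<in>V. \<P>(p in N. f (fst p) \<nu> (snd p)))"
    by (simp add: sum_distrib_left[symmetric] card_words)
qed

text \<open>The outermost update is absorbed into the predicate, the induction hypothesis removes
  the others, and \<open>reprogram_once\<close> then removes the absorbed one. The enlarged
  predicate still does not see the components of the remaining actions because \<open>L\<close> is
  distinct.\<close>

lemma reprogram_list:
  assumes "\<And>\<nu>. \<nu> \<in> V \<Longrightarrow> {p \<in> space N. f (fst p) \<nu> (snd p)} \<in> sets N" "set L \<subseteq> S" "distinct L"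
    and "\<And>i g \<nu> w \<rho>. i \<in> set L \<Longrightarrow> f g (\<nu>(m + 2 + i := w)) \<rho> = f g \<nu> \<rho>"
  shows "(\<Sum>\<nu>\<in>V. \<P>(p in N. f (reprogram L (fst p) \<nu>) \<nu> (snd p))) = (\<Sum>\<nu>\<in>V. \<P>(p in N. f (fst p) \<nu> (snd p))) \<and>
    (\<forall>\<nu>\<in>V. {p \<in> space N. f (reprogram L (fst p) \<nu>) \<nu> (snd p)} \<in> sets N)"
  using assms
proof (induction L arbitrary: f)
  case (Cons i L)
  let ?f = "\<lambda>g \<nu> \<rho>. f (g(\<nu> (i + 1) := bxor c (\<nu> (m + 2 + i)))) \<nu> \<rho>"
  have i: "i \<in> S" "\<And>g \<nu> w \<rho>. f g (\<nu>(m + 2 + i := w)) \<rho> = f g \<nu> \<rho>"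
    using Cons.prems(2) by (simp, intro Cons.prems(4)) simp
  note once = reprogram_once[of f i, OF Cons.prems(1) i]
  have ih: "(\<Sum>\<nu>\<in>V. \<P>(p in N. ?f (reprogram L (fst p) \<nu>) \<nu> (snd p))) = (\<Sum>\<nu>\<in>V. \<P>(p in N. ?f (fst p) \<nu> (snd p))) \<and>
    (\<forall>\<nu>\<in>V. {p \<in> space N. ?f (reprogram L (fst p) \<nu>) \<nu> (snd p)} \<in> sets N)"
  proof (rule Cons.IH)
    show "?f g (\<nu>(m + 2 + j := w)) \<rho> = ?f g \<nu> \<rho>" if "j \<in> set L" for j g \<nu> w \<rho>
    proof -
      have "j \<noteq> i" "j \<in> S" using that Cons.prems(2,3) by auto
      moreover have "f g (\<nu>(m + 2 + j := w)) \<rho> = f g \<nu> \<rho>" for g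
        by (rule Cons.prems(4)) (use that in simp)
      moreover have "i + 1 \<noteq> m + 2 + j" "m + 2 + i \<noteq> m + 2 + j" using S i(1) calculation(1) by auto
      ultimately show ?thesis by simp
    qed
  next
    show "{p \<in> space N. ?f (fst p) \<nu> (snd p)} \<in> sets N" if "\<nu> \<in> V" for \<nu>
      by (rule once(2)[OF _ that])
  qed (use Cons.prems(2,3) in auto)
  have one: "(\<Sum>\<nu>\<in>V. \<P>(p in N. ?f (fst p) \<nu> (snd p))) = (\<Sum>\<nu>\<in>V. \<P>(p in N. f (fst p) \<nu> (snd p)))"
    by (rule once(1))
  show ?case
    unfolding reprogram.simps by (rule conjI[OF trans[OF conjunct1[OF ih] one] conjunct2[OF ih]])
qed simp

text \<open>Supplies the independence hypothesis of \<open>reprogram_list\<close> for the real game;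
  for answers outside \<open>S\<close> it comes from the locale assumption on
  \<open>B\<close>.\<close>

lemma real_indep:
  assumes "i \<in> S" "n \<le> m"
  shows "transcript (real_answer g (\<nu>(m + 2 + i := w)) \<rho>) n = transcript (real_answer g \<nu> \<rho>) n"
proof (rule transcript_cong)
  fix j assume j: "1 \<le> j" "j \<le> n"
  let ?ts = "transcript (real_answer g (\<nu>(m + 2 + i := w)) \<rho>) (j - 1)"
  show "real_answer g (\<nu>(m + 2 + i := w)) \<rho> j ?ts = real_answer g \<nu> \<rho> j ?ts"
  proof (cases "j \<in> S")
    case True
    then show ?thesis using j assms by (simp add: real_answer_def)
  next
    case False
    have "B j (\<nu>(m + 2 + i := w)) \<rho> ?ts = B j \<nu> \<rho> ?ts"
      by (rule B) (use j assms False in auto)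
    then show ?thesis using False by (simp add: real_answer_def)
  qed
qed

text \<open>There are at most \<open>m ^ 2\<close> pairs of actions, with two events each. Hits of a
  query are bounded for every single \<open>\<nu>\<close>, collisions of nonces on average over
  \<open>\<nu>\<close>, so the bound is on the sum.\<close>

lemma prob_bad:
  "(\<Sum>\<nu>\<in>V. \<P>(p in N. bad p \<nu>)) \<le> 2 * real m ^ 2 * card V / 2 ^ \<eta>"
    and sets_bad: "{p \<in> space N. bad p \<nu>} \<in> sets N"
proof -
  interpret N: prob_space N by (rule prob_space_N)
  have fin: "finite S" using S finite_subset by blast
  let ?E = "\<lambda>\<nu> i j. {p \<in> space N. nonces p \<nu> (i + 1) = query \<nu> j (snd p)}"
  let ?C = "\<lambda>\<nu> i j. {p \<in> space N. i \<noteq> j \<and> nonces p \<nu> (i + 1) = nonces p \<nu> (j + 1)}"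
  have E: "?E \<nu> i j \<in> sets N" for \<nu> i j
    by (intro sets_eqN measurable_nonces measurable_compose[OF measurable_snd measurable_query])
  have C: "?C \<nu> i j \<in> sets N" for \<nu> i j
    using sets_eqN[OF measurable_nonces measurable_nonces] by (cases "i = j") simp_all
  have bad_iff: "bad p \<nu> \<longleftrightarrow> (\<exists>i\<in>S. \<exists>j\<in>S. nonces p \<nu> (i + 1) = query \<nu> j (snd p) \<or>
      (i \<noteq> j \<and> nonces p \<nu> (i + 1) = nonces p \<nu> (j + 1)))" for p \<nu>
    unfolding bad_def by blast
  have bad: "{p \<in> space N. bad p \<nu>} = (\<Union>(i, j)\<in>S \<times> S. ?E \<nu> i j \<union> ?C \<nu> i j)" for \<nu>
  proof -
    have UN: "(\<Union>(i, j)\<in>S \<times> S. F i j) = (\<Union>i\<in>S. \<Union>j\<in>S. F i j)" for F :: "nat \<Rightarrow> nat \<Rightarrow> (oracle_fun \<times> tape) set"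
      by auto
    show ?thesis unfolding UN bad_iff by blast
  qed
  show "{p \<in> space N. bad p \<nu>} \<in> sets N"
    unfolding bad split_beta' by (intro sets.finite_UN sets.Un E C finite_cartesian_product fin)
  \<comment> \<open>Xor with \<open>\<nu> (i + 1)\<close> turns the event into a guess of the
    oracle's value at \<open>query \<nu> i\<close>, and both point and guess are functions of the
    tape alone.\<close>
  have PE: "measure N (?E \<nu> i j) \<le> 1 / 2 ^ \<eta>" if "\<nu> \<in> V" "i \<in> S" for \<nu> i j
  proof -
    let ?z = "\<lambda>\<rho>. bxor (\<nu> (i + 1)) (query \<nu> j \<rho>)"
    have z: "(\<lambda>\<rho>. ?z \<rho>) \<in> random_tape \<rightarrow>\<^sub>M count_space UNIV"
      by (rule measurable_compose[OF measurable_query]) simp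
    have m: "{p \<in> space N. fst p (query \<nu> i (snd p)) = ?z (snd p)} \<in> sets N"
      by (intro sets_eqN measurable_oracle measurable_query measurable_compose[OF measurable_snd z])
    have eq: "bxor (\<nu> (i + 1)) (nonces p \<nu> (i + 1)) = fst p (query \<nu> i (snd p))" if p: "p \<in> space N" for p
      using \<open>i \<in> S\<close> in_V[OF \<open>\<nu> \<in> V\<close> \<open>i \<in> S\<close>] in_spaceN[OF p] by (simp add: nonces_def bxor_cancel)
    have sub: "?E \<nu> i j \<subseteq> {p \<in> space N. fst p (query \<nu> i (snd p)) = ?z (snd p)}"
    proof
      fix p assume "p \<in> ?E \<nu> i j"
      then show "p \<in> {p \<in> space N. fst p (query \<nu> i (snd p)) = ?z (snd p)}"
        using eq[of p] by simp
    qed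
    from N.finite_measure_mono[OF sub m] random_function_guess[OF prob_space_random_tape m]
    show ?thesis by linarith
  qed
  have PC: "(\<Sum>\<nu>\<in>V. measure N (?C \<nu> i j)) \<le> card V / 2 ^ \<eta>" if "i \<in> S" "j \<in> S" for i j
  proof (cases "i = j")
    case False
    have "(\<Sum>\<nu>\<in>V. measure N (?C \<nu> i j)) = (\<Sum>\<nu>\<in>V. \<P>(p in N. nonces p \<nu> (i + 1) = nonces p \<nu> (j + 1)))"
      using False by simp
    \<comment> \<open>In the sum over \<open>\<nu>\<close>, the bijection replaces the derived
      nonces by coordinates of \<open>\<nu>\<close> itself.\<close>
    also have "\<dots> = (\<Sum>\<nu>\<in>V. \<P>(p in N. \<nu> (i + 1) = \<nu> (j + 1)))"
      by (rule sum_prob_nonces[of "\<lambda>p \<nu>. \<nu> (i + 1) = \<nu> (j + 1)"]) auto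
    also have "\<dots> = (\<Sum>\<nu>\<in>V. if \<nu> (i + 1) = \<nu> (j + 1) then 1 else 0)"
      by (intro sum.cong refl) (auto simp: N.prob_space)
    also have "\<dots> = card V / card (words \<eta>)"
      by (rule card_vectors_collision) (use that S False in auto)
    finally show ?thesis by (simp add: card_words)
  qed simp
  have "(\<Sum>\<nu>\<in>V. \<P>(p in N. bad p \<nu>)) \<le> (\<Sum>\<nu>\<in>V. \<Sum>(i, j)\<in>S \<times> S. measure N (?E \<nu> i j) + measure N (?C \<nu> i j))"
  proof (rule sum_mono)
    fix \<nu> assume "\<nu> \<in> V"
    have "\<P>(p in N. bad p \<nu>) \<le> (\<Sum>ij\<in>S \<times> S. measure N (?E \<nu> (fst ij) (snd ij) \<union> ?C \<nu> (fst ij) (snd ij)))"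
      unfolding bad split_beta'
    proof (rule N.finite_measure_subadditive_finite)
      show "(\<lambda>ij. ?E \<nu> (fst ij) (snd ij) \<union> ?C \<nu> (fst ij) (snd ij)) ` (S \<times> S) \<subseteq> sets N"
        by (intro image_subsetI sets.Un E C)
    qed (use fin in simp)
    also have "\<dots> \<le> (\<Sum>ij\<in>S \<times> S. measure N (?E \<nu> (fst ij) (snd ij)) + measure N (?C \<nu> (fst ij) (snd ij)))"
      by (intro sum_mono measure_Un_le E C)
    finally show "\<P>(p in N. bad p \<nu>) \<le> (\<Sum>(i, j)\<in>S \<times> S. measure N (?E \<nu> i j) + measure N (?C \<nu> i j))"
      unfolding split_beta' .
  qed
  also have "\<dots> = (\<Sum>(i, j)\<in>S \<times> S. (\<Sum>\<nu>\<in>V. measure N (?E \<nu> i j)) + (\<Sum>\<nu>\<in>V. measure N (?C \<nu> i j)))"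
    by (subst sum.swap) (simp add: split_beta' sum.distrib)
  also have "\<dots> \<le> (\<Sum>(i, j)\<in>S \<times> S. card V / 2 ^ \<eta> + card V / 2 ^ \<eta>)"
  proof (intro sum_mono)
    fix ij assume "ij \<in> S \<times> S"
    then obtain i j where ij: "ij = (i, j)" "i \<in> S" "j \<in> S" by auto
    have "(\<Sum>\<nu>\<in>V. measure N (?E \<nu> i j)) \<le> (\<Sum>\<nu>\<in>V. 1 / 2 ^ \<eta>)"
      by (intro sum_mono PE ij)
    then have "(\<Sum>\<nu>\<in>V. measure N (?E \<nu> i j)) + (\<Sum>\<nu>\<in>V. measure N (?C \<nu> i j)) \<le> card V / 2 ^ \<eta> + card V / 2 ^ \<eta>"
      using PC[OF ij(2,3)] by (intro add_mono) simp_all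
    then show "(case ij of (i, j) \<Rightarrow> (\<Sum>\<nu>\<in>V. measure N (?E \<nu> i j)) + (\<Sum>\<nu>\<in>V. measure N (?C \<nu> i j))) \<le>
      (case ij of (i, j) \<Rightarrow> card V / 2 ^ \<eta> + card V / 2 ^ \<eta>)" using ij by simp
  qed
  also have "\<dots> = real (card S) ^ 2 * (2 * card V / 2 ^ \<eta>)"
    by (simp add: card_cartesian_product power2_eq_square)
  also have "\<dots> \<le> real m ^ 2 * (2 * card V / 2 ^ \<eta>)"
    using card_mono[OF _ S] by (intro mult_right_mono power_mono) auto
  finally show "(\<Sum>\<nu>\<in>V. \<P>(p in N. bad p \<nu>)) \<le> 2 * real m ^ 2 * card V / 2 ^ \<eta>" by (simp add: mult_ac)
qed

text \<open>Seen from the real game, reprogramming the oracle at the names leaves the average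
  unchanged, and so does replacing the names by \<open>nonces p \<nu>\<close>. The result is
  compared with the ideal game sample by sample: \<open>coupling\<close> makes the outcomes equal
  outside \<open>bad\<close>.\<close>

lemma statistical_hop:
  "\<bar>(\<Sum>\<nu>\<in>V. \<P>(p in N. W (transcript (real_answer (fst p) \<nu> (snd p)) m) (snd p))) / card V -
    (\<Sum>\<nu>\<in>V. \<P>(p in N. W (transcript (ideal_answer \<nu> (snd p)) m) (snd p))) / card V\<bar> \<le> 2 * real m ^ 2 / 2 ^ \<eta>"
proof -
  interpret N: prob_space N by (rule prob_space_N)
  have "finite S" using S finite_subset by blast
  then obtain L where L: "set L = S" "distinct L" using finite_distinct_list by blast
  let ?f = "\<lambda>g \<nu> \<rho>. W (transcript (real_answer g \<nu> \<rho>) m) \<rho>"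
  let ?h = "\<lambda>p \<nu>. ?f (reprogram L (fst p) \<nu>) \<nu> (snd p)"
  let ?i = "\<lambda>p \<nu>. W (transcript (ideal_answer \<nu> (snd p)) m) (snd p)"
  have f: "{p \<in> space N. ?f (fst p) \<nu> (snd p)} \<in> sets N" for \<nu>
    by (rule sets_W[OF measurable_real measurable_snd]) simp
  have i: "{p \<in> space N. ?i p \<nu>} \<in> sets N" for \<nu>
    by (rule sets_W[OF measurable_compose[OF measurable_snd measurable_ideal] measurable_snd]) simp
  have A: "(\<Sum>\<nu>\<in>V. \<P>(p in N. ?h p \<nu>)) = (\<Sum>\<nu>\<in>V. \<P>(p in N. ?f (fst p) \<nu> (snd p)))"
    and h: "\<And>\<nu>. \<nu> \<in> V \<Longrightarrow> {p \<in> space N. ?h p \<nu>} \<in> sets N"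
    using reprogram_list[of ?f L, OF f] L real_indep by auto
  have h': "{p \<in> space N. ?h p (nonces p \<nu>)} \<in> sets N" if "\<nu> \<in> V" for \<nu>
    by (rule sets_nonces[of ?h, OF h that])
  have diff: "\<bar>\<P>(p in N. ?h p (nonces p \<nu>)) - \<P>(p in N. ?i p \<nu>)\<bar> \<le> \<P>(p in N. bad p \<nu>)" if "\<nu> \<in> V" for \<nu>
  proof -
    have eq: "?h p (nonces p \<nu>) \<longleftrightarrow> ?i p \<nu>" if "p \<in> space N" "\<not> bad p \<nu>" for p
      using coupling[OF that(1) \<open>\<nu> \<in> V\<close> L that(2) order_refl] by simp
    have "\<P>(p in N. ?h p (nonces p \<nu>)) \<le> measure N ({p \<in> space N. ?i p \<nu>} \<union> {p \<in> space N. bad p \<nu>})"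
      by (rule N.finite_measure_mono) (use eq i sets_bad in auto)
    also have "\<dots> \<le> \<P>(p in N. ?i p \<nu>) + \<P>(p in N. bad p \<nu>)"
      by (rule measure_Un_le[OF i sets_bad])
    finally have 1: "\<P>(p in N. ?h p (nonces p \<nu>)) \<le> \<P>(p in N. ?i p \<nu>) + \<P>(p in N. bad p \<nu>)" .
    have "\<P>(p in N. ?i p \<nu>) \<le> measure N ({p \<in> space N. ?h p (nonces p \<nu>)} \<union> {p \<in> space N. bad p \<nu>})"
      by (rule N.finite_measure_mono) (use eq h'[OF that] sets_bad in auto)
    also have "\<dots> \<le> \<P>(p in N. ?h p (nonces p \<nu>)) + \<P>(p in N. bad p \<nu>)"
      by (rule measure_Un_le[OF h'[OF that] sets_bad])
    finally show ?thesis using 1 by linarith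
  qed
  have sums: "(\<Sum>\<nu>\<in>V. \<P>(p in N. ?f (fst p) \<nu> (snd p))) - (\<Sum>\<nu>\<in>V. \<P>(p in N. ?i p \<nu>)) =
      (\<Sum>\<nu>\<in>V. \<P>(p in N. ?h p (nonces p \<nu>)) - \<P>(p in N. ?i p \<nu>))"
    unfolding A[symmetric] using sum_prob_nonces[of ?h, OF h] by (simp add: sum_subtractf)
  have "\<bar>(\<Sum>\<nu>\<in>V. \<P>(p in N. ?f (fst p) \<nu> (snd p))) - (\<Sum>\<nu>\<in>V. \<P>(p in N. ?i p \<nu>))\<bar> \<le> (\<Sum>\<nu>\<in>V. \<P>(p in N. bad p \<nu>))"
    unfolding sums by (rule order_trans[OF sum_abs sum_mono]) (rule diff)
  also have "\<dots> \<le> 2 * real m ^ 2 * card V / 2 ^ \<eta>"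
    by (rule prob_bad)
  finally have "\<bar>(\<Sum>\<nu>\<in>V. \<P>(p in N. ?f (fst p) \<nu> (snd p))) - (\<Sum>\<nu>\<in>V. \<P>(p in N. ?i p \<nu>))\<bar> / card V
     \<le> (2 * real m ^ 2 * card V / 2 ^ \<eta>) / card V"
    by (intro divide_right_mono) auto
  then show ?thesis
    by (simp add: diff_divide_distrib[symmetric] abs_divide card_vectors)
qed

end

section \<open>Hybrid games for the protocol\<close>

text \<open>The factor 2 of two summands is absorbed by one more power: for
  \<open>2 \<le> \<eta>\<close>, \<open>2 / \<eta> ^ Suc e\<close> is at most
  \<open>1 / \<eta> ^ e\<close>.\<close>

lemma negligible_bound:
  assumes "negligible f" "negligible g" "\<And>\<eta>. \<bar>h \<eta>\<bar> \<le> f \<eta> + g \<eta>"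
  shows "negligible h"
  unfolding negligible_def
proof
  fix e :: nat
  have "\<forall>\<^sub>F \<eta> in sequentially. \<bar>f \<eta>\<bar> < 1 / real \<eta> ^ Suc e" "\<forall>\<^sub>F \<eta> in sequentially. \<bar>g \<eta>\<bar> < 1 / real \<eta> ^ Suc e"
    using assms(1,2) unfolding negligible_def by blast+
  then show "\<forall>\<^sub>F \<eta> in sequentially. \<bar>h \<eta>\<bar> < 1 / real \<eta> ^ e"
    using eventually_ge_at_top[of 2]
  proof eventually_elim
    case (elim \<eta>)
    have "\<bar>h \<eta>\<bar> < 2 / real \<eta> ^ Suc e" using elim(1,2) assms(3)[of \<eta>] by linarith
    also have "\<dots> \<le> real \<eta> / real \<eta> ^ Suc e" using elim(3) by (intro divide_right_mono) auto
    also have "\<dots> = 1 / real \<eta> ^ e" using elim(3) by simp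
    finally show ?case .
  qed
qed

lemma negligible_exponential: "negligible (\<lambda>\<eta>. C / 2 ^ \<eta>)"
  unfolding negligible_def
proof
  fix e :: nat
  have "(\<lambda>\<eta>. C * (real \<eta> ^ e / 2 ^ \<eta>)) \<longlonglongrightarrow> C * 0"
    by (intro tendsto_mult tendsto_const) real_asymp
  then have "\<forall>\<^sub>F \<eta> in sequentially. \<bar>C * (real \<eta> ^ e / 2 ^ \<eta>)\<bar> < 1"
    by (auto dest!: tendstoD[of _ _ _ 1] simp: dist_real_def)
  then show "\<forall>\<^sub>F \<eta> in sequentially. \<bar>C / 2 ^ \<eta>\<bar> < 1 / real \<eta> ^ e"
    using eventually_gt_at_top[of 0] by eventually_elim (auto simp: field_simps abs_mult)
qed

lemma transcript_conv_map: "transcript A n = map (\<lambda>i. A (Suc i) (transcript A i)) [0..<n]"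
  by (induction n) auto

definition key_index :: "tag \<Rightarrow> nat" where
  "key_index a = (case a of TagA \<Rightarrow> 0 | TagB \<Rightarrow> 1)"

lemma key_index_less: "key_index a < 2" and key_index_inject: "key_index a = key_index b \<longleftrightarrow> a = b"
  by (auto simp: key_index_def split: tag.splits)

text \<open>
  Intermediate games: the tags in a set \<open>I\<close> send two random words. \<open>d i l\<close> is the tag that index \<open>l\<close>
  designates in action \<open>i\<close>.
\<close>

locale protocol =
  fixes M :: model and m :: nat and \<alpha> :: "nat \<Rightarrow> action" and d :: "nat \<Rightarrow> nat \<Rightarrow> tag"
    and Adv :: "nat \<Rightarrow> bits list \<Rightarrow> tape \<Rightarrow> bits"
  assumes computational: "computational_model M" and hash_prf: "prf_family (i_hash M)"
    and Adv: "ptime (\<lambda>\<eta> xs. length xs = Suc m) Adv"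
begin

abbreviation "K \<equiv> 2 * m + 3"

definition hash_oracle :: "nat \<Rightarrow> (nat \<Rightarrow> bits) \<Rightarrow> tag \<Rightarrow> oracle_fun" where
  "hash_oracle \<eta> \<nu> b x = i_hash M \<eta> x (\<nu> (key_index b))"

text \<open>All hashing goes through \<open>h\<close>, one oracle per tag, so that the oracle of a
  single tag can be exchanged while the other tag keeps its keyed hash.\<close>

definition answer_of :: "tag set \<Rightarrow> nat \<Rightarrow> (tag \<Rightarrow> oracle_fun) \<Rightarrow> (nat \<Rightarrow> bits) \<Rightarrow> tape \<Rightarrow> nat \<Rightarrow> bits list \<Rightarrow> bits" where
  "answer_of I \<eta> h \<nu> \<rho> i ts = (case \<alpha> i of
       ReaderInit \<Rightarrow> i_pair M \<eta> (i_num M (card {j \<in> {1..<i}. \<alpha> j = ReaderInit} + 1) \<eta>) (\<nu> (i + 1))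
     | TagMsg l \<Rightarrow> if d i l \<in> I then i_pair M \<eta> (\<nu> (m + 2 + i)) (\<nu> (i + 1))
         else i_pair M \<eta> (bxor (i_ident M (d i l) \<eta>) (h (d i l) (\<nu> (i + 1))))
           (bxor (\<nu> (i + 1)) (h (d i l) (i_att M (G l) (length ts) \<eta> ts \<rho>)))
     | ReaderMsg \<Rightarrow> replicate \<eta> False
     | TagInit l \<Rightarrow> replicate \<eta> False)"

definition guess :: "nat \<Rightarrow> bits list \<Rightarrow> tape \<Rightarrow> bits" where
  "guess \<eta> ts \<rho> = Adv \<eta> (ts @ [i_att M Guess (length ts) \<eta> ts \<rho>]) \<rho>"

text \<open>The average over names takes the place of the honest tape, so that the attacker's tape
  remains as the only probability space.\<close>

definition game :: "tag set \<Rightarrow> nat \<Rightarrow> real" where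
  "game I \<eta> = (\<Sum>\<nu>\<in>vectors \<eta> K. \<P>(\<rho> in random_tape.
     guess \<eta> (transcript (answer_of I \<eta> (hash_oracle \<eta> \<nu>) \<nu> \<rho>) m) \<rho> = [True])) / card (vectors \<eta> K)"

lemma
  ptime_hash: "ptime (\<lambda>\<eta> xs. length xs = 2 \<and> length (xs ! 1) = \<eta>) (\<lambda>\<eta> xs \<rho>. i_hash M \<eta> (xs ! 0) (xs ! 1))" and
  length_hash: "length k = \<eta> \<Longrightarrow> length (i_hash M \<eta> x k) = \<eta>" and
  ptime_pair: "ptime (\<lambda>\<eta> xs. length xs = 2) (\<lambda>\<eta> xs \<rho>. i_pair M \<eta> (xs ! 0) (xs ! 1))" and
  ptime_ident: "ptime (\<lambda>\<eta> xs. xs = []) (\<lambda>\<eta> xs \<rho>. i_ident M a \<eta>)" and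
  length_ident: "length (i_ident M a \<eta>) = \<eta>" and
  ptime_num: "ptime (\<lambda>\<eta> xs. xs = []) (\<lambda>\<eta> xs \<rho>. i_num M j \<eta>)" and
  ptime_att: "ptime (\<lambda>\<eta> xs. length xs = n) (i_att M g n)"
  using computational unfolding computational_model_def ptime_det_def by blast+

lemma measurable_att: "(\<lambda>\<rho>. i_att M g (length ts) \<eta> ts \<rho>) \<in> random_tape \<rightarrow>\<^sub>M count_space UNIV"
  by (rule measurable_ptime[OF ptime_att]) simp

lemma measurable_answer_of: "(\<lambda>\<rho>. answer_of I \<eta> h \<nu> \<rho> i ts) \<in> random_tape \<rightarrow>\<^sub>M count_space UNIV"
proof (cases "\<alpha> i")
  case (TagMsg l)
  have "(\<lambda>\<rho>. i_pair M \<eta> (bxor (i_ident M (d i l) \<eta>) (h (d i l) (\<nu> (i + 1))))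
           (bxor (\<nu> (i + 1)) (h (d i l) (i_att M (G l) (length ts) \<eta> ts \<rho>)))) \<in> random_tape \<rightarrow>\<^sub>M count_space UNIV"
    by (rule measurable_compose[OF measurable_att]) simp
  then show ?thesis using TagMsg by (cases "d i l \<in> I") (simp_all add: answer_of_def)
qed (simp_all add: answer_of_def)

lemma measurable_guess:
  assumes "length ts = m"
  shows "(\<lambda>\<rho>. guess \<eta> ts \<rho>) \<in> random_tape \<rightarrow>\<^sub>M count_space UNIV"
  unfolding guess_def
  by (rule measurable_compose_countable[OF measurable_ptime[OF Adv] measurable_att]) (simp add: assms)

lemma measurable_win:
  assumes "length ts = m"
  shows "(\<lambda>\<rho>. guess \<eta> ts \<rho> = [True]) \<in> random_tape \<rightarrow>\<^sub>M count_space UNIV"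
  by (rule measurable_compose[OF measurable_guess[OF assms]]) simp

lemma answer_of_cong:
  assumes "1 \<le> i" "i \<le> m" "\<And>n. n = i + 1 \<or> n = m + 2 + i \<Longrightarrow> \<nu> n = \<nu>' n"
    "\<And>l. \<alpha> i = TagMsg l \<Longrightarrow> d i l \<notin> I \<Longrightarrow> h (d i l) = h' (d i l)"
  shows "answer_of I \<eta> h \<nu> \<rho> i ts = answer_of I \<eta> h' \<nu>' \<rho> i ts"
  using assms(3)[of "i + 1"] assms(3)[of "m + 2 + i"] assms(4)
  by (cases "\<alpha> i") (auto simp: answer_of_def)

section \<open>The distinguisher as a machine\<close>

lemma computable_pair:
  assumes "computable E" "computable F"
  shows "computable (\<lambda>\<eta> Or \<rho>. i_pair M \<eta> (E \<eta> Or \<rho>) (F \<eta> Or \<rho>))"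
  using computable_ptime[where Fs = "[E, F]" and k = 0, OF ptime_pair] assms by simp

lemma computable_hash:
  assumes "computable E" "computable F" "\<And>\<eta> Or \<rho>. length (F \<eta> Or \<rho>) = \<eta>"
  shows "computable (\<lambda>\<eta> Or \<rho>. i_hash M \<eta> (E \<eta> Or \<rho>) (F \<eta> Or \<rho>))"
  using computable_ptime[where Fs = "[E, F]" and k = 0, OF ptime_hash] assms by simp

lemma computable_ident: "computable (\<lambda>\<eta> Or \<rho>. i_ident M a \<eta>)"
  using computable_ptime[where Fs = "[]" and k = 0, OF ptime_ident] by simp

lemma computable_num: "computable (\<lambda>\<eta> Or \<rho>. i_num M j \<eta>)"
  using computable_ptime[where Fs = "[]" and k = 0, OF ptime_num] by simp

lemma computable_att:
  assumes "\<forall>F\<in>set Fs. computable F"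
  shows "computable (\<lambda>\<eta> Or \<rho>. i_att M g (length Fs) \<eta> (map (\<lambda>F. F \<eta> Or \<rho>) Fs) (\<lambda>i. \<rho> (k * \<eta> + i)))"
  by (rule computable_ptime[OF ptime_att assms]) simp

lemma computable_name: "n < K \<Longrightarrow> computable (\<lambda>\<eta> Or \<rho>. names \<eta> K \<rho> n)"
  using computable_block[of n] by (simp add: names_def)

context
  fixes I :: "tag set" and a :: tag
begin

text \<open>The hash of \<open>a\<close> is left to the external oracle, while the other tag hashes
  with its key from the names, which the distinguisher draws itself.\<close>

definition oracle_answer :: "nat \<Rightarrow> oracle_fun \<Rightarrow> (nat \<Rightarrow> bits) \<Rightarrow> tape \<Rightarrow> nat \<Rightarrow> bits list \<Rightarrow> bits" where
  "oracle_answer \<eta> Or \<nu> = answer_of I \<eta> ((hash_oracle \<eta> \<nu>)(a := Or)) \<nu>"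

definition oracle_transcript :: "nat \<Rightarrow> nat \<Rightarrow> oracle_fun \<Rightarrow> tape \<Rightarrow> bits list" where
  "oracle_transcript n \<eta> Or \<rho> = transcript (oracle_answer \<eta> Or (names \<eta> K \<rho>) (\<lambda>i. \<rho> (K * \<eta> + i))) n"

text \<open>Counted from 0: this is the answer to action \<open>Suc i\<close>. As a function of
  oracle and whole tape it has the form required by \<open>computable\<close>.\<close>

definition oracle_output :: "nat \<Rightarrow> nat \<Rightarrow> oracle_fun \<Rightarrow> tape \<Rightarrow> bits" where
  "oracle_output i \<eta> Or \<rho> = oracle_answer \<eta> Or (names \<eta> K \<rho>) (\<lambda>i. \<rho> (K * \<eta> + i)) (Suc i) (oracle_transcript i \<eta> Or \<rho>)"

lemma oracle_transcript_eq:
  "oracle_transcript n \<eta> Or \<rho> = map (\<lambda>F. F \<eta> Or \<rho>) (map oracle_output [0..<n])"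
  unfolding oracle_transcript_def oracle_output_def by (subst transcript_conv_map) (simp add: o_def)

lemma computable_attacker:
  assumes "\<forall>i<n. computable (oracle_output i)"
  shows "computable (\<lambda>\<eta> Or \<rho>. i_att M g n \<eta> (oracle_transcript n \<eta> Or \<rho>) (\<lambda>i. \<rho> (K * \<eta> + i)))"
proof -
  have "\<forall>F\<in>set (map oracle_output [0..<n]). computable F" using assms by auto
  from computable_att[OF this, of g K] show ?thesis by (simp add: oracle_transcript_eq)
qed

lemma length_oracle:
  assumes "\<And>x. length (Or x) = \<eta>"
  shows "length (((hash_oracle \<eta> (names \<eta> K \<rho>))(a := Or)) b x) = \<eta>"
  using assms key_index_less[of b] by (auto simp: hash_oracle_def names_def block_def intro!: length_hash)

lemma computable_oracle:
  assumes "computable F"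
  shows "computable (\<lambda>\<eta> Or \<rho>. ((hash_oracle \<eta> (names \<eta> K \<rho>))(a := Or)) b (F \<eta> Or \<rho>))"
proof (cases "b = a")
  case True
  then show ?thesis using computable_query[OF assms] by simp
next
  case False
  have "key_index b < K" using key_index_less[of b] by simp
  from computable_hash[OF assms computable_name[OF this]] this show ?thesis
    using False by (simp add: hash_oracle_def names_def block_def)
qed

lemma length_name: "n < K \<Longrightarrow> length (names \<eta> K \<rho> n) = \<eta>"
  by (simp add: names_def block_def)

text \<open>Each answer recomputes all earlier ones from scratch. The number of repetitions depends
  on \<open>m\<close> only, and \<open>m\<close> is fixed, so the time stays polynomial in \<eta>.
  Repetition is consistent because names are read at fixed positions of the tape and the oracle is a
  function.\<close>

lemma computable_oracle_output: "i < m \<Longrightarrow> computable (oracle_output i)"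
proof (induction i rule: less_induct)
  case (less i)
  then have IH: "\<forall>j<i. computable (oracle_output j)" by simp
  have n: "Suc i + 1 < K" "m + 2 + Suc i < K" using less.prems by simp_all
  show ?case
  proof (cases "\<alpha> (Suc i)")
    case ReaderInit
    have "computable (\<lambda>\<eta> Or \<rho>. i_pair M \<eta> (i_num M (card {j \<in> {1..<Suc i}. \<alpha> j = ReaderInit} + 1) \<eta>) (names \<eta> K \<rho> (Suc i + 1)))"
      by (intro computable_pair computable_num computable_name n)
    moreover have "oracle_output i = (\<lambda>\<eta> Or \<rho>. i_pair M \<eta> (i_num M (card {j \<in> {1..<Suc i}. \<alpha> j = ReaderInit} + 1) \<eta>) (names \<eta> K \<rho> (Suc i + 1)))"
      using ReaderInit by (simp add: oracle_output_def oracle_answer_def answer_of_def fun_eq_iff)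
    ultimately show ?thesis by simp
  next
    case (TagMsg l)
    let ?b = "d (Suc i) l"
    show ?thesis
    proof (cases "?b \<in> I")
      case True
      have "computable (\<lambda>\<eta> Or \<rho>. i_pair M \<eta> (names \<eta> K \<rho> (m + 2 + Suc i)) (names \<eta> K \<rho> (Suc i + 1)))"
        by (intro computable_pair computable_name n)
      moreover have "oracle_output i = (\<lambda>\<eta> Or \<rho>. i_pair M \<eta> (names \<eta> K \<rho> (m + 2 + Suc i)) (names \<eta> K \<rho> (Suc i + 1)))"
        using TagMsg True by (simp add: oracle_output_def oracle_answer_def answer_of_def fun_eq_iff)
      ultimately show ?thesis by simp
    next
      case False
      let ?h = "\<lambda>\<eta> Or \<rho>. ((hash_oracle \<eta> (names \<eta> K \<rho>))(a := Or)) ?b"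
      let ?x = "\<lambda>\<eta> Or \<rho>. i_att M (G l) i \<eta> (oracle_transcript i \<eta> Or \<rho>) (\<lambda>i. \<rho> (K * \<eta> + i))"
      have "computable (\<lambda>\<eta> Or \<rho>. i_pair M \<eta>
          (map2 (\<noteq>) (i_ident M ?b \<eta>) (?h \<eta> Or \<rho> (names \<eta> K \<rho> (Suc i + 1))))
          (map2 (\<noteq>) (names \<eta> K \<rho> (Suc i + 1)) (?h \<eta> Or \<rho> (?x \<eta> Or \<rho>))))"
        by (intro computable_pair computable_xor computable_ident computable_name computable_oracle computable_attacker n IH
            conjI length_ident length_oracle length_name)
      moreover have "oracle_output i = (\<lambda>\<eta> Or \<rho>. i_pair M \<eta>
          (map2 (\<noteq>) (i_ident M ?b \<eta>) (?h \<eta> Or \<rho> (names \<eta> K \<rho> (Suc i + 1))))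
          (map2 (\<noteq>) (names \<eta> K \<rho> (Suc i + 1)) (?h \<eta> Or \<rho> (?x \<eta> Or \<rho>))))"
        using TagMsg False
        by (intro ext) (simp only: oracle_output_def oracle_answer_def answer_of_def bxor_def oracle_transcript_def
            length_transcript action.case if_False)
      ultimately show ?thesis by simp
    qed
  next
    case ReaderMsg
    then have "oracle_output i = (\<lambda>\<eta> Or \<rho>. replicate \<eta> False)"
      by (simp add: oracle_output_def oracle_answer_def answer_of_def fun_eq_iff)
    then show ?thesis using computable_zero by simp
  next
    case (TagInit l)
    then have "oracle_output i = (\<lambda>\<eta> Or \<rho>. replicate \<eta> False)"
      by (simp add: oracle_output_def oracle_answer_def answer_of_def fun_eq_iff)
    then show ?thesis using computable_zero by simp
  qed
qed

definition distinguisher :: "nat \<Rightarrow> oracle_fun \<Rightarrow> tape \<Rightarrow> bits" where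
  "distinguisher \<eta> Or \<rho> = guess \<eta> (oracle_transcript m \<eta> Or \<rho>) (\<lambda>i. \<rho> (K * \<eta> + i))"

lemma oracle_ptime_distinguisher: "oracle_ptime distinguisher"
proof (rule computable_imp_oracle_ptime)
  let ?g = "\<lambda>\<eta> Or \<rho>. i_att M Guess m \<eta> (oracle_transcript m \<eta> Or \<rho>) (\<lambda>i. \<rho> (K * \<eta> + i))"
  let ?Fs = "map oracle_output [0..<m] @ [?g]"
  have "computable ?g" by (rule computable_attacker) (simp add: computable_oracle_output)
  then have "\<forall>F\<in>set ?Fs. computable F" by (auto intro: computable_oracle_output)
  from computable_ptime[OF Adv this, of K]
  have "computable (\<lambda>\<eta> Or \<rho>. Adv \<eta> (map (\<lambda>F. F \<eta> Or \<rho>) ?Fs) (\<lambda>i. \<rho> (K * \<eta> + i)))" by simp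
  moreover have "(\<lambda>\<eta> Or \<rho>. Adv \<eta> (map (\<lambda>F. F \<eta> Or \<rho>) ?Fs) (\<lambda>i. \<rho> (K * \<eta> + i))) = distinguisher"
    by (intro ext) (simp add: distinguisher_def guess_def oracle_transcript_eq)
  ultimately show "computable distinguisher" by simp
qed

end

section \<open>The two sides of the PRF experiment as games\<close>

lemma sets_win:
  assumes "(\<lambda>p. ts p) \<in> N \<rightarrow>\<^sub>M count_space UNIV" "(\<lambda>p. r p) \<in> N \<rightarrow>\<^sub>M random_tape" "\<And>p. length (ts p) = m"
  shows "{p \<in> space N. guess \<eta> (ts p) (r p) = [True]} \<in> sets N"
proof -
  have "(\<lambda>p. (\<lambda>us p. length us = m \<and> guess \<eta> us (r p) = [True]) (ts p) p) \<in> N \<rightarrow>\<^sub>M count_space UNIV"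
  proof (rule measurable_compose_countable[OF _ assms(1)])
    show "(\<lambda>p. length us = m \<and> guess \<eta> us (r p) = [True]) \<in> N \<rightarrow>\<^sub>M count_space UNIV" for us :: "bits list"
      using measurable_compose[OF assms(2) measurable_win[of us]] by (cases "length us = m") auto
  qed
  from measurable_sets[OF this, of "{True}"] show ?thesis
    by (simp add: assms(3) vimage_def Int_def conj_commute)
qed

lemma sets_game: "{\<rho>. guess \<eta> (transcript (answer_of I \<eta> h \<nu> \<rho>) m) \<rho> = [True]} \<in> sets random_tape"
  using sets_win[of "\<lambda>\<rho>. transcript (answer_of I \<eta> h \<nu> \<rho>) m" random_tape "\<lambda>\<rho>. \<rho>" \<eta>]
    measurable_transcript[of "answer_of I \<eta> h \<nu>", OF measurable_answer_of] by simp

lemma distinguisher_eq: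
  "distinguisher I a \<eta> Or \<rho> = guess \<eta> (transcript (oracle_answer I a \<eta> Or (names \<eta> K \<rho>) (\<lambda>i. \<rho> (K * \<eta> + i))) m) (\<lambda>i. \<rho> (K * \<eta> + i))"
  by (simp add: distinguisher_def oracle_transcript_def)

text \<open>The oracle's key is uniform and independent of the names, so it can be put in the place
  of the name at \<open>key_index a\<close>; redrawing one coordinate of a uniform vector gives a
  uniform vector.\<close>

lemma prob_keyed_game:
  "\<P>((k, \<rho>) in uniform_bits \<eta> \<Otimes>\<^sub>M random_tape. distinguisher I a \<eta> (\<lambda>x. i_hash M \<eta> x k) \<rho> = [True]) = game I \<eta>"
proof -
  let ?V = "vectors \<eta> K" and ?U = "uniform_bits \<eta>"
  let ?\<phi> = "\<lambda>k \<nu> \<rho>. guess \<eta> (transcript (oracle_answer I a \<eta> (\<lambda>x. i_hash M \<eta> x k) \<nu> \<rho>) m) \<rho> = [True]"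
  let ?G = "\<lambda>\<nu>. \<P>(\<rho> in random_tape. guess \<eta> (transcript (answer_of I \<eta> (hash_oracle \<eta> \<nu>) \<nu> \<rho>) m) \<rho> = [True])"
  have T: "{\<rho> \<in> space random_tape. ?\<phi> k \<nu> \<rho>} \<in> sets random_tape" for k \<nu>
    using sets_game by (simp add: oracle_answer_def)
  have UT: "{p \<in> space (?U \<Otimes>\<^sub>M random_tape). ?\<phi> (fst p) \<nu> (snd p)} \<in> sets (?U \<Otimes>\<^sub>M random_tape)" for \<nu>
  proof -
    have "{p \<in> space (?U \<Otimes>\<^sub>M random_tape). ?\<phi> (fst p) \<nu> (snd p)} = (\<Union>k\<in>words \<eta>. {k} \<times> {\<rho> \<in> space random_tape. ?\<phi> k \<nu> \<rho>})"
      by (auto simp: space_pair_measure space_uniform_bits)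
    also have "\<dots> \<in> sets (?U \<Otimes>\<^sub>M random_tape)"
      by (intro sets.finite_UN finite_words pair_measureI T) (simp add: sets_uniform_bits)
    finally show ?thesis .
  qed
  \<comment> \<open>Keys enter the answers through the hashes alone: for \<open>i \<ge> 1\<close>
    the positions \<open>i + 1\<close> and \<open>m + 2 + i\<close> are at least 2.\<close>
  have key: "?\<phi> k \<nu> \<rho> \<longleftrightarrow> guess \<eta> (transcript (answer_of I \<eta> (hash_oracle \<eta> (\<nu>(key_index a := k))) (\<nu>(key_index a := k)) \<rho>) m) \<rho> = [True]"
    for k \<nu> \<rho>
  proof -
    have h: "(hash_oracle \<eta> \<nu>)(a := \<lambda>x. i_hash M \<eta> x k) = hash_oracle \<eta> (\<nu>(key_index a := k))"
      by (intro ext) (simp add: hash_oracle_def key_index_inject)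
    have "transcript (oracle_answer I a \<eta> (\<lambda>x. i_hash M \<eta> x k) \<nu> \<rho>) m =
      transcript (answer_of I \<eta> (hash_oracle \<eta> (\<nu>(key_index a := k))) (\<nu>(key_index a := k)) \<rho>) m"
      unfolding oracle_answer_def h
      by (intro transcript_cong answer_of_cong) (use key_index_less[of a] in auto)
    then show ?thesis by simp
  qed
  have "\<P>((k, \<rho>) in ?U \<Otimes>\<^sub>M random_tape. distinguisher I a \<eta> (\<lambda>x. i_hash M \<eta> x k) \<rho> = [True]) =
    \<P>(p in ?U \<Otimes>\<^sub>M random_tape. ?\<phi> (fst p) (names \<eta> K (snd p)) (\<lambda>i. snd p (K * \<eta> + i)))"
    by (simp only: distinguisher_eq split_beta' prod.collapse)
  also have "\<dots> = (\<Sum>\<nu>\<in>?V. \<P>(p in ?U \<Otimes>\<^sub>M random_tape. ?\<phi> (fst p) \<nu> (snd p))) / card ?V"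
    by (rule prob_tape_average[OF prob_space_uniform_bits UT])
  also have "\<dots> = (\<Sum>\<nu>\<in>?V. (\<Sum>k\<in>words \<eta>. \<P>(\<rho> in random_tape. ?\<phi> k \<nu> \<rho>)) / card (words \<eta>)) / card ?V"
    by (intro arg_cong2[of _ _ _ _ "(/)"] sum.cong refl prob_uniform_bits_average[OF prob_space_random_tape T])
  also have "(\<Sum>\<nu>\<in>?V. (\<Sum>k\<in>words \<eta>. \<P>(\<rho> in random_tape. ?\<phi> k \<nu> \<rho>)) / card (words \<eta>)) =
     (\<Sum>k\<in>words \<eta>. \<Sum>\<nu>\<in>?V. ?G (\<nu>(key_index a := k))) / card (words \<eta>)"
    unfolding sum_divide_distrib[symmetric] key by (subst sum.swap) (rule refl)
  also have "\<dots> = (\<Sum>\<nu>\<in>?V. ?G \<nu>)"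
    by (subst sum_vectors_resample) (use key_index_less[of a] in \<open>auto simp: card_words\<close>)
  finally show ?thesis by (simp only: game_def)
qed

text \<open>An answer outside the set is determined by the keys and the names of its own action,
  apart from tape and history; this gives the locale assumption on \<open>B\<close>.\<close>

lemma hop_protocol:
  assumes "a \<notin> I"
  shows "hop m \<eta> {i \<in> {1..m}. \<exists>l. \<alpha> i = TagMsg l \<and> d i l = a} (i_ident M a \<eta>)
    (\<lambda>i \<rho> ts. case \<alpha> i of TagMsg l \<Rightarrow> i_att M (G l) (length ts) \<eta> ts \<rho> | _ \<Rightarrow> [])
    (\<lambda>i \<nu> \<rho>. answer_of I \<eta> (hash_oracle \<eta> \<nu>) \<nu> \<rho> i) (\<lambda>ts \<rho>. guess \<eta> ts \<rho> = [True])"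
proof
  show "i_ident M a \<eta> \<in> words \<eta>" by (simp add: words_def length_ident)
next
  fix i and \<nu> \<nu>' :: "nat \<Rightarrow> bits" and \<rho> ts
  assume i: "1 \<le> i" "i \<le> m" "i \<notin> {i \<in> {1..m}. \<exists>l. \<alpha> i = TagMsg l \<and> d i l = a}"
    and eq: "\<And>n. (\<And>j. j \<in> {i \<in> {1..m}. \<exists>l. \<alpha> i = TagMsg l \<and> d i l = a} \<Longrightarrow> n \<noteq> j + 1 \<and> n \<noteq> m + 2 + j) \<Longrightarrow> \<nu> n = \<nu>' n"
  \<comment> \<open>\<open>j \<ge> 1\<close> keeps \<open>j + 1\<close> and \<open>m + 2 + j\<close>
    away from the key positions 0 and 1.\<close>
  have "\<nu> (key_index b) = \<nu>' (key_index b)" for b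
    by (rule eq) (use key_index_less[of b] in auto)
  then have h: "hash_oracle \<eta> \<nu> = hash_oracle \<eta> \<nu>'" by (simp add: hash_oracle_def fun_eq_iff)
  show "answer_of I \<eta> (hash_oracle \<eta> \<nu>) \<nu> \<rho> i ts = answer_of I \<eta> (hash_oracle \<eta> \<nu>') \<nu>' \<rho> i ts"
    unfolding h
  proof (rule answer_of_cong[OF i(1,2)])
    show "\<nu> n = \<nu>' n" if "n = i + 1 \<or> n = m + 2 + i" for n
      by (rule eq) (use that i in auto)
  qed simp
next
  show "(\<lambda>\<rho>. case \<alpha> i of TagMsg l \<Rightarrow> i_att M (G l) (length ts) \<eta> ts \<rho> | _ \<Rightarrow> []) \<in> random_tape \<rightarrow>\<^sub>M count_space UNIV" for i ts
    using measurable_att by (cases "\<alpha> i") simp_all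
qed (auto intro: measurable_answer_of measurable_win)

text \<open>The real game of the locale is the distinguisher run on a random function, and its ideal
  game is the protocol game in which \<open>a\<close> is idealised as well.\<close>

lemma prob_random_game:
  assumes "a \<notin> I"
  shows "\<bar>\<P>((g, \<rho>) in random_function \<eta> \<Otimes>\<^sub>M random_tape. distinguisher I a \<eta> g \<rho> = [True]) - game (insert a I) \<eta>\<bar>
    \<le> 2 * real m ^ 2 / 2 ^ \<eta>"
proof -
  let ?S = "{i \<in> {1..m}. \<exists>l. \<alpha> i = TagMsg l \<and> d i l = a}"
  let ?q = "\<lambda>i \<rho> ts. case \<alpha> i of TagMsg l \<Rightarrow> i_att M (G l) (length ts) \<eta> ts \<rho> | _ \<Rightarrow> []"
  let ?V = "vectors \<eta> K" and ?N = "random_function \<eta> \<Otimes>\<^sub>M random_tape"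
  interpret H: hop m \<eta> ?S "i_pair M \<eta>" "i_ident M a \<eta>" ?q
    "\<lambda>i \<nu> \<rho>. answer_of I \<eta> (hash_oracle \<eta> \<nu>) \<nu> \<rho> i" "\<lambda>ts \<rho>. guess \<eta> ts \<rho> = [True]"
    by (rule hop_protocol[OF assms])
  have real: "transcript (H.real_answer g \<nu> \<rho>) m = transcript (oracle_answer I a \<eta> g \<nu> \<rho>) m" for g \<nu> \<rho>
  proof (rule transcript_cong)
    fix i assume i: "1 \<le> i" "i \<le> m"
    have "H.real_answer g \<nu> \<rho> i ts = oracle_answer I a \<eta> g \<nu> \<rho> i ts" for ts
    proof (cases "i \<in> ?S")
      case True
      then obtain l where "\<alpha> i = TagMsg l" "d i l = a" by blast
      then show ?thesis
        unfolding H.real_answer_def if_P[OF True] using assms by (simp add: oracle_answer_def answer_of_def)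
    next
      case False
      \<comment> \<open>Outside \<open>?S\<close> tag \<open>a\<close> is not designated, so its
        oracle can be exchanged freely.\<close>
      have "answer_of I \<eta> (hash_oracle \<eta> \<nu>) \<nu> \<rho> i ts = answer_of I \<eta> ((hash_oracle \<eta> \<nu>)(a := g)) \<nu> \<rho> i ts"
        by (rule answer_of_cong[OF i]) (use False i in auto)
      then show ?thesis using False by (simp only: H.real_answer_def oracle_answer_def if_False)
    qed
    then show "H.real_answer g \<nu> \<rho> i (transcript (H.real_answer g \<nu> \<rho>) (i - 1)) =
      oracle_answer I a \<eta> g \<nu> \<rho> i (transcript (H.real_answer g \<nu> \<rho>) (i - 1))" .
  qed
  have ideal: "transcript (H.ideal_answer \<nu> \<rho>) m = transcript (answer_of (insert a I) \<eta> (hash_oracle \<eta> \<nu>) \<nu> \<rho>) m" for \<nu> \<rho>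
  proof (rule transcript_cong)
    fix i assume i: "1 \<le> i" "i \<le> m"
    have "H.ideal_answer \<nu> \<rho> i ts = answer_of (insert a I) \<eta> (hash_oracle \<eta> \<nu>) \<nu> \<rho> i ts" for ts
    proof (cases "i \<in> ?S")
      case True
      then obtain l where "\<alpha> i = TagMsg l" "d i l = a" by blast
      then show ?thesis
        unfolding H.ideal_answer_def if_P[OF True] by (simp add: answer_of_def)
    next
      case False
      then have "answer_of I \<eta> (hash_oracle \<eta> \<nu>) \<nu> \<rho> i ts = answer_of (insert a I) \<eta> (hash_oracle \<eta> \<nu>) \<nu> \<rho> i ts"
        using i by (cases "\<alpha> i") (auto simp: answer_of_def)
      then show ?thesis using False by (simp only: H.ideal_answer_def if_False)
    qed
    then show "H.ideal_answer \<nu> \<rho> i (transcript (H.ideal_answer \<nu> \<rho>) (i - 1)) =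
      answer_of (insert a I) \<eta> (hash_oracle \<eta> \<nu>) \<nu> \<rho> i (transcript (H.ideal_answer \<nu> \<rho>) (i - 1))" .
  qed
  let ?\<phi> = "\<lambda>g \<nu> \<rho>. guess \<eta> (transcript (oracle_answer I a \<eta> g \<nu> \<rho>) m) \<rho> = [True]"
  have sets: "{p \<in> space ?N. ?\<phi> (fst p) \<nu> (snd p)} \<in> sets ?N" for \<nu>
    using sets_win[OF H.measurable_real measurable_snd] by (simp only: real length_transcript)
  have "\<P>((g, \<rho>) in ?N. distinguisher I a \<eta> g \<rho> = [True]) =
    \<P>(p in ?N. ?\<phi> (fst p) (names \<eta> K (snd p)) (\<lambda>i. snd p (K * \<eta> + i)))"
    by (simp only: distinguisher_eq split_beta' prod.collapse)
  also have "\<dots> = (\<Sum>\<nu>\<in>?V. \<P>(p in ?N. ?\<phi> (fst p) \<nu> (snd p))) / card ?V"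
    by (rule prob_tape_average[OF prob_space_random_function sets])
  finally have 1: "\<P>((g, \<rho>) in ?N. distinguisher I a \<eta> g \<rho> = [True]) = (\<Sum>\<nu>\<in>?V. \<P>(p in ?N. ?\<phi> (fst p) \<nu> (snd p))) / card ?V" .
  interpret T: prob_space random_tape by (rule prob_space_random_tape)
  interpret R: prob_space "random_function \<eta>" by (rule prob_space_random_function)
  \<comment> \<open>The ideal game contains no random function any more, so this factor of the
    product integrates to 1.\<close>
  have 2: "\<P>(p in ?N. guess \<eta> (transcript (answer_of (insert a I) \<eta> (hash_oracle \<eta> \<nu>) \<nu> (snd p)) m) (snd p) = [True]) =
    \<P>(\<rho> in random_tape. guess \<eta> (transcript (answer_of (insert a I) \<eta> (hash_oracle \<eta> \<nu>) \<nu> \<rho>) m) \<rho> = [True])" for \<nu>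
  proof -
    let ?E = "{\<rho>. guess \<eta> (transcript (answer_of (insert a I) \<eta> (hash_oracle \<eta> \<nu>) \<nu> \<rho>) m) \<rho> = [True]}"
    have "{p \<in> space ?N. snd p \<in> ?E} = space (random_function \<eta>) \<times> ?E"
      by (auto simp: space_pair_measure)
    moreover have "emeasure ?N (space (random_function \<eta>) \<times> ?E) = emeasure random_tape ?E"
      by (subst T.emeasure_pair_measure_Times) (auto simp: sets_game R.emeasure_space_1)
    ultimately show ?thesis by (simp add: measure_def)
  qed
  show ?thesis
    using H.statistical_hop unfolding real ideal 1 2 game_def .
qed

text \<open>The probability for a random function lies between the two games: the PRF assumption
  bounds its distance to the first, the coupling its distance to the second.\<close>

lemma game_hop:
  assumes "a \<notin> I"
  shows "negligible (\<lambda>\<eta>. \<bar>game I \<eta> - game (insert a I) \<eta>\<bar>)"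
proof (rule negligible_bound[OF _ negligible_exponential])
  let ?R = "\<lambda>\<eta>. \<P>((g, \<rho>) in random_function \<eta> \<Otimes>\<^sub>M random_tape. distinguisher I a \<eta> g \<rho> = [True])"
  show "negligible (\<lambda>\<eta>. \<bar>game I \<eta> - ?R \<eta>\<bar>)"
    using hash_prf oracle_ptime_distinguisher[of I a] unfolding prf_family_def prob_keyed_game[where I = I and a = a, symmetric] by blast
  show "\<bar>\<bar>game I \<eta> - game (insert a I) \<eta>\<bar>\<bar> \<le> \<bar>game I \<eta> - ?R \<eta>\<bar> + 2 * real m ^ 2 / 2 ^ \<eta>" for \<eta>
    using prob_random_game[OF assms, of \<eta>] by linarith
qed

lemma game_all: "negligible (\<lambda>\<eta>. \<bar>game {} \<eta> - game UNIV \<eta>\<bar>)"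
proof (rule negligible_bound)
  show "negligible (\<lambda>\<eta>. \<bar>game {} \<eta> - game {TagA} \<eta>\<bar>)"
    by (rule game_hop) simp
  show "negligible (\<lambda>\<eta>. \<bar>game {TagA} \<eta> - game (insert TagB {TagA}) \<eta>\<bar>)"
    by (rule game_hop) simp
  have "UNIV = insert TagB {TagA}"
    using tag.exhaust by auto
  then show "\<bar>\<bar>game {} \<eta> - game UNIV \<eta>\<bar>\<bar> \<le> \<bar>game {} \<eta> - game {TagA} \<eta>\<bar> + \<bar>game {TagA} \<eta> - game (insert TagB {TagA}) \<eta>\<bar>" for \<eta>
    by simp
qed

end

section \<open>Frames as games\<close>

lemma eval_frame:
  assumes "protocol M m Adv" "i \<le> m"
  shows "map (eval M \<eta> \<rho>1 \<rho>2) (frame s p \<alpha> (Suc i)) =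
    transcript (protocol.answer_of M m \<alpha> (designated s p) {} \<eta> (protocol.hash_oracle M \<eta> (names \<eta> (2 * m + 3) \<rho>1)) (names \<eta> (2 * m + 3) \<rho>1) \<rho>2) i"
  using assms(2)
proof (induction i)
  case (Suc i)
  interpret protocol M m \<alpha> "designated s p" Adv by fact
  let ?\<nu> = "names \<eta> K \<rho>1"
  let ?\<phi> = "frame s p \<alpha> (Suc i)"
  have IH: "map (eval M \<eta> \<rho>1 \<rho>2) ?\<phi> = transcript (answer_of {} \<eta> (hash_oracle \<eta> ?\<nu>) ?\<nu> \<rho>2) i" (is "_ = ?ts")
    using Suc by simp
  \<comment> \<open>The interpretation of an attacker symbol depends on its number of arguments, so
    the lengths of frame and transcript have to match.\<close>
  have len: "length ?\<phi> = i" using arg_cong[OF IH, of length] by simp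
  \<comment> \<open>\<open>fresh (Suc i)\<close> is name number \<open>Suc i + 1\<close>, which lies
    below \<open>2 * m + 3\<close> since \<open>Suc i \<le> m\<close>.\<close>
  have fresh: "eval M \<eta> \<rho>1 \<rho>2 (fresh (Suc i)) = ?\<nu> (Suc i + 1)"
    using Suc.prems by (simp add: fresh_def names_def)
  have key: "eval M \<eta> \<rho>1 \<rho>2 (key b) = ?\<nu> (key_index b)" for b
    by (cases b) (simp_all add: key_def key_index_def names_def)
  have "eval M \<eta> \<rho>1 \<rho>2 (answer s p \<alpha> (Suc i) ?\<phi>) = answer_of {} \<eta> (hash_oracle \<eta> ?\<nu>) ?\<nu> \<rho>2 (Suc i) ?ts"
    by (cases "\<alpha> (Suc i)")
      (simp_all add: answer_def answer_of_def tag_answer_def fresh key IH len hash_oracle_def bxor_def)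
  then show ?case using IH by simp
qed simp

lemma prob_frame:
  assumes "protocol M m Adv"
  shows "\<P>((\<rho>1, \<rho>2) in random_tape \<Otimes>\<^sub>M random_tape.
      Adv \<eta> (map (eval M \<eta> \<rho>1 \<rho>2) (frame s p \<alpha> (m + 1) @ [Att Guess (frame s p \<alpha> (m + 1))])) \<rho>2 = [True]) =
    protocol.game M m \<alpha> (designated s p) Adv {} \<eta>"
proof -
  interpret protocol M m \<alpha> "designated s p" Adv by fact
  let ?ts = "\<lambda>\<nu> \<rho>. transcript (answer_of {} \<eta> (hash_oracle \<eta> \<nu>) \<nu> \<rho>) m"
  have len: "length (frame s p \<alpha> (Suc m)) = m"
    using arg_cong[OF eval_frame[OF assms order_refl], of length] by simp
  have "Adv \<eta> (map (eval M \<eta> \<rho>1 \<rho>2) (frame s p \<alpha> (m + 1) @ [Att Guess (frame s p \<alpha> (m + 1))])) \<rho>2 =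
    guess \<eta> (?ts (names \<eta> K \<rho>1) \<rho>2) \<rho>2" for \<rho>1 \<rho>2
    using eval_frame[OF assms order_refl, of \<eta> \<rho>1 \<rho>2] by (simp add: guess_def len)
  then have "\<P>((\<rho>1, \<rho>2) in random_tape \<Otimes>\<^sub>M random_tape.
      Adv \<eta> (map (eval M \<eta> \<rho>1 \<rho>2) (frame s p \<alpha> (m + 1) @ [Att Guess (frame s p \<alpha> (m + 1))])) \<rho>2 = [True]) =
    \<P>((\<rho>1, \<rho>2) in random_tape \<Otimes>\<^sub>M random_tape. guess \<eta> (?ts (names \<eta> K \<rho>1) \<rho>2) \<rho>2 = [True])"
    by simp
  also have "\<dots> = game {} \<eta>"
    unfolding game_def by (rule prob_tape_pair_average) (rule sets_game)
  finally show ?thesis .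
qed

lemma length_frame: "length (frame s p \<alpha> (Suc i)) = i"
  by (induction i) auto

text \<open>\<open>d\<close> enters an answer through the test \<open>d i l \<in> I\<close> and the
  branch in which it fails; for \<open>I = UNIV\<close> it never fails.\<close>

lemma game_UNIV_eq:
  assumes "protocol M m Adv"
  shows "protocol.game M m \<alpha> d Adv UNIV \<eta> = protocol.game M m \<alpha> d' Adv UNIV \<eta>"
proof -
  interpret P: protocol M m \<alpha> d Adv by fact
  interpret P': protocol M m \<alpha> d' Adv by fact
  have "P.answer_of UNIV = P'.answer_of UNIV"
    unfolding P.answer_of_def P'.answer_of_def by (intro ext) (auto split: action.splits)
  then show ?thesis
    by (simp add: P.game_def P'.game_def)
qed

theorem theorem2:
  fixes M :: model and m p q :: nat and \<alpha> :: "nat \<Rightarrow> action"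
  assumes "m \<ge> 1" and "p + q = m"
    and "\<And>i. 1 \<le> i \<Longrightarrow> i \<le> p \<Longrightarrow> \<alpha> i \<in> phase1_actions"
    and "\<And>i. p < i \<Longrightarrow> i \<le> m \<Longrightarrow> \<alpha> i \<in> phase2_actions"
    and "computational_model M"
    and "prf_family (i_hash M)"
  shows "indistinguishable M
    (frame LeftSide p \<alpha> (m + 1) @ [Att Guess (frame LeftSide p \<alpha> (m + 1))])
    (frame RightSide p \<alpha> (m + 1) @ [Att Guess (frame RightSide p \<alpha> (m + 1))])"
  unfolding indistinguishable_def
proof (intro conjI allI impI)
  fix Adv
  let ?n = "length (frame LeftSide p \<alpha> (m + 1) @ [Att Guess (frame LeftSide p \<alpha> (m + 1))])"
  assume "ptime (\<lambda>\<eta> xs. length xs = ?n) Adv"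
  then have Adv: "ptime (\<lambda>\<eta> xs. length xs = Suc m) Adv"
    by (simp add: length_frame)
  have P: "protocol M m Adv"
    by unfold_locales (fact assms(5), fact assms(6), fact Adv)
  let ?game = "\<lambda>s. protocol.game M m \<alpha> (designated s p) Adv"
  have hyb: "negligible (\<lambda>\<eta>. \<bar>?game s {} \<eta> - ?game s UNIV \<eta>\<bar>)" for s
    by (rule protocol.game_all[OF P])
  \<comment> \<open>Both frames are within negligible distance of one and the same game with both
    tags idealised.\<close>
  have "negligible (\<lambda>\<eta>. \<bar>?game LeftSide {} \<eta> - ?game RightSide {} \<eta>\<bar>)"
  proof (rule negligible_bound[OF hyb[of LeftSide] hyb[of RightSide]])
    show "\<bar>\<bar>?game LeftSide {} \<eta> - ?game RightSide {} \<eta>\<bar>\<bar> \<le>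
        \<bar>?game LeftSide {} \<eta> - ?game LeftSide UNIV \<eta>\<bar> + \<bar>?game RightSide {} \<eta> - ?game RightSide UNIV \<eta>\<bar>" for \<eta>
      using game_UNIV_eq[OF P, of \<alpha> "designated LeftSide p" \<eta> "designated RightSide p"] by linarith
  qed
  then show "negligible (\<lambda>\<eta>.
       \<bar>\<P>((\<rho>1, \<rho>2) in random_tape \<Otimes>\<^sub>M random_tape.
          Adv \<eta> (map (eval M \<eta> \<rho>1 \<rho>2) (frame LeftSide p \<alpha> (m + 1) @ [Att Guess (frame LeftSide p \<alpha> (m + 1))])) \<rho>2 = [True])
        - \<P>((\<rho>1, \<rho>2) in random_tape \<Otimes>\<^sub>M random_tape.
          Adv \<eta> (map (eval M \<eta> \<rho>1 \<rho>2) (frame RightSide p \<alpha> (m + 1) @ [Att Guess (frame RightSide p \<alpha> (m + 1))])) \<rho>2 = [True])\<bar>)"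
    by (simp only: prob_frame[OF P])
qed (simp add: length_frame)

end
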